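(* For each sample size $n$ let $p=p_n$ and $q_n$ be positive integers, let $p_1=p_{1,n},\ldots,p_{q_n}=p_{q_n,n}$ be positive integers with $\sum_{i=1}^{q_n}p_i=p$, and let $X_1,\ldots,X_n$ be independent identically $\mathcal{N}(\mu,\Sigma)$-distributed random vectors, where $\mu\in\mathbb{R}^p$ and $\Sigma\in\mathbb{R}^{p\times p}$ is positive definite ($\mu$ and $\Sigma$ may depend on $n$). Let $\Sigma=(\Sigma_{ij})_{i,j=1,\ldots,q_n}$ be the block decomposition of $\Sigma$ with blocks $\Sigma_{ij}\in\mathbb{R}^{p_i\times p_j}$, and let $\Lambda_n$ be the likelihood ratio statistic (defined in the context) for the null hypothesis $$H_0:\ \Sigma_{ij}=0\quad\text{for all } i\neq j .$$ Assume that, as $n\to\infty$, $q_n\to\infty$, $p_i/n\to\lambda_i\in(0,1)$ for every fixed $i\ge 1$, $p/n\to c<1$, and $\sum_{i=1}^\infty\lambda_i=c$. Then, under the null hypothesis $H_0$, $$\frac{2}{n}\log\Lambda_n-s_n\ \xrightarrow{\mathcal{D}}\ \mathcal{N}(0,\sigma^2)\qquad (n\to\infty),$$ where $$\sigma^2=2\log\Big((1-c)^{-1}\prod_{i=1}^\infty(1-\lambda_i)\Big),$$ $$s_n=\sum_{i=1}^{q_n}(n-p_i-1)\log\Big(1-\frac{p_i}{n-1}\Big)-(n-p-1)\log\Big(1-\frac{p}{n-1}\Big)-\frac{\sigma^2}{4}.$$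
   Context: $\mathcal{N}(\mu,\Sigma)$ denotes the multivariate normal distribution with mean $\mu$ and covariance matrix $\Sigma$, $|\cdot|$ denotes the determinant, and $\xrightarrow{\mathcal{D}}$ denotes weak convergence (convergence in distribution). The block decomposition corresponds to decomposing a vector $X\sim\mathcal{N}(\mu,\Sigma)$ as $X=({X^{(1)}}^\top,\ldots,{X^{(q_n)}}^\top)^\top$ with $X^{(i)}$ of dimension $p_i$, so that $\Sigma_{ij}=\operatorname{Cov}(X^{(i)},X^{(j)})$. Let $\overline{X}=\frac1n\sum_{k=1}^nX_k$ and $$\hat\Sigma=\frac1n\sum_{k=1}^n(X_k-\overline{X})(X_k-\overline{X})^\top ,$$ and let $\hat\Sigma_{ij}\in\mathbb{R}^{p_i\times p_j}$ be the block of $\hat\Sigma$ in the $i$th block row and $j$th block column of the same decomposition. The likelihood ratio statistic is $$\Lambda_n=\frac{|\hat\Sigma|^{n/2}}{\prod_{i=1}^{q_n}|\hat\Sigma_{ii}|^{n/2}} .$$ Since $p/n\to c<1$, it is almost surely well defined and positive for all sufficiently large $n$. *)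

theory Defs
  imports
    "HOL-Probability.Probability"
    "Jordan_Normal_Form.Determinant"
    "Jordan_Normal_Form.Gauss_Jordan_Elimination"
begin

text \<open>
  The dimension \<open>p\<close> varies with the sample size, so points of \<open>\<real>\<^sup>p\<close> are taken as elements of
  \<open>Pi\<^sub>M {..<p} (\<lambda>_. borel)\<close>, and matrices and parameter vectors as the dimension-carrying
  types of \<^theory>\<open>Jordan_Normal_Form.Matrix\<close>. All indices (coordinates, blocks,
  observations) start at 0.
\<close>

hide_type (open) Finite_Cartesian_Product.vec
hide_const (open) Finite_Cartesian_Product.vec Finite_Cartesian_Product.mat Determinants.det

definition positive_definite :: "real mat \<Rightarrow> bool" where
  "positive_definite A \<longleftrightarrow> square_mat A \<and> transpose_mat A = A \<and>
     (\<forall>v \<in> carrier_vec (dim_row A). v \<noteq> 0\<^sub>v (dim_row A) \<longrightarrow> scalar_prod v (A *\<^sub>v v) > 0)"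

text \<open>
  The nondegenerate normal distribution; meaningful for \<open>\<Sigma>\<close> positive definite of the same
  dimension as \<open>\<mu>\<close>, in which case \<open>mat_inverse\<close> does not return \<open>None\<close>.
\<close>

definition multivariate_normal_density :: "real vec \<Rightarrow> real mat \<Rightarrow> (nat \<Rightarrow> real) \<Rightarrow> real" where
  "multivariate_normal_density \<mu> \<Sigma> x =
     (let v = vec (dim_vec \<mu>) x - \<mu> in
      exp (- scalar_prod v (the (mat_inverse \<Sigma>) *\<^sub>v v) / 2) /
      sqrt ((2 * pi) ^ dim_vec \<mu> * det \<Sigma>))"

definition multivariate_normal :: "real vec \<Rightarrow> real mat \<Rightarrow> (nat \<Rightarrow> real) measure" where
  "multivariate_normal \<mu> \<Sigma> =
     density (Pi\<^sub>M {..<dim_vec \<mu>} (\<lambda>_. lborel))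
       (\<lambda>x. ennreal (multivariate_normal_density \<mu> \<Sigma> x))"

text \<open>The block in block row \<open>i\<close> and block column \<open>j\<close>, for diagonal blocks of sizes \<open>d 0, d 1, \<dots>\<close>.\<close>

definition mat_block :: "(nat \<Rightarrow> nat) \<Rightarrow> real mat \<Rightarrow> nat \<Rightarrow> nat \<Rightarrow> real mat" where
  "mat_block d A i j = mat (d i) (d j) (\<lambda>(a, b). A $$ ((\<Sum>l<i. d l) + a, (\<Sum>l<j. d l) + b))"

text \<open>For data \<open>x\<close>, \<open>x k a\<close> is coordinate \<open>a\<close> of observation \<open>k\<close>.\<close>

definition sample_mean :: "nat \<Rightarrow> (nat \<Rightarrow> nat \<Rightarrow> real) \<Rightarrow> nat \<Rightarrow> real" where
  "sample_mean n x a = (\<Sum>k<n. x k a) / real n"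

definition sample_cov :: "nat \<Rightarrow> nat \<Rightarrow> (nat \<Rightarrow> nat \<Rightarrow> real) \<Rightarrow> real mat" where
  "sample_cov n p x = mat p p (\<lambda>(a, b).
     (\<Sum>k<n. (x k a - sample_mean n x a) * (x k b - sample_mean n x b)) / real n)"

definition likelihood_ratio ::
    "nat \<Rightarrow> nat \<Rightarrow> nat \<Rightarrow> (nat \<Rightarrow> nat) \<Rightarrow> (nat \<Rightarrow> nat \<Rightarrow> real) \<Rightarrow> real" where
  "likelihood_ratio n p q d x =
     det (sample_cov n p x) powr (real n / 2) /
     (\<Prod>i<q. det (mat_block d (sample_cov n p x) i i) powr (real n / 2))"

end

theory Submission
  imports Defs "HOL-Real_Asymp.Real_Asymp"
begin

text \<open>
  Write \<open>N = n - 1\<close>. Under the null hypothesis each coordinate of an observation is, given the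
  earlier coordinates, an affine function of the earlier coordinates of its own block plus
  independent Gaussian noise. Column by column, the ratio of determinants therefore gains a factor
  which is the squared distance of a Gaussian vector in \<open>\<real>\<^sup>n\<close> to the span of \<open>1\<close> and all previous
  columns, divided by its squared distance to the span of \<open>1\<close> and the previous columns of the same
  block. By rotation invariance the conditional law of this factor is a beta law that does not depend
  on the previous columns, so the factors are independent and the characteristic function of the
  logarithm of the statistic is a quotient of products of
  \<open>\<Gamma>(k/2 + i t) / \<Gamma>(k/2)\<close>, \<open>N - p < k \<le> N\<close>.

  Up to a factor \<open>exp (O(1/k\<^sup>2))\<close> this Gamma quotient is \<open>exp (H(k) - H(k - 1) - i t ln 2)\<close> with
  \<open>H(x) = i t (x ln x - x - ln x / 2) - t\<^sup>2 ln x\<close>. The products telescope, the centring \<open>s n\<close> appears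
  exactly, and what remains is governed by
  \<open>ln (1 - p/N) - (\<Sum>i. ln (1 - d i / N))\<close>, which tends to \<open>- \<sigma>\<^sup>2 / 2\<close> by dominated convergence.
  Levy's continuity theorem concludes.
\<close>

section \<open>Quotients of Gamma functions\<close>

text \<open>The Gamma quotient with index \<open>k\<close> is the expectation of
  \<open>Y powr (i t)\<close> for \<open>Y\<close> half a chi-square variable with \<open>k\<close>
  degrees of freedom. The constant column uses up one degree, which is why everything is counted
  from \<open>n - 1\<close>. Both the number of factors and the number of blocks grow with
  \<open>n\<close>, so a pointwise Stirling limit does not suffice: errors of size
  \<open>O(1/k^2)\<close>, over at most \<open>n\<close> factors with \<open>k\<close> of order
  \<open>n\<close>, leave \<open>O(1/n)\<close> in total. That \<open>k\<close> stays of order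
  \<open>n\<close> is where \<open>c < 1\<close> enters. The difference of logarithms that closes
  the overview occurs twice in the exponent: times \<open>t^2\<close> it becomes the Gaussian
  exponent, and times \<open>t/2\<close> it is a residual phase. The term
  \<open>\<sigma>2 / 4\<close> in \<open>s n\<close> is exactly what cancels this phase in the
  limit. Multivariate changes of variables are reduced to one-dimensional ones: isometries are
  composed of plane rotations, and the constant of the normal density is identified by total mass
  one. Singular sample covariances are discarded as null sets in the same induction that adds the
  columns.\<close>

definition gamma_ratio :: "real \<Rightarrow> real \<Rightarrow> complex" where
  "gamma_ratio t a = Gamma (of_real a + \<i> * of_real t) / Gamma (of_real a)"

text \<open>This is \<open>ln (Gamma x)\<close> up to a constant and \<open>O(1/x)\<close>. Its
  difference between \<open>2*a\<close> and \<open>2*a - 1\<close>, less \<open>ln 2\<close>, is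
  \<open>ln a - 1/(2*a) + O(1/a^2)\<close>, the beginning of the expansion of the digamma function
  at \<open>a\<close>.\<close>

definition stirling_term :: "real \<Rightarrow> real" where
  "stirling_term x = x * ln x - x - ln x / 2"

text \<open>
  The first terms of the Stirling expansion of \<open>ln \<Gamma>(a + i t) - ln \<Gamma>(a)\<close>, written as a difference
  in \<open>2 a\<close> so that sums over \<open>a = k/2\<close> telescope.
\<close>

definition gamma_exponent :: "real \<Rightarrow> real \<Rightarrow> complex" where
  "gamma_exponent t a = Complex (- t\<^sup>2 * (ln (2*a) - ln (2*a-1)))
     (t * (stirling_term (2*a) - stirling_term (2*a-1) - ln 2))"

text \<open>Polar form: the logarithm is given by its real and imaginary parts, so that real
  asymptotics apply to each separately.\<close>

lemma exp_Complex_ln_arctan: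
  "exp (Complex (ln (1+x\<^sup>2)/2) (arctan x)) = 1 + \<i> * of_real x"
proof -
  have pos: "1 + x\<^sup>2 > 0" by (smt (verit) zero_le_power2)
  have e: "exp (ln (1+x\<^sup>2)/2) = sqrt (1+x\<^sup>2)"
    using pos by (simp add: ln_sqrt[symmetric])
  show ?thesis
    using pos by (simp add: complex_eq_iff Re_exp Im_exp e cos_arctan sin_arctan)
qed

lemma arctan_cubic_bound:
  "\<exists>C d. d > 0 \<and> C \<ge> 0 \<and> (\<forall>x::real. \<bar>x\<bar> < d \<longrightarrow> \<bar>arctan x - x\<bar> \<le> C * \<bar>x\<bar>^3)"
proof -
  have "(\<lambda>x::real. arctan x - x) \<in> O[at 0](\<lambda>x. x^3)" by real_asymp
  then obtain c where c: "c > 0" "eventually (\<lambda>x::real. norm (arctan x - x) \<le> c * norm (x^3)) (at 0)"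
    by (elim landau_o.bigE)
  then obtain d where d: "d > 0" "\<And>x::real. x \<noteq> 0 \<Longrightarrow> \<bar>x\<bar> < d \<Longrightarrow> \<bar>arctan x - x\<bar> \<le> c * \<bar>x\<bar>^3"
    by (auto simp: eventually_at power_abs)
  show ?thesis
  proof (rule exI[of _ c], rule exI[of _ d], intro conjI allI impI)
    fix x :: real assume "\<bar>x\<bar> < d"
    thus "\<bar>arctan x - x\<bar> \<le> c * \<bar>x\<bar>^3" using d(2)[of x] by (cases "x = 0") auto
  qed (use c(1) d(1) in auto)
qed

text \<open>By the functional equation, \<open>1 + i t / a\<close> is the factor gained by the Gamma
  quotient between \<open>a\<close> and \<open>a + 1\<close>. Its polar form is compared with the
  step of the exponent. The error has to be cubic because it is later summed over
  \<open>a, a + 1, ...\<close>, which costs one order.\<close>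

lemma gamma_exponent_step:
  "\<exists>K a0. a0 \<ge> 1 \<and> K \<ge> 0 \<and> (\<forall>a\<ge>a0. \<exists>e. 1 + \<i> * of_real (t / a) = exp (gamma_exponent t (a+1) - gamma_exponent t a + e)
       \<and> norm e \<le> K / a^3)"
proof -
  \<comment> \<open>\<open>r\<close> is the discrepancy of the log-moduli; \<open>t * m\<close> is
    that of the phases once \<open>arctan (t/a)\<close> is replaced by \<open>t/a\<close>.\<close>
  define r where "r a = ln (1+(t/a)\<^sup>2)/2 + t\<^sup>2 * ((ln (2*a+2) - ln (2*a+1)) - (ln (2*a) - ln (2*a-1)))" for a
  define m where "m a = 1/a - ((2*a+3/2)*ln (1+1/a) - (2*a+1/2) * ln (1+1/(2*a)) + (2*a-3/2)*ln(1-1/(2*a)))" for a :: real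
  \<comment> \<open>\<open>t\<close> enters \<open>r\<close> only through its square, so
    \<open>\<bar>t\<bar>\<close> may replace it; the expansion then has a parameter of known
    sign.\<close>
  have "(\<lambda>a. (ln (1+(\<bar>t\<bar>/a)\<^sup>2)/2 + \<bar>t\<bar>\<^sup>2 * ((ln (2*a+2) - ln (2*a+1)) - (ln (2*a) - ln (2*a-1))))) \<in> O(\<lambda>a. 1/a^3)"
  proof (cases "t = 0")
    case False
    hence "\<bar>t\<bar> > 0" by simp
    thus ?thesis by real_asymp
  qed simp
  hence "r \<in> O(\<lambda>a. 1/a^3)" by (simp add: r_def[abs_def] power_divide)
  then obtain c1 where c1: "c1 > 0" "eventually (\<lambda>a. norm (r a) \<le> c1 * norm (1/a^3)) at_top"
    by (elim landau_o.bigE)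
  have "m \<in> O(\<lambda>a. 1/a^3)" unfolding m_def by real_asymp
  then obtain c2 where c2: "c2 > 0" "eventually (\<lambda>a. norm (m a) \<le> c2 * norm (1/a^3)) at_top"
    by (elim landau_o.bigE)
  obtain C d where Cd: "d > 0" "C \<ge> 0" "\<And>x::real. \<bar>x\<bar> < d \<Longrightarrow> \<bar>arctan x - x\<bar> \<le> C * \<bar>x\<bar>^3"
    using arctan_cubic_bound by blast
  have "eventually (\<lambda>a. a > \<bar>t\<bar> / d) at_top" by (rule eventually_gt_at_top)
  with c1(2) c2(2) have "eventually (\<lambda>a. norm (r a) \<le> c1 * norm (1/a^3) \<and> norm (m a) \<le> c2 * norm (1/a^3) \<and> a > \<bar>t\<bar> / d) at_top"
    by eventually_elim auto
  then obtain a1 where a1: "\<And>a. a \<ge> a1 \<Longrightarrow> norm (r a) \<le> c1 * norm (1/a^3) \<and> norm (m a) \<le> c2 * norm (1/a^3) \<and> a > \<bar>t\<bar> / d"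
    by (auto simp: eventually_at_top_linorder)
  define K where "K = c1 + \<bar>t\<bar> * c2 + C * \<bar>t\<bar>^3"
  show ?thesis
  proof (rule exI[of _ K], rule exI[of _ "max 1 a1"], intro conjI allI impI)
    show "K \<ge> 0" using c1 c2 Cd by (auto simp: K_def)
    fix a assume a: "max 1 a1 \<le> a"
    hence a': "a \<ge> 1" "a > 0" by auto
    note b = a1[of a]
    define e where "e = Complex (r a) ((arctan (t/a) - t/a) + t * m a)"
    have l: "ln (1 + u/(2*a)) = ln (2*a+u) - ln (2*a)" if "u \<ge> -1" for u
    proof -
      have "1 + u/(2*a) = (2*a+u)/(2*a)" using a' by (simp add: field_simps)
      thus ?thesis using a' that by (simp add: ln_div)
    qed
    have l1: "ln (1 + 1/a) = ln (2*a+2) - ln (2*a)" and l2: "ln (1 + 1/(2*a)) = ln (2*a+1) - ln (2*a)"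
      and l3: "ln (1 - 1/(2*a)) = ln (2*a-1) - ln (2*a)"
      using l[of 2] l[of 1] l[of "-1"] by simp_all
    have sh: "2*(a+1) = 2*a+2" "2*(a+1)-1 = 2*a+1" "2*a+2-1=2*a+1" by simp_all
    have mm: "m a = 1/a - (stirling_term (2*(a+1)) - stirling_term (2*(a+1)-1) - (stirling_term (2*a) - stirling_term (2*a-1)))"
      unfolding m_def l1 l2 l3 stirling_term_def sh by (simp add: field_simps)
    have eq: "gamma_exponent t (a+1) - gamma_exponent t a + e = Complex (ln (1+(t/a)\<^sup>2)/2) (arctan (t/a))"
      unfolding e_def mm gamma_exponent_def r_def
      by (simp add: complex_eq_iff sh) (simp add: algebra_simps)
    show "\<exists>e. 1 + \<i> * of_real (t / a) = exp (gamma_exponent t (a+1) - gamma_exponent t a + e) \<and> norm e \<le> K / a^3"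
    proof (intro exI[of _ e] conjI)
      show "1 + \<i> * of_real (t / a) = exp (gamma_exponent t (a+1) - gamma_exponent t a + e)"
        unfolding eq exp_Complex_ln_arctan by simp
      have td: "\<bar>t/a\<bar> < d" using b a a' Cd(1) by (simp add: field_simps)
      have "norm e \<le> \<bar>Re e\<bar> + \<bar>Im e\<bar>" by (rule cmod_le)
      also have "\<dots> \<le> \<bar>r a\<bar> + (\<bar>arctan (t/a) - t/a\<bar> + \<bar>t\<bar> * \<bar>m a\<bar>)"
        unfolding e_def by (simp add: abs_mult[symmetric])
      also have "\<dots> \<le> c1 * (1/a^3) + (C * \<bar>t/a\<bar>^3 + \<bar>t\<bar> * (c2 * (1/a^3)))"
        using b a a' Cd(3)[OF td] by (intro add_mono mult_left_mono) auto
      also have "\<dots> = K / a^3" using a' unfolding K_def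
        by (simp add: field_simps abs_mult power_divide)
      finally show "norm e \<le> K / a^3" .
    qed
  qed auto
qed

text \<open>A telescoping majorant: \<open>2 / x^2\<close> decreases over a unit step by at least
  \<open>4*x / (x^2 * (2*x)^2) = 1 / x^3\<close>, because \<open>x + 1 \<le> 2*x\<close> for
  \<open>x \<ge> 1\<close>.\<close>

lemma sum_inverse_cube_le:
  fixes a :: real
  assumes "a \<ge> 1"
  shows "(\<Sum>j<N. 1 / (a + real j)^3) \<le> 2 / a^2 - 2 / (a + real N)^2"
proof (induction N)
  case (Suc N)
  define x where "x = a + real N"
  have x: "x \<ge> 1" using assms by (simp add: x_def)
  have "2/x^2 - 2/(x+1)^2 = (4*x+2)/(x^2*(x+1)^2)"
    using x by (simp add: divide_simps) (simp add: power2_eq_square algebra_simps)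
  moreover have "(4*x+2)/(x^2*(x+1)^2) \<ge> (4*x)/(x^2*(2*x)^2)"
    using x by (intro frac_le mult_left_mono power_mono) auto
  moreover have "(4*x)/(x^2*(2*x)^2) = 1/x^3"
    using x by (simp add: divide_simps power2_eq_square power3_eq_cube)
  ultimately show ?case using Suc by (simp add: x_def add.assoc add.commute[of 1])
qed simp

text \<open>Quotient of Euler's limits for \<open>Gamma\<close> at \<open>a + i t\<close> and at
  \<open>a\<close>: the factorials cancel, the powers of \<open>n\<close> leave
  \<open>exp (i t ln n)\<close>, and the Pochhammer symbols turn into Gamma values shifted by
  \<open>n + 1\<close>.\<close>

lemma gamma_ratio_limit:
  assumes "a > 0"
  shows "(\<lambda>n. gamma_ratio t (a + real (n+1)) * exp (- \<i> * of_real (t * ln (real n)))) \<longlonglongrightarrow> 1"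
proof -
  let ?z = "of_real a + \<i> * of_real t :: complex" and ?a = "of_real a :: complex"
  have nz: "?z \<notin> \<int>\<^sub>\<le>\<^sub>0" "?a \<notin> \<int>\<^sub>\<le>\<^sub>0"
    using assms by (auto simp: complex_eq_iff elim!: nonpos_Ints_cases)
  have G: "gamma_ratio t a \<noteq> 0" using nz by (auto simp: gamma_ratio_def Gamma_eq_zero_iff)
  have "(\<lambda>n. Gamma_series ?z n / Gamma_series ?a n) \<longlonglongrightarrow> gamma_ratio t a"
    unfolding gamma_ratio_def using nz
    by (intro tendsto_divide Gamma_series_LIMSEQ) (auto simp: Gamma_eq_zero_iff)
  hence "(\<lambda>n. gamma_ratio t a / (Gamma_series ?z n / Gamma_series ?a n)) \<longlonglongrightarrow> gamma_ratio t a / gamma_ratio t a"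
    using G by (intro tendsto_divide) auto
  moreover
  have "gamma_ratio t a / (Gamma_series ?z n / Gamma_series ?a n) =
      gamma_ratio t (a + real (n+1)) * exp (- \<i> * of_real (t * ln (real n)))" if "n > 0" for n
  proof -
    have p1: "pochhammer ?z (n+1) = Gamma (?z + of_nat (n+1)) / Gamma ?z"
      using nz by (intro pochhammer_Gamma)
    have p2: "pochhammer ?a (n+1) = Gamma (?a + of_nat (n+1)) / Gamma ?a"
      using nz by (intro pochhammer_Gamma)
    have s: "gamma_ratio t (a + real (n+1)) = Gamma (?z + of_nat (n+1)) / Gamma (?a + of_nat (n+1))"
      by (simp add: gamma_ratio_def add_ac)
    have ex: "exp (?z * of_real (ln (real n))) = exp (?a * of_real (ln (real n))) * exp (\<i> * of_real (t * ln (real n)))"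
      unfolding exp_add[symmetric] by (simp add: ring_distribs mult.assoc)
    have alg: "(P/Q) / ((F * (E1 * E2) / (R/P)) / (F * E1 / (S/Q))) = R / S * inverse E2"
      if "P \<noteq> 0" "Q \<noteq> 0" "R \<noteq> 0" "S \<noteq> 0" "E1 \<noteq> 0" "E2 \<noteq> 0" "F \<noteq> 0" for P Q R S E1 E2 F :: complex
      using that by (simp add: divide_simps)
    have np: "?z + of_nat (n+1) \<notin> \<int>\<^sub>\<le>\<^sub>0" "?a + of_nat (n+1) \<notin> \<int>\<^sub>\<le>\<^sub>0"
      using assms by (auto simp: complex_eq_iff elim!: nonpos_Ints_cases)
    have g0: "Gamma ?z \<noteq> 0" "Gamma ?a \<noteq> 0" "Gamma (?z + of_nat (n+1)) \<noteq> 0" "Gamma (?a + of_nat (n+1)) \<noteq> 0"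
      using nz np by (simp_all only: Gamma_eq_zero_iff not_False_eq_True)
    show ?thesis
      unfolding Gamma_series_def p1 p2 s ex mult_minus_left exp_minus gamma_ratio_def[of t a]
      by (rule alg) (use g0 in auto)
  qed
  hence "\<forall>\<^sub>F n in sequentially. gamma_ratio t a / (Gamma_series ?z n / Gamma_series ?a n) =
      gamma_ratio t (a + real (n+1)) * exp (- \<i> * of_real (t * ln (real n)))"
    by (intro eventually_mono[OF eventually_gt_at_top[of 0]])
  ultimately have "(\<lambda>n. gamma_ratio t (a + real (n+1)) * exp (- \<i> * of_real (t * ln (real n)))) \<longlonglongrightarrow> gamma_ratio t a / gamma_ratio t a"
    by (rule Lim_transform_eventually)
  thus ?thesis using G by simp
qed

text \<open>The exponent has the same behaviour at infinity as the Gamma quotient. This fixes the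
  multiplicative constant that the recursion in \<open>a\<close> leaves open.\<close>

lemma gamma_exponent_limit:
  assumes "a > 0"
  shows "(\<lambda>n. gamma_exponent t (a + real (n+1)) - \<i> * of_real (t * ln (real n))) \<longlonglongrightarrow> 0"
proof -
  have y: "filterlim (\<lambda>x. a+(x+1)) at_top at_top"
    by (rule filterlim_tendsto_add_at_top[OF tendsto_const]) real_asymp
  have l1: "((\<lambda>y. ln (2*y) - ln (2*y-1)) \<longlongrightarrow> (0::real)) at_top" by real_asymp
  have y1: "((\<lambda>y. (2*y) * ln (2*y) - (2*y-1) * ln (2*y-1) - 1 - (ln (2*y) - ln (2*y-1)) / 2 - ln (2*y)) \<longlongrightarrow> (0::real)) at_top"
    by real_asymp
  have y2: "((\<lambda>x. ln (x + b) - ln x) \<longlongrightarrow> 0) at_top" if "b > 0" for b :: real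
    using that by real_asymp
  have ev: "eventually (\<lambda>x. ln (x + (a+1)) - ln x = ln (2*(a+(x+1))) - ln 2 - ln x) at_top"
    using eventually_gt_at_top[of 0] 
  proof eventually_elim
    case (elim x)
    have "ln (2*(a+(x+1))) = ln 2 + ln (a+(x+1))" using assms elim by (intro ln_mult_pos) auto
    thus ?case by (simp add: add_ac)
  qed
  have y3: "((\<lambda>x. ln (2*(a+(x+1))) - ln 2 - ln x) \<longlongrightarrow> 0) at_top"
    by (rule Lim_transform_eventually[OF y2 ev]) (use assms in auto)
  have l2: "((\<lambda>x. (2*(a+(x+1))) * ln (2*(a+(x+1))) - (2*(a+(x+1))-1) * ln (2*(a+(x+1))-1)
      - 1 - (ln (2*(a+(x+1))) - ln (2*(a+(x+1))-1)) / 2 - ln 2 - ln x) \<longlongrightarrow> 0) at_top"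
    using Lim_transform_eventually[OF tendsto_add[OF filterlim_compose[OF y1 y] y3] always_eventually]
    by simp
  note c1 = filterlim_compose[OF filterlim_compose[OF l1 y] filterlim_real_sequentially]
  note c2 = filterlim_compose[OF l2 filterlim_real_sequentially]
  have "(\<lambda>n. Complex (- t\<^sup>2 * (ln (2*(a+(real n+1))) - ln (2*(a+(real n+1))-1)))
     (t * ((2*(a+(real n+1))) * ln (2*(a+(real n+1))) - (2*(a+(real n+1))-1) * ln (2*(a+(real n+1))-1)
      - 1 - (ln (2*(a+(real n+1))) - ln (2*(a+(real n+1))-1)) / 2 - ln 2 - ln (real n)))) \<longlonglongrightarrow> Complex (- t\<^sup>2 * 0) (t * 0)"
    by (intro tendsto_Complex tendsto_mult tendsto_const c1 c2)
  moreover have "Complex (- t\<^sup>2 * (ln (2*(a+(real n+1))) - ln (2*(a+(real n+1))-1)))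
     (t * ((2*(a+(real n+1))) * ln (2*(a+(real n+1))) - (2*(a+(real n+1))-1) * ln (2*(a+(real n+1))-1)
      - 1 - (ln (2*(a+(real n+1))) - ln (2*(a+(real n+1))-1)) / 2 - ln 2 - ln (real n)))
    = gamma_exponent t (a + real (n+1)) - \<i> * of_real (t * ln (real n))" for n
    unfolding gamma_exponent_def stirling_term_def
    by (simp add: complex_eq_iff) (simp add: algebra_simps add_divide_distrib diff_divide_distrib)
  moreover have "Complex (- t\<^sup>2 * 0) (t * 0) = 0" by (simp add: complex_eq_iff)
  ultimately show ?thesis by (simp only:)
qed

lemma gamma_ratio_Suc:
  assumes "a > 0"
  shows "gamma_ratio t (a+1) = gamma_ratio t a * (1 + \<i> * of_real (t/a))"
proof -
  have nz: "of_real a + \<i> * of_real t \<notin> (\<int>\<^sub>\<le>\<^sub>0 :: complex set)" "of_real a \<notin> (\<int>\<^sub>\<le>\<^sub>0 :: complex set)"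
    using assms by (auto simp: complex_eq_iff elim!: nonpos_Ints_cases)
  hence nz0: "Gamma (of_real a + \<i> * of_real t :: complex) \<noteq> 0" "Gamma (of_real a :: complex) \<noteq> 0" "(of_real a :: complex) \<noteq> 0"
    using assms by (auto simp: Gamma_eq_zero_iff)
  have "gamma_ratio t (a+1) = Gamma ((of_real a + \<i> * of_real t) + 1) / Gamma (of_real a + 1)"
    by (simp add: gamma_ratio_def add_ac)
  also have "\<dots> = ((of_real a + \<i> * of_real t) * Gamma (of_real a + \<i> * of_real t)) / (of_real a * Gamma (of_real a))"
    unfolding Gamma_plus1[OF nz(1)] Gamma_plus1[OF nz(2)] ..
  also have "\<dots> = gamma_ratio t a * (1 + \<i> * of_real (t/a))"
    using nz0 by (simp add: gamma_ratio_def field_simps)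
  finally show ?thesis .
qed

text \<open>Running the functional equation from \<open>a\<close> to infinity expresses the quotient
  at \<open>a\<close> through its behaviour there and the sum of all step errors, which
  \<open>sum_inverse_cube_le\<close> bounds by a multiple of \<open>1 / a^2\<close>.\<close>

lemma gamma_ratio_asymptotic:
  "\<exists>K a0. a0 \<ge> 1 \<and> K \<ge> 0 \<and>
     (\<forall>a\<ge>a0. \<exists>e. gamma_ratio t a = exp (gamma_exponent t a + e) \<and> norm e \<le> K / a\<^sup>2)"
proof -
  obtain K a0 where K: "a0 \<ge> 1" "K \<ge> 0"
    "\<And>a. a \<ge> a0 \<Longrightarrow> \<exists>e. 1 + \<i> * of_real (t / a) = exp (gamma_exponent t (a+1) - gamma_exponent t a + e) \<and> norm e \<le> K / a^3"
    using gamma_exponent_step[of t] by blast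
  then obtain e where e: "\<And>a. a \<ge> a0 \<Longrightarrow> 1 + \<i> * of_real (t / a) = exp (gamma_exponent t (a+1) - gamma_exponent t a + e a)"
    "\<And>a. a \<ge> a0 \<Longrightarrow> norm (e a) \<le> K / a^3" by metis
  show ?thesis
  proof (rule exI[of _ "2*K"], rule exI[of _ a0], intro conjI allI impI)
    fix a assume a: "a \<ge> a0"
    hence a1: "a \<ge> 1" "a > 0" using K(1) by auto
    have rec: "gamma_ratio t (a + real N) =
      gamma_ratio t a * exp (gamma_exponent t (a + real N) - gamma_exponent t a + (\<Sum>j<N. e (a + real j)))" for N
    proof (induction N)
      case (Suc N)
      have "gamma_ratio t (a + real (Suc N)) = gamma_ratio t (a + real N) * (1 + \<i> * of_real (t/(a + real N)))"
        using gamma_ratio_Suc[of "a + real N" t] a1 by (simp add: add_ac)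
      also have "1 + \<i> * of_real (t/(a + real N)) = exp (gamma_exponent t (a + real (Suc N)) - gamma_exponent t (a + real N) + e (a + real N))"
        using e(1)[of "a + real N"] a by (simp add: add_ac)
      also note Suc.IH
      finally show ?case
        unfolding mult.assoc exp_add[symmetric] by (simp add: algebra_simps)
    qed simp
    have pb: "(\<Sum>j<N. norm (e (a + real j))) \<le> 2*K / a\<^sup>2" for N
    proof -
      have "(\<Sum>j<N. norm (e (a + real j))) \<le> (\<Sum>j<N. K * (1 / (a + real j)^3))"
        by (intro sum_mono) (use e(2) a in auto)
      also have "\<dots> \<le> K * (2 / a^2)"
        unfolding sum_distrib_left[symmetric]
        by (intro mult_left_mono K order_trans[OF sum_inverse_cube_le[OF a1(1)]]) auto
      finally show ?thesis by (simp add: mult.commute)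
    qed
    have sm: "summable (\<lambda>j. norm (e (a + real j)))"
      by (rule summableI_nonneg_bounded[OF _ pb]) auto
    define S where "S = (\<Sum>j. e (a + real j))"
    have "(\<lambda>N. \<Sum>j<N. e (a + real j)) \<longlonglongrightarrow> S"
      unfolding S_def using summable_norm_cancel[OF sm] by (rule summable_LIMSEQ)
    hence S: "(\<lambda>N. \<Sum>j<N+1. e (a + real j)) \<longlonglongrightarrow> S" by (rule LIMSEQ_ignore_initial_segment)
    have "norm S \<le> (\<Sum>j. norm (e (a + real j)))" unfolding S_def by (rule summable_norm[OF sm])
    also have "\<dots> \<le> 2*K / a\<^sup>2" by (rule suminf_le_const[OF sm pb])
    finally have nS: "norm S \<le> 2*K / a\<^sup>2" .
    \<comment> \<open>By the recursion this sequence coincides with that of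
      \<open>gamma_ratio_limit\<close>. Equating the two limits shows that the total error
      \<open>S\<close> enters with a minus sign.\<close>
    have "(\<lambda>n. gamma_ratio t a * exp (- gamma_exponent t a + (\<Sum>j<n+1. e (a + real j)) +
        (gamma_exponent t (a + real (n+1)) - \<i> * of_real (t * ln (real n)))))
      \<longlonglongrightarrow> gamma_ratio t a * exp (- gamma_exponent t a + S + 0)"
      by (intro tendsto_intros S gamma_exponent_limit a1(2))
    moreover have "gamma_ratio t a * exp (- gamma_exponent t a + (\<Sum>j<n+1. e (a + real j)) +
        (gamma_exponent t (a + real (n+1)) - \<i> * of_real (t * ln (real n))))
        = gamma_ratio t (a + real (n+1)) * exp (- \<i> * of_real (t * ln (real n)))" for n
      unfolding rec[of "n+1"] mult.assoc exp_add[symmetric]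
      by (intro arg_cong[of _ _ "\<lambda>z. gamma_ratio t a * exp z"]) simp
    ultimately have "gamma_ratio t a * exp (- gamma_exponent t a + S) = 1"
      using LIMSEQ_unique[OF _ gamma_ratio_limit[OF a1(2), of t]] by simp
    moreover have "gamma_ratio t a = (gamma_ratio t a * exp (- gamma_exponent t a + S)) * exp (gamma_exponent t a + - S)"
      unfolding mult.assoc exp_add[symmetric] by simp
    ultimately have "gamma_ratio t a = exp (gamma_exponent t a + - S)" by simp
    thus "\<exists>e. gamma_ratio t a = exp (gamma_exponent t a + e) \<and> norm e \<le> 2*K / a\<^sup>2"
      using nS by (intro exI[of _ "-S"]) simp
  qed (use K in auto)
qed

section \<open>Asymptotics of the characteristic function\<close>

lemma abs_ln_one_minus_le:
  fixes x b :: real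
  assumes "0 \<le> x" "x \<le> b" "b < 1"
  shows "\<bar>ln (1 - x)\<bar> \<le> x / (1 - b)"
proof -
  have "- ln (1 - x) = ln (1 / (1 - x))" using assms by (simp add: ln_div)
  also have "\<dots> \<le> 1 / (1 - x) - 1" using assms by (intro ln_le_minus_one) auto
  also have "\<dots> = x / (1 - x)" using assms by (simp add: field_simps)
  also have "\<dots> \<le> x / (1 - b)" using assms by (intro divide_left_mono mult_pos_pos) auto
  finally show ?thesis using assms by simp
qed

text \<open>A product that converges in the strict sense and has no zero factor has a nonzero limit;
  this is what lets the logarithm pass to the limit.\<close>

lemma ln_prodinf_sums:
  fixes l :: "nat \<Rightarrow> real"
  assumes "summable l" and l: "\<And>i. 0 \<le> l i \<and> l i < 1"
  shows "(\<lambda>i. ln (1 - l i)) sums ln (\<Prod>i. 1 - l i)" and "(\<Prod>i. 1 - l i) > 0"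
    and "(\<lambda>n. \<Prod>i<n. 1 - l i) \<longlonglongrightarrow> (\<Prod>i. 1 - l i)"
proof -
  have l1: "l i \<noteq> 1" for i using l[of i] by auto
  have cp: "convergent_prod (\<lambda>i. 1 + - l i)"
    using assms by (intro summable_imp_convergent_prod_real) (auto simp: l1 abs_of_nonneg)
  hence lim: "(\<lambda>n. \<Prod>i\<le>n. 1 - l i) \<longlonglongrightarrow> (\<Prod>i. 1 - l i)"
    using convergent_prod_LIMSEQ by fastforce
  hence "(\<lambda>n. \<Prod>i<Suc n. 1 - l i) \<longlonglongrightarrow> (\<Prod>i. 1 - l i)" by (simp add: lessThan_Suc_atMost)
  thus lim': "(\<lambda>n. \<Prod>i<n. 1 - l i) \<longlonglongrightarrow> (\<Prod>i. 1 - l i)" by (rule LIMSEQ_imp_Suc)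
  have ne: "(\<Prod>i. 1 - l i) \<noteq> 0"
    using prodinf_nonzero[OF cp] l1 by auto
  have "(\<Prod>i. 1 - l i) \<ge> 0"
    by (rule tendsto_lowerbound[OF lim']) (use l in \<open>auto intro!: always_eventually prod_nonneg simp: less_imp_le\<close>)
  with ne show pos: "(\<Prod>i. 1 - l i) > 0" by linarith
  have "(\<lambda>n. ln (\<Prod>i<n. 1 - l i)) \<longlonglongrightarrow> ln (\<Prod>i. 1 - l i)"
    by (intro tendsto_ln lim' ne)
  moreover have "ln (\<Prod>i<n. 1 - l i) = (\<Sum>i<n. ln (1 - l i))" for n
    using l l1 by (intro ln_prod) auto
  ultimately show "(\<lambda>i. ln (1 - l i)) sums ln (\<Prod>i. 1 - l i)" by (simp add: sums_def)
qed

text \<open>Weierstrass' product inequality, with the cross term \<open>l 0 * l 1\<close> of the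
  first two factors kept. It survives the limit and gives strictness, hence a positive limit
  variance.\<close>

lemma prodinf_one_minus_gt:
  fixes l :: "nat \<Rightarrow> real"
  assumes sums: "l sums c" and l: "\<And>i. 0 < l i \<and> l i < 1"
  shows "(\<Prod>i. 1 - l i) > 1 - c"
proof -
  have fin: "1 - (\<Sum>i<n+2. l i) + l 0 * l 1 \<le> (\<Prod>i<n+2. 1 - l i)" for n
  proof (induction n)
    case 0
    have e: "{..<0+2} = {0,1::nat}" by auto
    show ?case unfolding e by (simp add: algebra_simps)
  next
    case (Suc n)
    define S where "S = (\<Sum>i<n+2. l i)"
    have "S \<ge> (\<Sum>i\<in>{0}. l i)" unfolding S_def
      by (intro sum_mono2) (use l in \<open>auto simp: less_imp_le\<close>)
    moreover have "l 0 * l 1 \<le> l 0 * 1" using l[of 0] l[of 1] by (intro mult_left_mono) auto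
    ultimately have S: "S - l 0 * l 1 \<ge> 0" by simp
    have "1 - (\<Sum>i<Suc n+2. l i) + l 0 * l 1 = (1 - S + l 0 * l 1) - l (n+2)" by (simp add: S_def)
    also have "\<dots> \<le> (1 - S + l 0 * l 1) * (1 - l (n+2))"
      using mult_nonneg_nonneg[OF S, of "l (n+2)"] l[of "n+2"] by (simp add: algebra_simps)
    also have "\<dots> \<le> (\<Prod>i<n+2. 1 - l i) * (1 - l (n+2))"
      using Suc l[of "n+2"] by (intro mult_right_mono) (auto simp: S_def)
    finally show ?case by (simp add: mult.commute)
  qed
  have "(\<lambda>n. \<Sum>i<n+2. l i) \<longlonglongrightarrow> c" using sums unfolding sums_def by (rule LIMSEQ_ignore_initial_segment)
  hence "(\<lambda>n. 1 - (\<Sum>i<n+2. l i) + l 0 * l 1) \<longlonglongrightarrow> 1 - c + l 0 * l 1" by (intro tendsto_intros)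
  moreover have "(\<lambda>n. \<Prod>i<n+2. 1 - l i) \<longlonglongrightarrow> (\<Prod>i. 1 - l i)"
    by (rule LIMSEQ_ignore_initial_segment, rule ln_prodinf_sums(3))
      (use sums l in \<open>auto simp: sums_iff less_imp_le\<close>)
  ultimately have "1 - c + l 0 * l 1 \<le> (\<Prod>i. 1 - l i)" using fin by (intro LIMSEQ_le) auto
  thus ?thesis using mult_pos_pos[of "l 0" "l 1"] l by fastforce
qed

lemma abs_sum_ln_one_minus_le:
  fixes x :: "nat \<Rightarrow> real"
  assumes "I \<le> n" "b < 1" and x: "\<And>i. i < n \<Longrightarrow> 0 \<le> x i \<and> x i \<le> b"
  shows "\<bar>(\<Sum>i<n. ln (1 - x i)) - (\<Sum>i<I. ln (1 - x i))\<bar> \<le> 1 / (1 - b) * ((\<Sum>i<n. x i) - (\<Sum>i<I. x i))"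
proof -
  have diff: "(\<Sum>i<n. f i) - (\<Sum>i<I. f i) = (\<Sum>i\<in>{..<n}-{..<I}. f i)" for f :: "nat \<Rightarrow> real"
    using assms(1) by (subst sum_diff) auto
  have "\<bar>\<Sum>i\<in>{..<n}-{..<I}. ln (1 - x i)\<bar> \<le> (\<Sum>i\<in>{..<n}-{..<I}. \<bar>ln (1 - x i)\<bar>)" by (rule sum_abs)
  also have "\<dots> \<le> (\<Sum>i\<in>{..<n}-{..<I}. 1 / (1 - b) * x i)"
  proof (intro sum_mono)
    fix i assume "i \<in> {..<n}-{..<I}"
    thus "\<bar>ln (1 - x i)\<bar> \<le> 1 / (1 - b) * x i" using abs_ln_one_minus_le[of "x i" b] x[of i] assms(2) by simp
  qed
  finally show ?thesis unfolding diff by (simp add: sum_distrib_left)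
qed

text \<open>Termwise convergence alone could lose mass to indices that move away with
  \<open>n\<close>. Since the sums of \<open>x n\<close> converge to the sum of the limits, their
  tails are uniformly small, and \<open>\<bar>ln (1 - x)\<bar> \<le> x / (1 - b)\<close> carries
  this over to the logarithms.\<close>

lemma sum_ln_one_minus_limit:
  fixes x :: "nat \<Rightarrow> nat \<Rightarrow> real" and q :: "nat \<Rightarrow> nat"
  assumes q: "filterlim q at_top sequentially"
    and x0: "\<forall>\<^sub>F n in sequentially. \<forall>i<q n. 0 \<le> x n i"
    and total: "(\<lambda>n. \<Sum>i<q n. x n i) \<longlonglongrightarrow> c"
    and x: "\<And>i. (\<lambda>n. x n i) \<longlonglongrightarrow> l i"
    and sums: "l sums c" and l: "\<And>i. 0 \<le> l i \<and> l i < 1" and c: "c < 1"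
  shows "(\<lambda>n. \<Sum>i<q n. ln (1 - x n i)) \<longlonglongrightarrow> ln (\<Prod>i. 1 - l i)"
proof (rule tendstoI)
  fix e0 :: real assume "e0 > 0"
  \<comment> \<open>A bound strictly between \<open>c\<close> and 1: for large \<open>n\<close> the
    whole sum, hence each of its nonnegative terms, lies below it, and so does each
    \<open>l i\<close>.\<close>
  define b where "b = (1 + c) / 2"
  have b: "c < b" "b < 1" using c by (auto simp: b_def)
  define C where "C = 1 / (1 - b)"
  have C: "C > 0" using b by (simp add: C_def)
  \<comment> \<open>Error budget: \<open>e\<close> for the first \<open>I\<close> terms and
    \<open>C * e\<close> for each of the two tails.\<close>
  define e where "e = e0 / (1 + 2 * C)"
  have "e * (1 + 2 * C) = e0" using C by (simp add: e_def)
  hence "e + 2 * C * e = e0" by (simp only: distrib_left mult_1_right mult.commute)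
  moreover have "e > 0" using \<open>e0 > 0\<close> C by (simp add: e_def)
  ultimately have e: "e > 0" "e + 2 * C * e = e0" by auto
  have sml: "summable l" and suml: "suminf l = c" using sums by (auto simp: sums_iff)
  have psum: "(\<Sum>i<n. l i) \<le> c" for n
    using sum_le_suminf[OF sml, of "{..<n}"] l suml by auto
  have lb: "l i \<le> b" for i
    using psum[of "Suc i"] b l sum_nonneg[of "{..<i}" l] by simp
  have ls: "(\<lambda>i. ln (1 - l i)) sums ln (\<Prod>i. 1 - l i)"
    using ln_prodinf_sums(1)[OF sml l] .
  have "\<forall>\<^sub>F n in sequentially. dist (\<Sum>i<n. l i) c < e"
    using sums e(1) unfolding sums_def by (rule tendstoD)
  then obtain I where "dist (\<Sum>i<I. l i) c < e" by (auto simp: eventually_sequentially)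
  hence I: "c - (\<Sum>i<I. l i) < e" by (auto simp: dist_real_def)
  have tail: "\<bar>ln (\<Prod>i. 1 - l i) - (\<Sum>i<I. ln (1 - l i))\<bar> \<le> C * e"
  proof (rule LIMSEQ_le_const2)
    show "(\<lambda>n. \<bar>(\<Sum>i<n. ln (1 - l i)) - (\<Sum>i<I. ln (1 - l i))\<bar>) \<longlonglongrightarrow> \<bar>ln (\<Prod>i. 1 - l i) - (\<Sum>i<I. ln (1 - l i))\<bar>"
      using ls unfolding sums_def by (intro tendsto_intros)
    have "\<bar>(\<Sum>i<n. ln (1 - l i)) - (\<Sum>i<I. ln (1 - l i))\<bar> \<le> C * e" if "n \<ge> I" for n
    proof -
      have "\<bar>(\<Sum>i<n. ln (1 - l i)) - (\<Sum>i<I. ln (1 - l i))\<bar> \<le> C * ((\<Sum>i<n. l i) - (\<Sum>i<I. l i))"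
        unfolding C_def using that b l lb by (intro abs_sum_ln_one_minus_le) auto
      also have "\<dots> \<le> C * e" using C psum[of n] I by (intro mult_left_mono) auto
      finally show ?thesis .
    qed
    thus "\<exists>N. \<forall>n\<ge>N. \<bar>(\<Sum>i<n. ln (1 - l i)) - (\<Sum>i<I. ln (1 - l i))\<bar> \<le> C * e" by blast
  qed
  have "(\<lambda>n. \<Sum>i<I. ln (1 - x n i)) \<longlonglongrightarrow> (\<Sum>i<I. ln (1 - l i))"
    by (intro tendsto_sum tendsto_ln tendsto_diff tendsto_const x) (use l in \<open>metis less_irrefl eq_iff_diff_eq_0\<close>)
  hence 1: "\<forall>\<^sub>F n in sequentially. dist (\<Sum>i<I. ln (1 - x n i)) (\<Sum>i<I. ln (1 - l i)) < e"
    using e(1) by (rule tendstoD)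
  have "(\<lambda>n. (\<Sum>i<q n. x n i) - (\<Sum>i<I. x n i)) \<longlonglongrightarrow> c - (\<Sum>i<I. l i)"
    by (intro tendsto_intros total x)
  hence 2: "\<forall>\<^sub>F n in sequentially. (\<Sum>i<q n. x n i) - (\<Sum>i<I. x n i) < e"
    using I by (rule order_tendstoD)
  have 3: "\<forall>\<^sub>F n in sequentially. (\<Sum>i<q n. x n i) < b"
    using total b(1) by (rule order_tendstoD)
  have 4: "\<forall>\<^sub>F n in sequentially. q n \<ge> I" using q by (simp add: filterlim_at_top)
  show "\<forall>\<^sub>F n in sequentially. dist (\<Sum>i<q n. ln (1 - x n i)) (ln (\<Prod>i. 1 - l i)) < e0"
    using 1 2 3 4 x0
  proof eventually_elim
    case (elim n)
    have xb: "x n i \<le> b" if "i < q n" for i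
      using member_le_sum[of i "{..<q n}" "x n"] elim that by auto
    have "\<bar>(\<Sum>i<q n. ln (1 - x n i)) - (\<Sum>i<I. ln (1 - x n i))\<bar> \<le> C * ((\<Sum>i<q n. x n i) - (\<Sum>i<I. x n i))"
      unfolding C_def using elim xb b by (intro abs_sum_ln_one_minus_le) auto
    also have "\<dots> \<le> C * e" using C elim by (intro mult_left_mono) auto
    finally have "\<bar>(\<Sum>i<q n. ln (1 - x n i)) - (\<Sum>i<I. ln (1 - x n i))\<bar> \<le> C * e" .
    with tail elim(1) show ?case unfolding dist_real_def e(2)[symmetric] by linarith
  qed
qed

section \<open>Telescoping products of Gamma quotients\<close>

definition chi_ratio :: "real \<Rightarrow> nat \<Rightarrow> complex" where
  "chi_ratio t k = gamma_ratio t (real k / 2)"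

definition chi_primitive :: "real \<Rightarrow> real \<Rightarrow> complex" where
  "chi_primitive t x = Complex (- t\<^sup>2 * ln x) (t * stirling_term x)"

definition chi_expansion :: "real \<Rightarrow> real \<Rightarrow> nat \<Rightarrow> bool" where
  "chi_expansion t K k \<longleftrightarrow> (\<exists>e. chi_ratio t k =
     exp (chi_primitive t (real k) - chi_primitive t (real k - 1) - \<i> * of_real (t * ln 2) + e) \<and> norm e \<le> K / (real k)\<^sup>2)"

text \<open>The substitution \<open>a = k / 2\<close> turns the differences in \<open>2*a\<close>
  into unit steps in \<open>k\<close>, and \<open>K / a^2\<close> into
  \<open>4*K / k^2\<close>.\<close>

lemma chi_ratio_asymptotic: "\<exists>K k0. k0 \<ge> 1 \<and> K \<ge> 0 \<and> (\<forall>k\<ge>k0. chi_expansion t K k)"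
proof -
  obtain K a0 where K: "a0 \<ge> 1" "K \<ge> 0"
    "\<And>a. a \<ge> a0 \<Longrightarrow> \<exists>e. gamma_ratio t a = exp (gamma_exponent t a + e) \<and> norm e \<le> K / a\<^sup>2"
    using gamma_ratio_asymptotic[of t] by blast
  have eq: "gamma_exponent t (real k / 2) = chi_primitive t (real k) - chi_primitive t (real k - 1) - \<i> * of_real (t * ln 2)" for k
    by (simp add: gamma_exponent_def chi_primitive_def complex_eq_iff algebra_simps)
  show ?thesis
  proof (rule exI[of _ "4*K"], rule exI[of _ "nat \<lceil>2*a0\<rceil>"], intro conjI allI impI)
    fix k assume "nat \<lceil>2*a0\<rceil> \<le> k"
    hence "a0 \<le> real k / 2" by linarith
    from K(3)[OF this] show "chi_expansion t (4 * K) k"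
      by (simp add: chi_expansion_def eq chi_ratio_def power_divide mult.commute)
  qed (use K in linarith)+
qed

text \<open>Written relative to \<open>ln N\<close>, the difference has a part linear in
  \<open>m\<close>, which will cancel between the full product and the block products because the
  block sizes add up, and a part in \<open>l\<close> that survives.\<close>

lemma chi_primitive_diff:
  assumes "m < N"
  defines "l \<equiv> ln (1 - real m / real N)"
  shows "chi_primitive t (real N) - chi_primitive t (real N - real m) =
    Complex (t\<^sup>2 * l) (t * (real m * ln (real N) - real m - (real N - real m) * l + l / 2))"
proof -
  have N: "real N > 0" "real N - real m > 0" using assms by auto
  have "1 - real m / real N = (real N - real m) / real N" using N by (simp add: field_simps)
  hence "ln (real N - real m) = ln (real N) + l" using N by (simp add: l_def ln_div)
  thus ?thesis
    by (simp add: chi_primitive_def complex_eq_iff stirling_term_def) (simp add: algebra_simps add_divide_distrib)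
qed

text \<open>All indices \<open>N - j\<close> are at least \<open>M\<close>, so each of the
  \<open>m\<close> errors is bounded by the worst value \<open>K / M^2\<close>.\<close>

lemma chi_ratio_prod:
  assumes K: "\<And>k. k \<ge> k0 \<Longrightarrow> chi_expansion t K k"
    and "K \<ge> 0" "k0 \<ge> 1" and M: "k0 \<le> M" and m: "m + M \<le> N"
  shows "\<exists>e. (\<Prod>j<m. chi_ratio t (N - j)) = exp (chi_primitive t (real N) - chi_primitive t (real N - real m) -
    of_nat m * (\<i> * of_real (t * ln 2)) + e) \<and> norm e \<le> real m * (K / (real M)\<^sup>2)"
  using m
proof (induction m)
  case (Suc m)
  then obtain e where e: "(\<Prod>j<m. chi_ratio t (N - j)) = exp (chi_primitive t (real N) - chi_primitive t (real N - real m) -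
    of_nat m * (\<i> * of_real (t * ln 2)) + e)" "norm e \<le> real m * (K / (real M)\<^sup>2)" by auto
  have k: "M \<le> N - m" "k0 \<le> N - m" using Suc.prems M by auto
  have rk: "real (N - m) = real N - real m" using Suc.prems by auto
  obtain e' where e': "chi_ratio t (N - m) =
     exp (chi_primitive t (real N - real m) - chi_primitive t (real N - real m - 1) - \<i> * of_real (t * ln 2) + e')"
     "norm e' \<le> K / (real (N - m))\<^sup>2" using K[OF k(2)] rk unfolding chi_expansion_def by auto
  have "norm e' \<le> K / (real M)\<^sup>2"
    using M \<open>k0 \<ge> 1\<close> k(1) by (intro order_trans[OF e'(2)] divide_left_mono power_mono \<open>K \<ge> 0\<close> mult_pos_pos) auto
  hence n: "norm (e + e') \<le> real (Suc m) * (K / (real M)\<^sup>2)"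
    using e(2) norm_triangle_ineq[of e e'] unfolding of_nat_Suc distrib_right by linarith
  show ?case
  proof (intro exI[of _ "e + e'"] conjI n)
    have "(\<Prod>j<Suc m. chi_ratio t (N - j)) = (\<Prod>j<m. chi_ratio t (N - j)) * chi_ratio t (N - m)" by simp
    also have "\<dots> = exp (chi_primitive t (real N) - chi_primitive t (real N - real (Suc m)) - of_nat (Suc m) * (\<i> * of_real (t * ln 2)) + (e + e'))"
      unfolding e(1) e'(1) exp_add[symmetric] by (rule arg_cong[of _ _ exp]) (simp add: algebra_simps)
    finally show "(\<Prod>j<Suc m. chi_ratio t (N - j)) = exp (chi_primitive t (real N) - chi_primitive t (real N - real (Suc m)) - of_nat (Suc m) * (\<i> * of_real (t * ln 2)) + (e + e'))" .
  qed
qed (use \<open>K \<ge> 0\<close> in auto)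

text \<open>After the linear terms cancel there remain the phase \<open>b\<close>, which is the
  deterministic centring, and \<open>k\<close>, once in the modulus and once, halved, in the phase.
  The factor 2 in the error counts numerator and denominator, which have equally many Gamma
  quotients.\<close>

lemma chi_ratio_block_prod:
  fixes d :: "nat \<Rightarrow> nat" and q :: nat
  assumes K: "\<And>k. k \<ge> k0 \<Longrightarrow> chi_expansion t K k"
    and K0: "K \<ge> 0" "k0 \<ge> 1" and M: "k0 \<le> M" and m: "(\<Sum>i<q. d i) + M \<le> N"
  defines "k \<equiv> ln (1 - real (\<Sum>i<q. d i) / real N) - (\<Sum>i<q. ln (1 - real (d i) / real N))"
    and "b \<equiv> (\<Sum>i<q. (real N - real (d i)) * ln (1 - real (d i) / real N))
      - (real N - real (\<Sum>i<q. d i)) * ln (1 - real (\<Sum>i<q. d i) / real N)"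
  shows "\<exists>e. (\<Prod>j<(\<Sum>i<q. d i). chi_ratio t (N - j)) / (\<Prod>i<q. \<Prod>j<d i. chi_ratio t (N - j)) =
      exp (Complex (t\<^sup>2 * k) (t * (b + k / 2)) + e) \<and> norm e \<le> 2 * real (\<Sum>i<q. d i) * (K / (real M)\<^sup>2)"
proof -
  let ?c = "\<i> * of_real (t * ln 2) :: complex" and ?D = "\<lambda>m. chi_primitive t (real N) - chi_primitive t (real N - real m)"
  define p where "p = (\<Sum>i<q. d i)"
  define B where "B = K / (real M)\<^sup>2"
  have lt: "p < N" using m M K0(2) by (auto simp: p_def)
  have dp: "d i \<le> p" if "i < q" for i using that member_le_sum[of i "{..<q}" d] by (auto simp: p_def)
  obtain e0 where e0: "(\<Prod>j<p. chi_ratio t (N - j)) = exp (?D p -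
    of_nat p * ?c + e0)" "norm e0 \<le> real p * B"
    using chi_ratio_prod[OF K K0 M, of p N] m unfolding p_def B_def by blast
  have "\<forall>i\<in>{..<q}. \<exists>e. (\<Prod>j<d i. chi_ratio t (N - j)) = exp (?D (d i) -
    of_nat (d i) * ?c + e) \<and> norm e \<le> real (d i) * B"
    using dp m unfolding B_def p_def[symmetric] by (intro ballI chi_ratio_prod[OF K K0 M]) fastforce+
  then obtain e where e: "\<And>i. i < q \<Longrightarrow> (\<Prod>j<d i. chi_ratio t (N - j)) = exp (?D (d i) -
    of_nat (d i) * ?c + e i)" "\<And>i. i < q \<Longrightarrow> norm (e i) \<le> real (d i) * B"
    unfolding bchoice_iff by auto
  have "norm (\<Sum>i<q. e i) \<le> (\<Sum>i<q. real (d i) * B)" by (rule sum_norm_le) (use e in auto)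
  also have "\<dots> = real p * B" by (simp add: p_def sum_distrib_right)
  finally have ne: "norm (e0 - (\<Sum>i<q. e i)) \<le> 2 * real p * B"
    using e0(2) norm_triangle_ineq4[of e0 "\<Sum>i<q. e i"] by linarith
  have "(\<Prod>i<q. \<Prod>j<d i. chi_ratio t (N - j)) = (\<Prod>i<q. exp (?D (d i) -
    of_nat (d i) * ?c + e i))" by (intro prod.cong refl) (use e in auto)
  also have "\<dots> = exp (\<Sum>i<q. ?D (d i) -
    of_nat (d i) * ?c + e i)" by (rule exp_sum[symmetric]) simp
  also have "(\<Sum>i<q. ?D (d i) -
    of_nat (d i) * ?c + e i) =
     (\<Sum>i<q. ?D (d i)) - of_nat p * ?c + (\<Sum>i<q. e i)"
    by (simp add: p_def sum.distrib sum_subtractf sum_distrib_right)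
  finally have "(\<Prod>j<p. chi_ratio t (N - j)) / (\<Prod>i<q. \<Prod>j<d i. chi_ratio t (N - j)) =
     exp (?D p -
       (\<Sum>i<q. ?D (d i)) + (e0 - (\<Sum>i<q. e i)))"
    unfolding e0(1) by (simp add: exp_diff[symmetric] algebra_simps)
  also have "?D p -
       (\<Sum>i<q. ?D (d i)) = Complex (t\<^sup>2 * k) (t * (b + k / 2))"
  proof -
    define l where "l m = ln (1 - real m / real N)" for m
    have pd: "real p = (\<Sum>i<q. real (d i))" by (simp add: p_def)
    have k: "k = l p - (\<Sum>i<q. l (d i))"
      and b: "b = (\<Sum>i<q. (real N - real (d i)) * l (d i)) - (real N - real p) * l p"
      by (simp_all add: k_def b_def l_def p_def)
    have 1: "?D p =
      Complex (t\<^sup>2 * l p) (t * (real p * ln (real N) - real p - (real N - real p) * l p + l p / 2))"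
      unfolding l_def by (rule chi_primitive_diff[OF lt])
    have 2: "(\<Sum>i<q. ?D (d i)) =
       (\<Sum>i<q. Complex (t\<^sup>2 * l (d i)) (t * (real (d i) * ln (real N) - real (d i) - (real N - real (d i)) * l (d i) + l (d i) / 2)))"
      unfolding l_def by (intro sum.cong refl chi_primitive_diff) (use lt dp in fastforce)
    have 3: "(\<Sum>i<q. real (d i) * ln (real N) - real (d i) - (real N - real (d i)) * l (d i) + l (d i) / 2)
       = real p * ln (real N) - real p - (\<Sum>i<q. (real N - real (d i)) * l (d i)) + (\<Sum>i<q. l (d i)) / 2"
      by (simp only: sum.distrib sum_subtractf sum_distrib_right[symmetric] sum_divide_distrib[symmetric] pd)
    show ?thesis
      unfolding 1 2 k b
      by (simp add: complex_eq_iff Re_sum Im_sum sum_distrib_left[symmetric] 3) (simp add: algebra_simps diff_divide_distrib)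
  qed
  finally show ?thesis using ne unfolding p_def B_def by blast
qed

definition block_chi_ratio :: "real \<Rightarrow> nat \<Rightarrow> nat \<Rightarrow> nat \<Rightarrow> (nat \<Rightarrow> nat) \<Rightarrow> complex" where
  "block_chi_ratio t n p q d = (\<Prod>j<p. chi_ratio t (n - 1 - j)) / (\<Prod>i<q. \<Prod>j<d i. chi_ratio t (n - 1 - j))"

text \<open>The limit \<open>- \<sigma>2 / 2\<close> of \<open>k n\<close> settles both of its
  roles: times \<open>t^2\<close> it is the Gaussian exponent, and half of it cancels the
  \<open>\<sigma>2 / 4\<close> left over from \<open>s n\<close>.\<close>

lemma block_chi_ratio_limit:
  fixes q :: "nat \<Rightarrow> nat"
  assumes d_sum: "\<And>n. n > 0 \<Longrightarrow> (\<Sum>i<q n. d n i) = p n"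
    and q_lim: "filterlim q at_top sequentially"
    and lam_range: "\<And>i. 0 < lam i \<and> lam i < 1"
    and d_lim: "\<And>i. (\<lambda>n. real (d n i) / real n) \<longlonglongrightarrow> lam i"
    and p_lim: "(\<lambda>n. real (p n) / real n) \<longlonglongrightarrow> c"
    and c_less: "c < 1"
    and lam_sum: "lam sums c"
    and sigma2: "\<sigma>2 = 2 * ln (inverse (1 - c) * (\<Prod>i. 1 - lam i))"
    and s: "\<And>n. n > 0 \<Longrightarrow> s n =
      (\<Sum>i<q n. (real n - real (d n i) - 1) * ln (1 - real (d n i) / (real n - 1)))
      - (real n - real (p n) - 1) * ln (1 - real (p n) / (real n - 1)) - \<sigma>2 / 4"
  shows "(\<lambda>n. block_chi_ratio t n (p n) (q n) (d n)
     * exp (- \<i> * of_real (t * s n))) \<longlonglongrightarrow> of_real (exp (- \<sigma>2 * t\<^sup>2 / 2))"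
proof -
  have sml: "summable lam" using lam_sum by (simp add: sums_iff)
  have P: "(\<Prod>i. 1 - lam i) > 0" using lam_range by (intro ln_prodinf_sums(2) sml) (auto simp: less_imp_le)
  have nn: "(\<lambda>n. real n / real (n - 1)) \<longlonglongrightarrow> 1"
  proof (rule LIMSEQ_imp_Suc)
    show "(\<lambda>n. real (Suc n) / real (Suc n - 1)) \<longlonglongrightarrow> 1" using LIMSEQ_Suc_n_over_n by simp
  qed
  have conv: "(\<lambda>n. y n / real (n - 1)) \<longlonglongrightarrow> l" if "(\<lambda>n. y n / real n) \<longlonglongrightarrow> l" for y l
  proof -
    have "\<forall>\<^sub>F n in sequentially. y n / real n * (real n / real (n - 1)) = y n / real (n - 1)"
      using eventually_gt_at_top[of 0] by eventually_elim auto
    from Lim_transform_eventually[OF tendsto_mult[OF that nn] this] show ?thesis by simp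
  qed
  define k where "k n = ln (1 - real (p n) / real (n - 1)) - (\<Sum>i<q n. ln (1 - real (d n i) / real (n - 1)))" for n
  have tot: "(\<lambda>n. \<Sum>i<q n. real (d n i) / real (n - 1)) \<longlonglongrightarrow> c"
  proof (rule Lim_transform_eventually[OF conv[OF p_lim]])
    show "\<forall>\<^sub>F n in sequentially. real (p n) / real (n - 1) = (\<Sum>i<q n. real (d n i) / real (n - 1))"
      using eventually_gt_at_top[of 0]
      by eventually_elim (simp add: d_sum[symmetric] sum_divide_distrib)
  qed
  have "(\<lambda>n. \<Sum>i<q n. ln (1 - real (d n i) / real (n - 1))) \<longlonglongrightarrow> ln (\<Prod>i. 1 - lam i)"
    by (rule sum_ln_one_minus_limit[OF q_lim _ tot conv[OF d_lim] lam_sum _ c_less])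
      (use lam_range in \<open>auto simp: less_imp_le\<close>)
  moreover have "(\<lambda>n. ln (1 - real (p n) / real (n - 1))) \<longlonglongrightarrow> ln (1 - c)"
    using c_less by (intro tendsto_intros conv[OF p_lim]) auto
  ultimately have "k \<longlonglongrightarrow> ln (1 - c) - ln (\<Prod>i. 1 - lam i)" unfolding k_def by (intro tendsto_diff)
  also have "ln (1 - c) - ln (\<Prod>i. 1 - lam i) = - \<sigma>2 / 2"
    using c_less P by (simp add: sigma2 ln_mult_pos ln_inverse)
  finally have k: "k \<longlonglongrightarrow> - \<sigma>2 / 2" .
  obtain K k0 where K: "k0 \<ge> 1" "K \<ge> 0" "\<And>k. k \<ge> k0 \<Longrightarrow> chi_expansion t K k"
    using chi_ratio_asymptotic[of t] by blast
  \<comment> \<open>Since \<open>c = 1 - 4*r\<close>, eventually \<open>p n < (1 - 2*r) * n\<close>;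
    one further \<open>r * n\<close> absorbs the shift from \<open>n\<close> to
    \<open>n - 1\<close>, leaving \<open>n - 1 - p n \<ge> r * n\<close>.\<close>
  define r where "r = (1 - c) / 4"
  have r: "r > 0" using c_less by (simp add: r_def)
  have "\<forall>\<^sub>F n in sequentially. real (p n) / real n < 1 - 2 * r"
    using p_lim by (rule order_tendstoD) (use c_less in \<open>simp add: r_def field_simps\<close>)
  moreover have "\<forall>\<^sub>F n in sequentially. real n \<ge> 1 / r" by real_asymp
  moreover have "\<forall>\<^sub>F n in sequentially. r * real n \<ge> real k0"
    using r by real_asymp
  ultimately have large: "\<forall>\<^sub>F n in sequentially. n > 0 \<and> p n + (n - 1 - p n) \<le> n - 1 \<and> k0 \<le> n - 1 - p n \<and>
      r * real n \<le> real (n - 1 - p n) \<and> p n \<le> n"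
    using eventually_gt_at_top[of 0]
  proof eventually_elim
    case (elim n)
    have 1: "real (p n) < real n - 2 * (r * real n)" using elim by (simp add: field_simps)
    have 2: "1 \<le> r * real n" using elim r by (simp add: field_simps)
    have 3: "p n \<le> n - 1" using 1 2 elim by linarith
    hence "real (n - 1 - p n) = real n - 1 - real (p n)" using elim by linarith
    thus ?case using 1 2 3 elim by auto
  qed
  have ex: "\<forall>\<^sub>F n in sequentially. \<exists>e. block_chi_ratio t n (p n) (q n) (d n)
     * exp (- \<i> * of_real (t * s n)) = exp (Complex (t\<^sup>2 * k n) (t * (\<sigma>2 / 4 + k n / 2)) + e) \<and>
     norm e \<le> (2 * K / r\<^sup>2) * (1 / real n)"
    using large
  proof eventually_elim
    case (elim n)
    have n: "n > 0" using elim by auto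
    have rn: "real (n - 1) = real n - 1" using n by auto
    define b where "b = (\<Sum>i<q n. (real (n-1) - real (d n i)) * ln (1 - real (d n i) / real (n-1)))
      - (real (n-1) - real (p n)) * ln (1 - real (p n) / real (n-1))"
    have sb: "s n = b - \<sigma>2 / 4"
      unfolding s[OF n] b_def rn by (simp add: algebra_simps)
    obtain e where e: "block_chi_ratio t n (p n) (q n) (d n) =
      exp (Complex (t\<^sup>2 * k n) (t * (b + k n / 2)) + e)" "norm e \<le> 2 * real (p n) * (K / (real (n - 1 - p n))\<^sup>2)"
      using chi_ratio_block_prod[OF K(3) K(2,1), where M = "n - 1 - p n" and q = "q n" and d = "d n" and N = "n - 1"] elim
      unfolding d_sum[OF n] k_def b_def block_chi_ratio_def by blast
    show ?case
    proof (intro exI[of _ e] conjI)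
      show "block_chi_ratio t n (p n) (q n) (d n)
         * exp (- \<i> * of_real (t * s n)) = exp (Complex (t\<^sup>2 * k n) (t * (\<sigma>2 / 4 + k n / 2)) + e)"
        unfolding e(1) exp_add[symmetric] sb
        by (rule arg_cong[of _ _ exp]) (simp add: complex_eq_iff algebra_simps)
      have "2 * real (p n) * (K / (real (n - 1 - p n))\<^sup>2) \<le> 2 * real n * (K / (r * real n)\<^sup>2)"
        using elim r K n by (intro mult_mono divide_left_mono power_mono mult_pos_pos zero_less_power) auto
      also have "\<dots> = (2 * K / r\<^sup>2) * (1 / real n)"
        using n r by (simp add: power2_eq_square field_simps)
      finally show "norm e \<le> (2 * K / r\<^sup>2) * (1 / real n)" using e(2) by linarith
    qed
  qed
  define F where "F n = block_chi_ratio t n (p n) (q n) (d n)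
     * exp (- \<i> * of_real (t * s n))" for n
  \<comment> \<open>The error is known to exist only for large \<open>n\<close> and one
    \<open>n\<close> at a time; the choice turns it into a null sequence.\<close>
  define e where "e n = (SOME e. F n = exp (Complex (t\<^sup>2 * k n) (t * (\<sigma>2 / 4 + k n / 2)) + e) \<and>
     norm e \<le> (2 * K / r\<^sup>2) * (1 / real n))" for n
  have e: "\<forall>\<^sub>F n in sequentially. F n = exp (Complex (t\<^sup>2 * k n) (t * (\<sigma>2 / 4 + k n / 2)) + e n) \<and>
     norm (e n) \<le> (2 * K / r\<^sup>2) * (1 / real n)"
    using ex unfolding F_def[symmetric] by eventually_elim (unfold e_def, rule someI_ex)
  have "(\<lambda>n. (2 * K / r\<^sup>2) * (1 / real n)) \<longlonglongrightarrow> (2 * K / r\<^sup>2) * 0"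
    by (intro tendsto_mult tendsto_const lim_1_over_n)
  hence "(\<lambda>n. (2 * K / r\<^sup>2) * (1 / real n)) \<longlonglongrightarrow> 0" by simp
  moreover have "\<forall>\<^sub>F n in sequentially. norm (e n) \<le> (2 * K / r\<^sup>2) * (1 / real n)"
    using e by eventually_elim simp
  ultimately have e0: "e \<longlonglongrightarrow> 0" by (rule Lim_null_comparison[rotated])
  have "(\<lambda>n. exp (Complex (t\<^sup>2 * k n) (t * (\<sigma>2 / 4 + k n / 2)) + e n)) \<longlonglongrightarrow>
     exp (Complex (t\<^sup>2 * (- \<sigma>2 / 2)) (t * (\<sigma>2 / 4 + (- \<sigma>2 / 2) / 2)) + 0)"
    by (intro tendsto_intros tendsto_Complex k e0) auto
  also have "exp (Complex (t\<^sup>2 * (- \<sigma>2 / 2)) (t * (\<sigma>2 / 4 + (- \<sigma>2 / 2) / 2)) + 0) = of_real (exp (- \<sigma>2 * t\<^sup>2 / 2))"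
  proof -
    have "Complex (t\<^sup>2 * (- \<sigma>2 / 2)) (t * (\<sigma>2 / 4 + (- \<sigma>2 / 2) / 2)) + 0 = of_real (- \<sigma>2 * t\<^sup>2 / 2)"
      by (simp add: complex_eq_iff)
    thus ?thesis by (simp only: exp_of_real)
  qed
  finally have "F \<longlonglongrightarrow> of_real (exp (- \<sigma>2 * t\<^sup>2 / 2))"
    by (rule Lim_transform_eventually) (use e in \<open>auto elim: eventually_mono\<close>)
  thus ?thesis unfolding F_def .
qed

section \<open>Gamma, beta and chi-square laws\<close>

definition gamma_density :: "real \<Rightarrow> real \<Rightarrow> real" where
  "gamma_density a x = indicator {0<..} x * x powr (a - 1) * exp (- x) / Gamma a"

definition beta_density :: "real \<Rightarrow> real \<Rightarrow> real \<Rightarrow> real" where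
  "beta_density a b r = indicator {0<..<1} r * r powr (a - 1) * (1 - r) powr (b - 1) * Gamma (a + b) / (Gamma a * Gamma b)"

definition gamma_law :: "real \<Rightarrow> real measure" where
  "gamma_law a = density lborel (\<lambda>x. ennreal (gamma_density a x))"

definition beta_law :: "real \<Rightarrow> real \<Rightarrow> real measure" where
  "beta_law a b = density lborel (\<lambda>x. ennreal (beta_density a b x))"

lemma gamma_density_measurable [measurable]: "gamma_density a \<in> borel_measurable borel"
  unfolding gamma_density_def by measurable

lemma beta_density_measurable [measurable]: "beta_density a b \<in> borel_measurable borel"
  unfolding beta_density_def by measurable

lemma sets_gamma_law [measurable_cong, simp]: "sets (gamma_law a) = sets borel"
  and space_gamma_law [simp]: "space (gamma_law a) = UNIV"
  and sets_beta_law [measurable_cong, simp]: "sets (beta_law a b) = sets borel"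
  and space_beta_law [simp]: "space (beta_law a b) = UNIV"
  by (simp_all add: gamma_law_def beta_law_def)

lemma gamma_density_nonneg: "a > 0 \<Longrightarrow> gamma_density a x \<ge> 0"
  by (simp add: gamma_density_def Gamma_real_pos less_imp_le)

lemma beta_density_nonneg: "a > 0 \<Longrightarrow> b > 0 \<Longrightarrow> beta_density a b x \<ge> 0"
  by (simp add: beta_density_def Gamma_real_pos less_imp_le)

lemma prob_space_gamma_law:
  assumes "a > 0" shows "prob_space (gamma_law a)"
proof (rule prob_spaceI)
  have G: "Gamma a > 0" using assms by (rule Gamma_real_pos)
  have "emeasure (gamma_law a) (space (gamma_law a)) = (\<integral>\<^sup>+x. ennreal (gamma_density a x) \<partial>lborel)"
    by (simp add: gamma_law_def emeasure_density)
  also have "\<dots> = (\<integral>\<^sup>+x. ennreal (indicat_real {0..} x * x powr (a - 1) / exp x) * ennreal (1 / Gamma a) \<partial>lborel)"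
  proof (rule nn_integral_cong)
    fix x :: real
    have "gamma_density a x = indicat_real {0..} x * x powr (a - 1) / exp x * (1 / Gamma a)"
      by (cases "x = 0") (auto simp: gamma_density_def exp_minus field_simps split: split_indicator)
    thus "ennreal (gamma_density a x) = ennreal (indicat_real {0..} x * x powr (a - 1) / exp x) * ennreal (1 / Gamma a)"
      using G by (simp add: ennreal_mult[symmetric])
  qed
  also have "\<dots> = ennreal (Gamma a) * ennreal (1 / Gamma a)"
    using assms by (subst nn_integral_multc) (auto simp: Gamma_conv_nn_integral_real[symmetric])
  also have "\<dots> = 1" using G by (simp add: ennreal_mult[symmetric])
  finally show "emeasure (gamma_law a) (space (gamma_law a)) = 1" .
qed

text \<open>The planar change of variables to ratio \<open>r\<close> and sum \<open>s\<close> is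
  split into two affine substitutions on the line, \<open>y = s - x\<close> and
  \<open>x = s * r\<close>, with Fubini in between. The transformed density factorises, so ratio and
  sum are independent.\<close>

lemma nn_integral_gamma_law_ratio_sum:
  assumes a: "a > 0" and b: "b > 0"
    and [measurable]: "f \<in> borel_measurable borel" "g \<in> borel_measurable borel"
  shows "(\<integral>\<^sup>+x. \<integral>\<^sup>+y. f (x / (x + y)) * g (x + y) \<partial>gamma_law b \<partial>gamma_law a) =
    (\<integral>\<^sup>+r. f r \<partial>beta_law a b) * (\<integral>\<^sup>+s. g s \<partial>gamma_law (a + b))"
proof -
  let ?\<alpha> = "\<lambda>x. ennreal (gamma_density a x)" and ?\<beta> = "\<lambda>x. ennreal (gamma_density b x)"
  let ?\<gamma> = "\<lambda>x. ennreal (gamma_density (a + b) x)" and ?\<rho> = "\<lambda>x. ennreal (beta_density a b x)"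
  note [simp] = gamma_density_nonneg[OF a] gamma_density_nonneg[OF b] beta_density_nonneg[OF a b]
  have G: "Gamma a > 0" "Gamma b > 0" "Gamma (a + b) > 0" using a b by (auto intro!: Gamma_real_pos)
  have split: "ennreal \<bar>s\<bar> * (?\<alpha> (s * r) * ?\<beta> (s - s * r)) =
      ?\<gamma> s * ?\<rho> r" if "s > 0" for s r
  proof -
    have "s * (gamma_density a (s * r) * gamma_density b (s - s * r)) = gamma_density (a + b) s * beta_density a b r"
    proof (cases "0 < r \<and> r < 1")
      case True
      have "s - s * r > 0" using True that by simp
      have e: "s - s * r = s * (1 - r)" by (simp add: algebra_simps)
      \<comment> \<open>The Jacobian \<open>s\<close> joins the powers of \<open>s\<close> from the
        two densities to give the exponent belonging to \<open>a + b\<close>.\<close>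
      have p: "s powr (a + b - 1) = s * (s powr (a - 1) * s powr (b - 1))"
        using that by (simp add: powr_diff powr_add)
      show ?thesis using True that G \<open>s - s * r > 0\<close>
        by (simp add: gamma_density_def beta_density_def e powr_mult p exp_minus exp_diff) (simp add: e field_simps exp_add[symmetric])
    next
      case False
      have "gamma_density a (s * r) * gamma_density b (s - s * r) = 0"
        using False that by (auto simp: gamma_density_def zero_less_mult_iff split: split_indicator)
      thus ?thesis using False by (auto simp: beta_density_def)
    qed
    thus ?thesis using that a b by (simp add: ennreal_mult[symmetric] gamma_density_nonneg beta_density_nonneg)
  qed
  have "(\<integral>\<^sup>+x. \<integral>\<^sup>+y. f (x / (x + y)) * g (x + y) \<partial>gamma_law b \<partial>gamma_law a) =
    (\<integral>\<^sup>+x. \<integral>\<^sup>+y. ?\<alpha> x * ?\<beta> y * (f (x / (x + y)) * g (x + y)) \<partial>lborel \<partial>lborel)"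
    unfolding gamma_law_def
    by (subst (1 2) nn_integral_density) (auto simp: mult.assoc nn_integral_cmult)
  also have "\<dots> = (\<integral>\<^sup>+x. \<integral>\<^sup>+s. ?\<alpha> x * ?\<beta> (s - x) * (f (x / s) * g s) \<partial>lborel \<partial>lborel)"
  proof (rule nn_integral_cong)
    fix x :: real
    show "(\<integral>\<^sup>+y. ?\<alpha> x * ?\<beta> y * (f (x / (x + y)) * g (x + y)) \<partial>lborel) =
      (\<integral>\<^sup>+s. ?\<alpha> x * ?\<beta> (s - x) * (f (x / s) * g s) \<partial>lborel)"
      by (subst nn_integral_real_affine[where c = 1 and t = "- x"]) (auto)
  qed
  also have "\<dots> = (\<integral>\<^sup>+s. \<integral>\<^sup>+x. ?\<alpha> x * ?\<beta> (s - x) * (f (x / s) * g s) \<partial>lborel \<partial>lborel)"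
    by (rule lborel_pair.Fubini') simp
  also have "\<dots> = (\<integral>\<^sup>+s. \<integral>\<^sup>+r. ?\<gamma> s * ?\<rho> r * (f r * g s) \<partial>lborel \<partial>lborel)"
  proof (rule nn_integral_cong)
    fix s :: real
    show "(\<integral>\<^sup>+x. ?\<alpha> x * ?\<beta> (s - x) * (f (x / s) * g s) \<partial>lborel) =
      (\<integral>\<^sup>+r. ?\<gamma> s * ?\<rho> r * (f r * g s) \<partial>lborel)"
    proof (cases "s > 0")
      case True
      have "(\<integral>\<^sup>+x. ?\<alpha> x * ?\<beta> (s - x) * (f (x / s) * g s) \<partial>lborel) =
         ennreal \<bar>s\<bar> * (\<integral>\<^sup>+r. ?\<alpha> (s * r) * ?\<beta> (s - s * r) * (f r * g s) \<partial>lborel)"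
        using True by (subst nn_integral_real_affine[where c = s and t = 0]) auto
      also have "\<dots> = (\<integral>\<^sup>+r. ?\<gamma> s * ?\<rho> r * (f r * g s) \<partial>lborel)"
      proof (subst nn_integral_cmult[symmetric])
        have "ennreal \<bar>s\<bar> * (?\<alpha> (s * r) * ?\<beta> (s - s * r) * (f r * g s)) =
          ?\<gamma> s * ?\<rho> r * (f r * g s)" for r
          unfolding split[OF True, symmetric] by (simp only: mult.assoc)
        thus "(\<integral>\<^sup>+r. ennreal \<bar>s\<bar> * (?\<alpha> (s * r) * ?\<beta> (s - s * r) * (f r * g s)) \<partial>lborel)
          = (\<integral>\<^sup>+r. ?\<gamma> s * ?\<rho> r * (f r * g s) \<partial>lborel)"
          by simp
      qed simp
      finally show ?thesis .
    next
      case False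
      have "gamma_density a x * gamma_density b (s - x) = 0" for x
        using False by (auto simp: gamma_density_def split: split_indicator)
      hence "?\<alpha> x * ?\<beta> (s - x) = 0" for x
        by (simp add: ennreal_mult[symmetric])
      hence "?\<alpha> x * ?\<beta> (s - x) * (f (x / s) * g s) = 0" for x
        by (simp only: mult_zero_left)
      moreover have "gamma_density (a + b) s = 0" using False by (auto simp: gamma_density_def)
      ultimately show ?thesis by (simp only: nn_integral_const ennreal_0 mult_zero_left)
    qed
  qed
  also have "\<dots> = (\<integral>\<^sup>+s. (\<integral>\<^sup>+r. ?\<rho> r * f r \<partial>lborel) * (?\<gamma> s * g s) \<partial>lborel)"
  proof (rule nn_integral_cong)
    fix s :: real
    have "?\<gamma> s * ?\<rho> r * (f r * g s) =
      (?\<rho> r * f r) * (?\<gamma> s * g s)" for r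
      by (simp only: ac_simps)
    thus "(\<integral>\<^sup>+r. ?\<gamma> s * ?\<rho> r * (f r * g s) \<partial>lborel) =
      (\<integral>\<^sup>+r. ?\<rho> r * f r \<partial>lborel) * (?\<gamma> s * g s)"
      by (simp only:) (rule nn_integral_multc, simp)
  qed
  also have "\<dots> = (\<integral>\<^sup>+r. ?\<rho> r * f r \<partial>lborel) * (\<integral>\<^sup>+s. ?\<gamma> s * g s \<partial>lborel)"
    by (rule nn_integral_cmult) simp
  finally show ?thesis by (simp add: gamma_law_def beta_law_def nn_integral_density)
qed

text \<open>With constant test functions the factorisation leaves the mass of the beta law as its
  only unknown.\<close>

lemma prob_space_beta_law:
  assumes "a > 0" "b > 0" shows "prob_space (beta_law a b)"
proof (rule prob_spaceI)
  interpret A: prob_space "gamma_law a" using assms(1) by (rule prob_space_gamma_law)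
  interpret B: prob_space "gamma_law b" using assms(2) by (rule prob_space_gamma_law)
  interpret S: prob_space "gamma_law (a + b)" using assms by (intro prob_space_gamma_law) auto
  show "emeasure (beta_law a b) (space (beta_law a b)) = 1"
    using nn_integral_gamma_law_ratio_sum[OF assms, of "\<lambda>_. 1" "\<lambda>_. 1"]
      A.emeasure_space_1 B.emeasure_space_1 S.emeasure_space_1 by simp
qed

lemma nn_integral_gamma_law_sum:
  assumes "a > 0" "b > 0" and [measurable]: "g \<in> borel_measurable borel"
  shows "(\<integral>\<^sup>+x. \<integral>\<^sup>+y. g (x + y) \<partial>gamma_law b \<partial>gamma_law a) = (\<integral>\<^sup>+s. g s \<partial>gamma_law (a + b))"
  using nn_integral_gamma_law_ratio_sum[OF assms(1,2), of "\<lambda>_. 1" g] prob_space.emeasure_space_1[OF prob_space_beta_law[OF assms(1,2)]]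
  by simp

lemma gamma_law_ratio_sum_distr:
  assumes a: "a > 0" and b: "b > 0"
  shows "distr (gamma_law a \<Otimes>\<^sub>M gamma_law b) (borel \<Otimes>\<^sub>M borel) (\<lambda>(x, y). (x / (x + y), x + y)) =
    beta_law a b \<Otimes>\<^sub>M gamma_law (a + b)"
proof (rule pair_measure_eqI[symmetric])
  let ?P = "gamma_law a \<Otimes>\<^sub>M gamma_law b"
  let ?D = "distr ?P (borel \<Otimes>\<^sub>M borel) (\<lambda>(x, y). (x / (x + y), x + y))"
  interpret A: prob_space "gamma_law a" using a by (rule prob_space_gamma_law)
  interpret B: prob_space "gamma_law b" using b by (rule prob_space_gamma_law)
  interpret S: prob_space "gamma_law (a + b)" using a b by (intro prob_space_gamma_law) auto
  interpret R: prob_space "beta_law a b" using a b by (rule prob_space_beta_law)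
  show "sigma_finite_measure (beta_law a b)" "sigma_finite_measure (gamma_law (a + b))" by unfold_locales
  show "sets (beta_law a b \<Otimes>\<^sub>M gamma_law (a + b)) =
    sets ?D"
    by (simp cong: sets_pair_measure_cong)
  fix X Y assume "X \<in> sets (beta_law a b)" "Y \<in> sets (gamma_law (a + b))"
  hence [measurable]: "X \<in> sets borel" "Y \<in> sets borel" by auto
  have "emeasure ?D (X \<times> Y)
    = (\<integral>\<^sup>+z. indicator (X \<times> Y) z \<partial>?D)"
    by (rule nn_integral_indicator[symmetric]) simp
  also have "\<dots> = (\<integral>\<^sup>+z. indicator X (fst z / (fst z + snd z)) * indicator Y (fst z + snd z) \<partial>?P)"
    by (subst nn_integral_distr) (auto simp: indicator_times case_prod_beta intro!: nn_integral_cong)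
  also have "\<dots> = (\<integral>\<^sup>+x. \<integral>\<^sup>+y. indicator X (x / (x + y)) * indicator Y (x + y) \<partial>gamma_law b \<partial>gamma_law a)"
    by (subst B.nn_integral_fst[symmetric]) auto
  also have "\<dots> = emeasure (beta_law a b) X * emeasure (gamma_law (a + b)) Y"
    by (subst nn_integral_gamma_law_ratio_sum[OF a b]) auto
  finally show "emeasure (beta_law a b) X * emeasure (gamma_law (a + b)) Y =
    emeasure ?D (X \<times> Y)" by simp
qed

lemma gamma_law_pos_AE: "AE x in gamma_law a. x > 0"
  unfolding gamma_law_def by (subst AE_density) (auto intro!: AE_I2 simp: gamma_density_def split: split_indicator)

lemma gamma_law_pair_pos_AE:
  assumes "a > 0" "b > 0"
  shows "AE w in gamma_law a \<Otimes>\<^sub>M gamma_law b. fst w > 0 \<and> snd w > 0"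
proof -
  interpret A: prob_space "gamma_law a" using assms(1) by (rule prob_space_gamma_law)
  interpret B: prob_space "gamma_law b" using assms(2) by (rule prob_space_gamma_law)
  interpret AB: pair_prob_space "gamma_law a" "gamma_law b" ..
  show ?thesis
  proof (rule AB.AE_pair_measure)
    show "AE x in gamma_law a. AE y in gamma_law b. fst (x, y) > 0 \<and> snd (x, y) > 0"
      using gamma_law_pos_AE[of a] by eventually_elim (use gamma_law_pos_AE[of b] in auto)
  qed measurable
qed

text \<open>Euler's integral for \<open>Gamma\<close> at \<open>a + i t\<close>: on the positive
  axis \<open>x powr (i t)\<close> is \<open>iexp (t * ln x)\<close>.\<close>

lemma char_ln_gamma_law:
  assumes a: "a > 0"
  shows "(LINT x|gamma_law a. iexp (t * ln x)) = gamma_ratio t a"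
proof -
  have G: "Gamma a > 0" using a by (rule Gamma_real_pos)
  define z where "z = of_real a + \<i> * of_real t"
  let ?f = "\<lambda>x::real. of_real x powr (z - 1) / of_real (exp x) :: complex"
  have z: "Re z > 0" using a by (simp add: z_def)
  have ai: "?f absolutely_integrable_on {0<..}"
    using absolutely_integrable_Gamma_integral[OF z, of 1] by simp
  have "(?f has_integral (LINT x:{0<..}|lebesgue. ?f x)) {0<..}"
    by (rule has_integral_set_lebesgue[OF ai])
  moreover have "(?f has_integral Gamma z) {0<..}" by (rule Gamma_integral_complex'[OF z])
  ultimately have "Gamma z = (LINT x:{0<..}|lebesgue. ?f x)" by (rule has_integral_unique[rotated])
  also have "\<dots> = (LINT x|lebesgue. indicator {0<..} x *\<^sub>R ?f x)" by (simp add: set_lebesgue_integral_def)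
  also have "\<dots> = (LINT x|lebesgue. of_real (Gamma a) * (gamma_density a x *\<^sub>R iexp (t * ln x)))"
  proof (rule Bochner_Integration.integral_cong[OF refl])
    fix x :: real
    show "indicator {0<..} x *\<^sub>R ?f x = of_real (Gamma a) * (gamma_density a x *\<^sub>R iexp (t * ln x))"
    proof (cases "x > 0")
      case True
      have "of_real x powr (z - 1) = exp ((of_real (a - 1) + \<i> * of_real t) * of_real (ln x) :: complex)"
        using True by (simp add: powr_def z_def Ln_of_real algebra_simps)
      also have "\<dots> = of_real (x powr (a - 1)) * iexp (t * ln x)"
        using True by (simp add: powr_def exp_of_real[symmetric] exp_add[symmetric] distrib_right mult.assoc)
      finally show ?thesis using True G
        by (simp add: gamma_density_def scaleR_conv_of_real exp_minus field_simps)
    qed (simp add: gamma_density_def)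
  qed
  also have "\<dots> = (LINT x|lborel. of_real (Gamma a) * (gamma_density a x *\<^sub>R iexp (t * ln x)))"
    by (rule integral_completion) measurable
  also have "\<dots> = of_real (Gamma a) * (LINT x|lborel. gamma_density a x *\<^sub>R iexp (t * ln x))"
    by (rule integral_mult_right_zero)
  also have "(LINT x|lborel. gamma_density a x *\<^sub>R iexp (t * ln x)) = (LINT x|gamma_law a. iexp (t * ln x))"
    unfolding gamma_law_def
    by (rule integral_density[symmetric]) (auto simp: gamma_density_nonneg[OF a])
  finally show ?thesis using G by (simp add: gamma_ratio_def z_def Gamma_complex_of_real)
qed

lemma gamma_ratio_nonzero:
  assumes "a > 0"
  shows "gamma_ratio t a \<noteq> 0"
proof -
  have "of_real a + \<i> * of_real t \<notin> (\<int>\<^sub>\<le>\<^sub>0 :: complex set)" "of_real a \<notin> (\<int>\<^sub>\<le>\<^sub>0 :: complex set)"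
    using assms by (auto simp: complex_eq_iff elim!: nonpos_Ints_cases)
  thus ?thesis by (simp add: gamma_ratio_def Gamma_eq_zero_iff)
qed

text \<open>For independent Gamma variables \<open>x\<close>, \<open>y\<close> one has
  \<open>ln x = ln r + ln s\<close> with \<open>r\<close> and \<open>s\<close> independent, so the
  characteristic function of \<open>ln x\<close> is a product. It can be solved for the beta factor
  because \<open>gamma_ratio\<close> has no zeros.\<close>

lemma char_ln_beta_law:
  assumes a: "a > 0" and b: "b > 0"
  shows "(LINT r|beta_law a b. iexp (t * ln r)) = gamma_ratio t a / gamma_ratio t (a + b)"
proof -
  let ?P = "gamma_law a \<Otimes>\<^sub>M gamma_law b"
  interpret A: prob_space "gamma_law a" using a by (rule prob_space_gamma_law)
  interpret B: prob_space "gamma_law b" using b by (rule prob_space_gamma_law)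
  interpret S: prob_space "gamma_law (a + b)" using a b by (intro prob_space_gamma_law) auto
  interpret R: prob_space "beta_law a b" using a b by (rule prob_space_beta_law)
  interpret AB: pair_prob_space "gamma_law a" "gamma_law b" ..
  interpret RS: pair_prob_space "beta_law a b" "gamma_law (a + b)" ..
  have "gamma_ratio t a = (LINT x|gamma_law a. iexp (t * ln x))" using char_ln_gamma_law[OF a] by simp
  also have "\<dots> = (LINT x|gamma_law a. LINT y|gamma_law b. iexp (t * ln (fst (x, y))))"
    using B.prob_space by simp
  also have "\<dots> = (LINT w|?P. iexp (t * ln (fst w)))"
    by (intro AB.integral_fst' AB.integrable_const_bound[where B = 1]) auto
  also have "\<dots> = (LINT w|?P. iexp (t * ln (fst w / (fst w + snd w))) * iexp (t * ln (fst w + snd w)))"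
  proof (rule integral_cong_AE)
    show "AE w in ?P. iexp (t * ln (fst w)) = iexp (t * ln (fst w / (fst w + snd w))) * iexp (t * ln (fst w + snd w))"
      using gamma_law_pair_pos_AE[OF a b]
    proof eventually_elim
      case (elim w)
      have "ln (fst w) = ln (fst w / (fst w + snd w)) + ln (fst w + snd w)" using elim by (simp add: ln_div)
      thus ?case by (simp add: exp_add[symmetric] distrib_left)
    qed
  qed auto
  also have "\<dots> = (LINT v|distr ?P (borel \<Otimes>\<^sub>M borel) (\<lambda>(x, y). (x / (x + y), x + y)). iexp (t * ln (fst v)) * iexp (t * ln (snd v)))"
    by (subst integral_distr) (auto simp: case_prod_beta)
  also have "\<dots> = (LINT v|(beta_law a b \<Otimes>\<^sub>M gamma_law (a + b)). iexp (t * ln (fst v)) * iexp (t * ln (snd v)))"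
    by (simp only: gamma_law_ratio_sum_distr[OF a b])
  also have "\<dots> = (LINT r|beta_law a b. LINT s|gamma_law (a + b). iexp (t * ln (fst (r, s))) * iexp (t * ln (snd (r, s))))"
    by (intro RS.integral_fst'[symmetric] RS.integrable_const_bound[where B = 1]) (auto simp: norm_mult)
  also have "\<dots> = (LINT r|beta_law a b. iexp (t * ln r)) * gamma_ratio t (a + b)"
    using char_ln_gamma_law[of "a + b" t] a b by simp
  finally show ?thesis using gamma_ratio_nonzero[of "a + b" t] a b by simp
qed

text \<open>The map from \<open>z\<close> to \<open>z^2 / 2\<close> is two-to-one. The substitution
  is therefore made on the positive half, and the resulting factor 2 is redistributed over both
  halves by symmetry.\<close>

lemma cdf_gamma_law_half:
  assumes "x \<ge> 0"
  shows "emeasure (gamma_law (1/2)) {..x} = (\<integral>\<^sup>+z. ennreal (std_normal_density z) * indicator {-sqrt (2*x)..sqrt (2*x)} z \<partial>lborel)"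
proof -
  let ?\<phi> = "\<lambda>z. ennreal (std_normal_density z)"
  define c where "c = sqrt (2 * x)"
  have c: "c \<ge> 0" "c\<^sup>2 / 2 = x" using assms by (auto simp: c_def)
  have "emeasure (gamma_law (1/2)) {..x} = (\<integral>\<^sup>+u. ennreal (gamma_density (1/2) u) * indicator {0\<^sup>2/2..c\<^sup>2/2} u \<partial>lborel)"
    unfolding gamma_law_def c(2)
    by (subst emeasure_density) (auto intro!: nn_integral_cong simp: gamma_density_def split: split_indicator)
  also have "\<dots> = (\<integral>\<^sup>+z. ennreal (gamma_density (1/2) (z\<^sup>2/2) * z) * indicator {0..c} z \<partial>lborel)"
    unfolding nn_integral_set_ennreal using c
    by (subst nn_integral_substitution[where g = "\<lambda>z. z\<^sup>2/2" and g' = "\<lambda>z. z"])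
      (auto simp: set_borel_measurable_def intro!: derivative_eq_intros continuous_intros)
  also have "\<dots> = (\<integral>\<^sup>+z. ennreal 2 * (?\<phi> z * indicator {0..c} z) \<partial>lborel)"
  proof (rule nn_integral_cong_AE)
    have "AE z::real in lborel. z \<noteq> 0" by (rule AE_lborel_singleton)
    thus "AE z in lborel. ennreal (gamma_density (1/2) (z\<^sup>2/2) * z) * indicator {0..c} z = ennreal 2 * (?\<phi> z * indicator {0..c} z)"
    proof eventually_elim
      case (elim z)
      show ?case
      proof (cases "z \<in> {0..c}")
        case True
        hence z: "z > 0" using elim by auto
        have "gamma_density (1/2) (z\<^sup>2/2) * z = 2 * std_normal_density z"
          using z by (simp add: gamma_density_def std_normal_density_def Gamma_one_half_real powr_minus powr_half_sqrt real_sqrt_divide real_sqrt_mult field_simps)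
        thus ?thesis using True by (simp add: ennreal_mult)
      qed simp
    qed
  qed
  also have "\<dots> = ennreal 2 * (\<integral>\<^sup>+z. ?\<phi> z * indicator {0..c} z \<partial>lborel)"
    by (rule nn_integral_cmult) auto
  also have "\<dots> = (\<integral>\<^sup>+z. ?\<phi> z * indicator {0..c} z \<partial>lborel) +
    (\<integral>\<^sup>+z. ?\<phi> z * indicator {0..c} z \<partial>lborel)"
    by (simp add: mult_2)
  also have "\<dots> = (\<integral>\<^sup>+z. ?\<phi> z * indicator {-c..0} z \<partial>lborel) + (\<integral>\<^sup>+z. ?\<phi> z * indicator {0..c} z \<partial>lborel)"
    by (rule arg_cong2[of _ _ _ _ "(+)", OF _ refl], subst nn_integral_real_affine[where c = "-1" and t = 0])
      (auto intro!: nn_integral_cong simp: std_normal_density_def split: split_indicator)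
  also have "\<dots> = (\<integral>\<^sup>+z. ?\<phi> z * indicator {-c..0} z + ?\<phi> z * indicator {0..c} z \<partial>lborel)"
    by (rule nn_integral_add[symmetric]) auto
  also have "\<dots> = (\<integral>\<^sup>+z. ?\<phi> z * indicator {-c..c} z \<partial>lborel)"
  proof (rule nn_integral_cong_AE)
    have "AE z::real in lborel. z \<noteq> 0" by (rule AE_lborel_singleton)
    thus "AE z in lborel. ?\<phi> z * indicator {-c..0} z + ?\<phi> z * indicator {0..c} z
      = ?\<phi> z * indicator {-c..c} z"
      by eventually_elim (use c in \<open>auto split: split_indicator\<close>)
  qed
  finally show ?thesis unfolding c_def .
qed

lemma distr_half_square_std_normal:
  "distr std_normal_distribution borel (\<lambda>z. z\<^sup>2 / 2) = gamma_law (1/2)"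
proof (rule cdf_unique)
  let ?N = std_normal_distribution
  let ?D = "distr ?N borel (\<lambda>z. z\<^sup>2 / 2)"
  interpret N: prob_space ?N by (rule prob_space_normal_density) simp
  interpret G: prob_space "gamma_law (1/2)" by (rule prob_space_gamma_law) simp
  have [measurable]: "(\<lambda>z. z\<^sup>2 / 2) \<in> ?N \<rightarrow>\<^sub>M borel" by simp
  show "real_distribution ?D"
    by (rule N.real_distribution_distr) simp
  show "real_distribution (gamma_law (1/2))"
    by (simp add: real_distribution_def real_distribution_axioms_def G.prob_space_axioms)
  show "cdf ?D = cdf (gamma_law (1/2))"
  proof
    fix x :: real
    have "emeasure ?D {..x} = emeasure (gamma_law (1/2)) {..x}"
    proof (cases "x \<ge> 0")
      case True
      have iff: "z\<^sup>2 / 2 \<le> x \<longleftrightarrow> \<bar>z\<bar> \<le> sqrt (2*x)" for z :: real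
        using real_sqrt_le_iff[of "z\<^sup>2" "2*x"] by auto
      have "(\<lambda>z. z\<^sup>2 / 2) -` {..x} = {z. z\<^sup>2 / 2 \<le> x}" by auto
      also have "\<dots> = {-sqrt (2*x)..sqrt (2*x)}" unfolding iff by (auto simp: abs_le_iff)
      finally have "(\<lambda>z. z\<^sup>2 / 2) -` {..x} = {-sqrt (2*x)..sqrt (2*x)}" .
      thus ?thesis unfolding cdf_gamma_law_half[OF True]
        by (simp add: emeasure_distr emeasure_density)
    next
      case False
      have "(\<lambda>z. z\<^sup>2 / 2) -` {..x} = {}" using False by (auto simp: not_le) (smt (verit) zero_le_power2 field_sum_of_halves)
      moreover have "emeasure (gamma_law (1/2)) {..x} = 0"
        unfolding gamma_law_def using False
        by (subst emeasure_density) (auto intro!: nn_integral_zero' simp: gamma_density_def split: split_indicator)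
      ultimately show ?thesis by (simp add: emeasure_distr)
    qed
    thus "cdf ?D x = cdf (gamma_law (1/2)) x"
      by (simp add: cdf_def measure_def)
  qed
qed

section \<open>Sums of squares of standard normal coordinates\<close>

abbreviation gaussian :: "nat set \<Rightarrow> (nat \<Rightarrow> real) measure" where
  "gaussian I \<equiv> Pi\<^sub>M I (\<lambda>_. std_normal_distribution)"

interpretation gauss: product_sigma_finite "\<lambda>_ :: nat. std_normal_distribution"
  by (simp add: product_sigma_finite_def prob_space_normal_density prob_space_imp_sigma_finite)

lemma prob_space_gaussian: "prob_space (gaussian I)"
  by (rule prob_space_PiM) (simp add: prob_space_normal_density)

lemma nn_integral_half_square_std_normal:
  assumes [measurable]: "g \<in> borel_measurable borel"
  shows "(\<integral>\<^sup>+z. g (z\<^sup>2 / 2) \<partial>std_normal_distribution) = (\<integral>\<^sup>+u. g u \<partial>gamma_law (1/2))"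
  unfolding distr_half_square_std_normal[symmetric] by (subst nn_integral_distr) auto

lemma nn_integral_chi_square:
  assumes "finite I" "I \<noteq> {}" "g \<in> borel_measurable borel"
  shows "(\<integral>\<^sup>+z. g (\<Sum>i\<in>I. (z i)\<^sup>2 / 2) \<partial>gaussian I) = (\<integral>\<^sup>+u. g u \<partial>gamma_law (real (card I) / 2))"
  using assms
proof (induction I arbitrary: g rule: finite_ne_induct)
  case (singleton i)
  note [measurable] = singleton
  have "(\<integral>\<^sup>+z. g (\<Sum>i\<in>{i}. (z i)\<^sup>2 / 2) \<partial>gaussian {i}) = (\<integral>\<^sup>+z. g ((z i)\<^sup>2 / 2) \<partial>gaussian {i})" by simp
  also have "\<dots> = (\<integral>\<^sup>+z. g (z\<^sup>2 / 2) \<partial>std_normal_distribution)"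
    by (rule gauss.product_nn_integral_singleton) simp
  finally show ?case by (simp add: nn_integral_half_square_std_normal)
next
  case (insert i I)
  note [measurable] = insert.prems
  interpret G1: prob_space "gamma_law (1/2)" by (rule prob_space_gamma_law) simp
  have "(\<integral>\<^sup>+z. g (\<Sum>i\<in>insert i I. (z i)\<^sup>2 / 2) \<partial>gaussian (insert i I)) =
    (\<integral>\<^sup>+x. \<integral>\<^sup>+y. g (\<Sum>j\<in>insert i I. ((x(i := y)) j)\<^sup>2 / 2) \<partial>std_normal_distribution \<partial>gaussian I)"
    using insert.hyps by (intro gauss.product_nn_integral_insert) auto
  also have "\<dots> = (\<integral>\<^sup>+x. \<integral>\<^sup>+y. g ((\<Sum>j\<in>I. (x j)\<^sup>2 / 2) + y\<^sup>2 / 2) \<partial>std_normal_distribution \<partial>gaussian I)"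
  proof (intro nn_integral_cong arg_cong[of _ _ g])
    fix x y
    have "(\<Sum>j\<in>I. ((x(i := y)) j)\<^sup>2 / 2) = (\<Sum>j\<in>I. (x j)\<^sup>2 / 2)"
      using insert.hyps by (intro sum.cong) auto
    thus "(\<Sum>j\<in>insert i I. ((x(i := y)) j)\<^sup>2 / 2) = (\<Sum>j\<in>I. (x j)\<^sup>2 / 2) + y\<^sup>2 / 2"
      using insert.hyps by (simp add: add.commute)
  qed
  also have "\<dots> = (\<integral>\<^sup>+x. \<integral>\<^sup>+u. g ((\<Sum>j\<in>I. (x j)\<^sup>2 / 2) + u) \<partial>gamma_law (1/2) \<partial>gaussian I)"
    by (intro nn_integral_cong nn_integral_half_square_std_normal) simp
  also have "\<dots> = (\<integral>\<^sup>+v. \<integral>\<^sup>+u. g (v + u) \<partial>gamma_law (1/2) \<partial>gamma_law (real (card I) / 2))"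
    by (rule insert.IH) (rule G1.borel_measurable_nn_integral, simp)
  also have "\<dots> = (\<integral>\<^sup>+u. g u \<partial>gamma_law (real (card I) / 2 + 1 / 2))"
    using insert.hyps by (intro nn_integral_gamma_law_sum) (auto simp: card_gt_0_iff)
  also have "real (card I) / 2 + 1 / 2 = real (card (insert i I)) / 2"
    using insert.hyps by (simp add: add_divide_distrib)
  finally show ?case .
qed

text \<open>\<open>L\<close> collects the coordinates on which neither sum depends; they integrate
  out, and Fubini over \<open>I\<close> and \<open>J\<close> gives independence.\<close>

lemma chi_square_pair_distr:
  assumes fin: "finite L" "finite I" "finite J" and ne: "I \<noteq> {}" "J \<noteq> {}"
    and disj: "L \<inter> (I \<union> J) = {}" "I \<inter> J = {}"
  shows "distr (gaussian (L \<union> (I \<union> J))) (borel \<Otimes>\<^sub>M borel) (\<lambda>z. (\<Sum>i\<in>I. (z i)\<^sup>2 / 2, \<Sum>i\<in>J. (z i)\<^sup>2 / 2)) =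
    gamma_law (real (card I) / 2) \<Otimes>\<^sub>M gamma_law (real (card J) / 2)"
proof (rule measure_eqI)
  let ?A = "\<lambda>z. \<Sum>i\<in>I. (z i)\<^sup>2 / 2 :: real" and ?B = "\<lambda>z. \<Sum>i\<in>J. (z i)\<^sup>2 / 2 :: real"
  let ?\<alpha> = "gamma_law (real (card I) / 2)" and ?\<beta> = "gamma_law (real (card J) / 2)"
  have pos: "real (card I) / 2 > 0" "real (card J) / 2 > 0" using fin ne by (auto simp: card_gt_0_iff)
  interpret GJ: prob_space "?\<beta>" by (rule prob_space_gamma_law[OF pos(2)])
  interpret GL: prob_space "gaussian L" by (rule prob_space_gaussian)
  interpret NJ: prob_space "gaussian J" by (rule prob_space_gaussian)
  let ?D = "distr (gaussian (L \<union> (I \<union> J))) (borel \<Otimes>\<^sub>M borel) (\<lambda>z. (?A z, ?B z))"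
  show "sets ?D = sets (?\<alpha> \<Otimes>\<^sub>M ?\<beta>)"
    by (simp cong: sets_pair_measure_cong)
  have S1: "(\<lambda>z. \<Sum>i\<in>I'. (z i)\<^sup>2 / 2 :: real) \<in> borel_measurable (gaussian K)" if "I' \<subseteq> K" for I' K :: "nat set"
  proof (intro borel_measurable_sum borel_measurable_divide borel_measurable_power borel_measurable_const)
    fix i assume "i \<in> I'"
    hence "i \<in> K" using that by auto
    thus "(\<lambda>z. z i) \<in> borel_measurable (gaussian K)"
      using measurable_component_singleton[of i K "\<lambda>_. std_normal_distribution"] by simp
  qed
  have [measurable]: "?A \<in> borel_measurable (gaussian (L \<union> (I \<union> J)))"
    "?B \<in> borel_measurable (gaussian (L \<union> (I \<union> J)))"
    "?A \<in> borel_measurable (gaussian (I \<union> J))"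
    "?B \<in> borel_measurable (gaussian (I \<union> J))"
    "?A \<in> borel_measurable (gaussian I)"
    "?B \<in> borel_measurable (gaussian J)"
    by (auto intro!: S1)
  fix X assume "X \<in> sets ?D"
  hence [measurable]: "X \<in> sets (borel \<Otimes>\<^sub>M borel)" by simp
  define h where "h x y = (indicator X (x, y) :: ennreal)" for x y :: real
  have [measurable]: "(\<lambda>(x, y). h x y) \<in> borel_measurable (borel \<Otimes>\<^sub>M borel)"
    unfolding h_def by measurable
  have "emeasure ?D X = (\<integral>\<^sup>+z. h (?A z) (?B z) \<partial>gaussian (L \<union> (I \<union> J)))"
    unfolding h_def by (subst nn_integral_indicator[symmetric], simp, subst nn_integral_distr) auto
  also have "\<dots> = (\<integral>\<^sup>+w. \<integral>\<^sup>+z. h (?A (merge L (I \<union> J) (w, z))) (?B (merge L (I \<union> J) (w, z))) \<partial>gaussian (I \<union> J) \<partial>gaussian L)"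
    using fin disj by (intro gauss.product_nn_integral_fold) auto
  also have "\<dots> = (\<integral>\<^sup>+w. \<integral>\<^sup>+z. h (?A z) (?B z) \<partial>gaussian (I \<union> J) \<partial>gaussian L)"
    using disj by (intro nn_integral_cong arg_cong2[of _ _ _ _ h] sum.cong) (auto simp: merge_def)
  also have "\<dots> = (\<integral>\<^sup>+z. h (?A z) (?B z) \<partial>gaussian (I \<union> J))"
    by (simp add: GL.emeasure_space_1)
  also have "\<dots> = (\<integral>\<^sup>+w. \<integral>\<^sup>+z. h (?A (merge I J (w, z))) (?B (merge I J (w, z))) \<partial>gaussian J \<partial>gaussian I)"
    using fin disj by (intro gauss.product_nn_integral_fold) auto
  also have "\<dots> = (\<integral>\<^sup>+w. \<integral>\<^sup>+z. h (?A w) (?B z) \<partial>gaussian J \<partial>gaussian I)"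
    using disj by (intro nn_integral_cong arg_cong2[of _ _ _ _ h] sum.cong) (auto simp: merge_def)
  also have "\<dots> = (\<integral>\<^sup>+w. \<integral>\<^sup>+y. h (?A w) y \<partial>?\<beta> \<partial>gaussian I)"
    using fin ne by (intro nn_integral_cong nn_integral_chi_square) auto
  also have "\<dots> = (\<integral>\<^sup>+x. \<integral>\<^sup>+y. h x y \<partial>?\<beta> \<partial>?\<alpha>)"
    using fin ne by (intro nn_integral_chi_square) auto
  also have "\<dots> = emeasure (?\<alpha> \<Otimes>\<^sub>M ?\<beta>) X"
    unfolding h_def by (subst GJ.emeasure_pair_measure) auto
  finally show "emeasure ?D X = emeasure (?\<alpha> \<Otimes>\<^sub>M ?\<beta>) X" .
qed

text \<open>The sums are nested, so their quotient is \<open>A / (A + B)\<close> with independent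
  \<open>A\<close> and \<open>B\<close>, which has a beta law. For \<open>u = v\<close> that law
  would degenerate, hence the separate case.\<close>

lemma char_ln_chi_square_ratio:
  assumes uv: "u \<le> v" "v < n"
  shows "(LINT z|gaussian {..<n}. iexp (t * (ln (\<Sum>i\<in>{v..<n}. (z i)\<^sup>2) - ln (\<Sum>i\<in>{u..<n}. (z i)\<^sup>2)))) =
    chi_ratio t (n - v) / chi_ratio t (n - u)"
proof (cases "u = v")
  case True
  interpret P: prob_space "gaussian {..<n}" by (rule prob_space_gaussian)
  show ?thesis using True uv gamma_ratio_nonzero[of "real (n - v) / 2" t] P.prob_space
    by (simp add: chi_ratio_def)
next
  case False
  hence u: "u < v" using uv by simp
  define I where "I = {v..<n}"
  define J where "J = {u..<v}"
  have K: "{..<u} \<union> (I \<union> J) = {..<n}" "{u..<n} = I \<union> J" using u uv by (auto simp: I_def J_def)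
  have fin: "finite I" "finite J" "I \<noteq> {}" "J \<noteq> {}" "{..<u} \<inter> (I \<union> J) = {}" "I \<inter> J = {}" "card I = n - v" "card J = v - u"
    using u uv by (auto simp: I_def J_def)
  define a b where "a = real (n - v) / 2" and "b = real (v - u) / 2"
  have ab: "a > 0" "b > 0" "a + b = real (n - u) / 2" using u uv by (auto simp: a_def b_def field_simps)
  let ?G = "gaussian {..<n}" and ?P = "gamma_law a \<Otimes>\<^sub>M gamma_law b"
  have D: "distr ?G (borel \<Otimes>\<^sub>M borel) (\<lambda>z. (\<Sum>i\<in>I. (z i)\<^sup>2 / 2, \<Sum>i\<in>J. (z i)\<^sup>2 / 2)) =
    ?P"
    using chi_square_pair_distr[of "{..<u}" I J] fin unfolding K a_def b_def by auto
  interpret A: prob_space "gamma_law a" using ab(1) by (rule prob_space_gamma_law)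
  interpret B: prob_space "gamma_law b" using ab(2) by (rule prob_space_gamma_law)
  interpret S: prob_space "gamma_law (a + b)" using ab by (intro prob_space_gamma_law) auto
  interpret R: prob_space "beta_law a b" using ab by (intro prob_space_beta_law)
  interpret AB: pair_prob_space "gamma_law a" "gamma_law b" ..
  interpret RS: pair_prob_space "beta_law a b" "gamma_law (a + b)" ..
  have m: "(\<lambda>z. \<Sum>i\<in>K. (z i)\<^sup>2 / 2) \<in> borel_measurable ?G" if "K \<subseteq> {..<n}" for K
  proof (intro borel_measurable_sum borel_measurable_divide borel_measurable_power borel_measurable_const)
    fix i assume "i \<in> K"
    thus "(\<lambda>z. z i) \<in> borel_measurable ?G"
      using that measurable_component_singleton[of i "{..<n}" "\<lambda>_. std_normal_distribution"] by auto
  qed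
  have [measurable]: "(\<lambda>z. \<Sum>i\<in>I. (z i)\<^sup>2 / 2) \<in> borel_measurable ?G"
    "(\<lambda>z. \<Sum>i\<in>J. (z i)\<^sup>2 / 2) \<in> borel_measurable ?G"
    by (auto intro!: m simp: I_def J_def) (use uv in auto)
  have sq: "(\<Sum>i\<in>K. (z i)\<^sup>2) = 2 * (\<Sum>i\<in>K. (z i)\<^sup>2 / 2)" for K and z :: "nat \<Rightarrow> real"
    by (simp add: sum_divide_distrib[symmetric])
  have "(LINT z|?G. iexp (t * (ln (\<Sum>i\<in>{v..<n}. (z i)\<^sup>2) - ln (\<Sum>i\<in>{u..<n}. (z i)\<^sup>2)))) =
    (LINT z|?G. (\<lambda>w. iexp (t * (ln (2 * fst w) - ln (2 * (fst w + snd w)))))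
      (\<Sum>i\<in>I. (z i)\<^sup>2 / 2, \<Sum>i\<in>J. (z i)\<^sup>2 / 2))"
    unfolding K(2) sq I_def[symmetric] using fin by (simp add: sum.union_disjoint)
  also have "\<dots> = (LINT w|?P. iexp (t * (ln (2 * fst w) - ln (2 * (fst w + snd w)))))"
    unfolding D[symmetric] by (rule integral_distr[symmetric]) measurable
  also have "\<dots> = (LINT w|?P. iexp (t * ln (fst w / (fst w + snd w))))"
  proof (rule integral_cong_AE)
    show "AE w in ?P. iexp (t * (ln (2 * fst w) - ln (2 * (fst w + snd w)))) = iexp (t * ln (fst w / (fst w + snd w)))"
      using gamma_law_pair_pos_AE[OF ab(1,2)]
    proof eventually_elim
      case (elim w)
      have "ln (2 * fst w) - ln (2 * (fst w + snd w)) = ln (fst w) - ln (fst w + snd w)"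
        using elim ln_mult_pos[of 2 "fst w"] ln_mult_pos[of 2 "fst w + snd w"] by simp
      also have "\<dots> = ln (fst w / (fst w + snd w))" using elim by (simp add: ln_div)
      finally show ?case by simp
    qed
  qed auto
  also have "\<dots> = (LINT v|distr ?P (borel \<Otimes>\<^sub>M borel) (\<lambda>(x, y). (x / (x + y), x + y)). iexp (t * ln (fst v)))"
    by (subst integral_distr) (auto simp: case_prod_beta)
  also have "\<dots> = (LINT v|(beta_law a b \<Otimes>\<^sub>M gamma_law (a + b)). iexp (t * ln (fst v)))"
    by (simp only: gamma_law_ratio_sum_distr[OF ab(1,2)])
  also have "\<dots> = (LINT r|beta_law a b. LINT s|gamma_law (a + b). iexp (t * ln (fst (r, s))))"
    by (intro RS.integral_fst'[symmetric] RS.integrable_const_bound[where B = 1]) auto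
  also have "\<dots> = (LINT r|beta_law a b. iexp (t * ln r))" using S.prob_space by simp
  also have "\<dots> = chi_ratio t (n - v) / chi_ratio t (n - u)"
    unfolding char_ln_beta_law[OF ab(1,2)] chi_ratio_def ab(3) by (simp add: a_def)
  finally show ?thesis .
qed

lemma chi_square_pos_AE:
  assumes "v < n"
  shows "AE z in gaussian {..<n}. (\<Sum>i\<in>{v..<n}. (z i)\<^sup>2) > 0"
proof -
  interpret P: product_prob_space "\<lambda>_ :: nat. std_normal_distribution" "{..<n}"
    by (simp add: product_prob_space_def product_prob_space_axioms_def gauss.product_sigma_finite_axioms prob_space_normal_density)
  have "AE x in std_normal_distribution. x \<noteq> 0"
    by (subst AE_density) (auto intro: AE_mp[OF AE_lborel_singleton[of 0]])
  hence "AE z in gaussian {..<n}. z v \<noteq> 0"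
    using assms by (intro P.AE_component) auto
  thus ?thesis
  proof eventually_elim
    case (elim z)
    have "0 < (z v)\<^sup>2" using elim by simp
    also have "(z v)\<^sup>2 \<le> (\<Sum>i\<in>{v..<n}. (z i)\<^sup>2)" using assms by (intro member_le_sum) auto
    finally show ?case .
  qed
qed

section \<open>Rotations of Gaussian vectors\<close>

lemma nn_integral_shear_fst:
  fixes f :: "real \<Rightarrow> real \<Rightarrow> ennreal"
  assumes [measurable]: "(\<lambda>(x, y). f x y) \<in> borel_measurable (borel \<Otimes>\<^sub>M borel)"
  shows "(\<integral>\<^sup>+x. \<integral>\<^sup>+y. f (x + t * y) y \<partial>lborel \<partial>lborel) = (\<integral>\<^sup>+x. \<integral>\<^sup>+y. f x y \<partial>lborel \<partial>lborel)"
proof -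
  have "(\<integral>\<^sup>+x. \<integral>\<^sup>+y. f (x + t * y) y \<partial>lborel \<partial>lborel) = (\<integral>\<^sup>+y. \<integral>\<^sup>+x. f (x + t * y) y \<partial>lborel \<partial>lborel)"
    by (rule lborel_pair.Fubini') simp
  also have "\<dots> = (\<integral>\<^sup>+y. \<integral>\<^sup>+x. f x y \<partial>lborel \<partial>lborel)"
  proof (rule nn_integral_cong)
    fix y
    show "(\<integral>\<^sup>+x. f (x + t * y) y \<partial>lborel) = (\<integral>\<^sup>+x. f x y \<partial>lborel)"
      by (subst (2) nn_integral_real_affine[where c = 1 and t = "t * y"]) (auto simp: add.commute)
  qed
  also have "\<dots> = (\<integral>\<^sup>+x. \<integral>\<^sup>+y. f x y \<partial>lborel \<partial>lborel)"
    by (rule lborel_pair.Fubini') simp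
  finally show ?thesis .
qed

lemma nn_integral_shear_snd:
  fixes f :: "real \<Rightarrow> real \<Rightarrow> ennreal"
  assumes [measurable]: "(\<lambda>(x, y). f x y) \<in> borel_measurable (borel \<Otimes>\<^sub>M borel)"
  shows "(\<integral>\<^sup>+x. \<integral>\<^sup>+y. f x (y + t * x) \<partial>lborel \<partial>lborel) = (\<integral>\<^sup>+x. \<integral>\<^sup>+y. f x y \<partial>lborel \<partial>lborel)"
proof (rule nn_integral_cong)
  fix x
  show "(\<integral>\<^sup>+y. f x (y + t * x) \<partial>lborel) = (\<integral>\<^sup>+y. f x y \<partial>lborel)"
    by (subst (2) nn_integral_real_affine[where c = 1 and t = "t * x"]) (auto simp: add.commute)
qed

text \<open>A rotation is a product of three shears, and each shear preserves Lebesgue measure by translation invariance.\<close>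

lemma nn_integral_rotate:
  fixes f :: "real \<Rightarrow> real \<Rightarrow> ennreal"
  assumes f [measurable]: "(\<lambda>(x, y). f x y) \<in> borel_measurable (borel \<Otimes>\<^sub>M borel)"
    and cs: "c\<^sup>2 + s\<^sup>2 = 1" "s \<noteq> 0"
  shows "(\<integral>\<^sup>+x. \<integral>\<^sup>+y. f (c * x + s * y) (- s * x + c * y) \<partial>lborel \<partial>lborel) = (\<integral>\<^sup>+x. \<integral>\<^sup>+y. f x y \<partial>lborel \<partial>lborel)"
proof -
  \<comment> \<open>The tangent of half the rotation angle: the rotation is the composition of
    shears with coefficients \<open>t\<close>, \<open>- s\<close>, \<open>t\<close>.\<close>
  define t where "t = (1 - c) / s"
  have ts: "t * s = 1 - c" using cs by (simp add: t_def)
  have "t * (1 + c) * s = (1 - c) * (1 + c)" using ts by (metis mult.assoc mult.commute)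
  also have "\<dots> = s * s" using cs(1) by (simp add: power2_eq_square algebra_simps)
  finally have tc: "t * (1 + c) = s" using cs(2) by simp
  define H where "H x y = f (x + t * y) y" for x y
  define G where "G x y = H x (y + (- s) * x)" for x y
  have [measurable]: "(\<lambda>(x, y). H x y) \<in> borel_measurable (borel \<Otimes>\<^sub>M borel)"
    "(\<lambda>(x, y). G x y) \<in> borel_measurable (borel \<Otimes>\<^sub>M borel)"
    unfolding G_def H_def by measurable
  have e1: "y + (- s) * (x + t * y) = - s * x + c * y" for x y
  proof -
    have "y + (- s) * (x + t * y) = - s * x + (1 - t * s) * y" by (simp add: algebra_simps)
    thus ?thesis unfolding ts by simp
  qed
  have e2: "(x + t * y) + t * (- s * x + c * y) = c * x + s * y" for x y
  proof -
    have "(x + t * y) + t * (- s * x + c * y) = (1 - t * s) * x + (t * (1 + c)) * y" by (simp add: algebra_simps)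
    thus ?thesis unfolding ts tc by simp
  qed
  have "(\<integral>\<^sup>+x. \<integral>\<^sup>+y. f (c * x + s * y) (- s * x + c * y) \<partial>lborel \<partial>lborel) = (\<integral>\<^sup>+x. \<integral>\<^sup>+y. G (x + t * y) y \<partial>lborel \<partial>lborel)"
    unfolding G_def H_def e1 e2 ..
  also have "\<dots> = (\<integral>\<^sup>+x. \<integral>\<^sup>+y. G x y \<partial>lborel \<partial>lborel)" by (rule nn_integral_shear_fst) measurable
  also have "\<dots> = (\<integral>\<^sup>+x. \<integral>\<^sup>+y. H x y \<partial>lborel \<partial>lborel)" unfolding G_def by (rule nn_integral_shear_snd) measurable
  also have "\<dots> = (\<integral>\<^sup>+x. \<integral>\<^sup>+y. f x y \<partial>lborel \<partial>lborel)" unfolding H_def by (rule nn_integral_shear_fst) measurable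
  finally show ?thesis .
qed

lemma nn_integral_std_normal_rotate:
  fixes f :: "real \<Rightarrow> real \<Rightarrow> ennreal"
  assumes f [measurable]: "(\<lambda>(x, y). f x y) \<in> borel_measurable (borel \<Otimes>\<^sub>M borel)"
    and cs: "c\<^sup>2 + s\<^sup>2 = 1" "s \<noteq> 0"
  shows "(\<integral>\<^sup>+x. \<integral>\<^sup>+y. f (c * x + s * y) (- s * x + c * y) \<partial>std_normal_distribution \<partial>std_normal_distribution) =
    (\<integral>\<^sup>+x. \<integral>\<^sup>+y. f x y \<partial>std_normal_distribution \<partial>std_normal_distribution)"
proof -
  have dens: "(\<integral>\<^sup>+x. \<integral>\<^sup>+y. g x y \<partial>std_normal_distribution \<partial>std_normal_distribution) =
    (\<integral>\<^sup>+x. \<integral>\<^sup>+y. ennreal (std_normal_density x * std_normal_density y) * g x y \<partial>lborel \<partial>lborel)"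
    if [measurable]: "(\<lambda>(x, y). g x y) \<in> borel_measurable (borel \<Otimes>\<^sub>M borel)" for g :: "real \<Rightarrow> real \<Rightarrow> ennreal"
    by (subst (1 2) nn_integral_density) (auto simp: nn_integral_cmult[symmetric] ennreal_mult mult.assoc)
  have inv: "std_normal_density (c * x + s * y) * std_normal_density (- s * x + c * y) = std_normal_density x * std_normal_density y" for x y
  proof -
    have "(c * x + s * y)\<^sup>2 + (- s * x + c * y)\<^sup>2 = (c\<^sup>2 + s\<^sup>2) * (x\<^sup>2 + y\<^sup>2)" by (simp add: power2_eq_square algebra_simps)
    hence e: "- (c * x + s * y)\<^sup>2 / 2 + - (- s * x + c * y)\<^sup>2 / 2 = - x\<^sup>2 / 2 + - y\<^sup>2 / 2"
      using cs(1) by simp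
    have "std_normal_density u * std_normal_density v = (1 / sqrt (2 * pi))\<^sup>2 * exp (- u\<^sup>2 / 2 + - v\<^sup>2 / 2)" for u v
      by (simp only: std_normal_density_def exp_add power2_eq_square mult.assoc mult.left_commute)
    thus ?thesis by (simp only: e)
  qed
  have "(\<integral>\<^sup>+x. \<integral>\<^sup>+y. f (c * x + s * y) (- s * x + c * y) \<partial>std_normal_distribution \<partial>std_normal_distribution) =
    (\<integral>\<^sup>+x. \<integral>\<^sup>+y. ennreal (std_normal_density (c * x + s * y) * std_normal_density (- s * x + c * y)) * f (c * x + s * y) (- s * x + c * y) \<partial>lborel \<partial>lborel)"
    unfolding inv by (rule dens) measurable
  also have "\<dots> = (\<integral>\<^sup>+x. \<integral>\<^sup>+y. ennreal (std_normal_density x * std_normal_density y) * f x y \<partial>lborel \<partial>lborel)"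
    by (rule nn_integral_rotate[OF _ cs]) measurable
  finally show ?thesis by (simp only: dens[OF f])
qed

section \<open>Orthogonal maps composed of plane rotations\<close>

definition dot :: "nat \<Rightarrow> (nat \<Rightarrow> real) \<Rightarrow> (nat \<Rightarrow> real) \<Rightarrow> real" where
  "dot n x y = (\<Sum>k<n. x k * y k)"

text \<open>An orthogonal map, kept as an operator on functions. Invariance of the Gaussian law is
  built in: it is checked for plane rotations and inherited by compositions.\<close>

definition gaussian_isometry :: "nat \<Rightarrow> ((nat \<Rightarrow> real) \<Rightarrow> nat \<Rightarrow> real) \<Rightarrow> bool" where
  "gaussian_isometry n T \<longleftrightarrow> T \<in> gaussian {..<n} \<rightarrow>\<^sub>M gaussian {..<n} \<and>
     distr (gaussian {..<n}) (gaussian {..<n}) T = gaussian {..<n} \<and>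
     (\<forall>x y. dot n (T x) (T y) = dot n x y) \<and>
     (\<forall>a b x y. T (\<lambda>k. a * x k + b * y k) = (\<lambda>k. a * T x k + b * T y k))"

lemma gaussian_isometry_id: "gaussian_isometry n (\<lambda>x. x)"
  by (simp add: gaussian_isometry_def)

lemma gaussian_isometry_comp:
  assumes "gaussian_isometry n S" "gaussian_isometry n T"
  shows "gaussian_isometry n (\<lambda>x. S (T x))"
proof -
  have m: "S \<in> gaussian {..<n} \<rightarrow>\<^sub>M gaussian {..<n}" "T \<in> gaussian {..<n} \<rightarrow>\<^sub>M gaussian {..<n}"
    using assms by (auto simp: gaussian_isometry_def)
  have "distr (gaussian {..<n}) (gaussian {..<n}) (\<lambda>x. S (T x)) = distr (distr (gaussian {..<n}) (gaussian {..<n}) T) (gaussian {..<n}) S"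
    by (subst distr_distr[OF m]) (simp add: comp_def)
  also have "\<dots> = gaussian {..<n}" using assms by (simp add: gaussian_isometry_def)
  finally show ?thesis using assms measurable_compose[OF m(2,1)] by (simp add: gaussian_isometry_def)
qed

definition givens :: "nat \<Rightarrow> nat \<Rightarrow> real \<Rightarrow> real \<Rightarrow> (nat \<Rightarrow> real) \<Rightarrow> nat \<Rightarrow> real" where
  "givens i j c s x = x(i := c * x i + s * x j, j := - s * x i + c * x j)"

lemma gaussian_isometry_givens:
  assumes ij: "i < n" "j < n" "i \<noteq> j" and cs: "c\<^sup>2 + s\<^sup>2 = 1" "s \<noteq> 0"
  shows "gaussian_isometry n (givens i j c s)"
  unfolding gaussian_isometry_def
proof (intro conjI allI)
  let ?G = "gaussian {..<n}" and ?N = std_normal_distribution and ?R = "givens i j c s"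
  define K where "K = {..<n} - {i, j}"
  have K: "{..<n} = insert i (insert j K)" "finite K" "i \<notin> insert j K" "j \<notin> K" using ij by (auto simp: K_def)
  have comp [measurable]: "(\<lambda>x. x k) \<in> borel_measurable ?G" if "k < n" for k
    using measurable_component_singleton[of k "{..<n}" "\<lambda>_. ?N"] that by simp
  show m: "?R \<in> ?G \<rightarrow>\<^sub>M ?G"
    unfolding givens_def using ij
    by (intro measurable_fun_upd[where J = "{..<n}"]) (auto intro!: borel_measurable_add borel_measurable_times)
  have nn: "(\<integral>\<^sup>+z. f (?R z) \<partial>?G) = (\<integral>\<^sup>+z. f z \<partial>?G)"
    if f [measurable]: "f \<in> borel_measurable ?G" for f
  proof -
    have split: "(\<integral>\<^sup>+z. g z \<partial>?G) =
      (\<integral>\<^sup>+x. \<integral>\<^sup>+w. \<integral>\<^sup>+y. g (x(j := w, i := y)) \<partial>?N \<partial>?N \<partial>gaussian K)"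
      if g: "g \<in> borel_measurable ?G" for g :: "(nat \<Rightarrow> real) \<Rightarrow> ennreal"
    proof -
      have N: "sigma_finite_measure ?N"
        by (intro prob_space_imp_sigma_finite prob_space_normal_density) simp
      have g' [measurable]: "g \<in> borel_measurable (gaussian (insert i (insert j K)))" using g K by simp
      have "(\<integral>\<^sup>+z. g z \<partial>?G) = (\<integral>\<^sup>+x. \<integral>\<^sup>+y. g (x(i := y)) \<partial>?N \<partial>gaussian (insert j K))"
        unfolding K(1) using K by (intro gauss.product_nn_integral_insert g') auto
      also have "\<dots> = (\<integral>\<^sup>+x. \<integral>\<^sup>+w. (\<lambda>x. \<integral>\<^sup>+y. g (x(i := y)) \<partial>?N) (x(j := w)) \<partial>?N \<partial>gaussian K)"
      proof (intro gauss.product_nn_integral_insert K sigma_finite_measure.borel_measurable_nn_integral[OF N])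
        have "(\<lambda>(x, y). x(i := y)) \<in> gaussian (insert j K) \<Otimes>\<^sub>M ?N \<rightarrow>\<^sub>M gaussian (insert i (insert j K))"
          by (rule measurable_add_dim)
        thus "(\<lambda>(x, y). g (x(i := y))) \<in> borel_measurable (gaussian (insert j K) \<Otimes>\<^sub>M ?N)"
          using measurable_compose[OF _ g'] by (simp add: case_prod_beta)
      qed
      finally show ?thesis .
    qed
    have "(\<integral>\<^sup>+z. f (?R z) \<partial>?G) =
      (\<integral>\<^sup>+x. \<integral>\<^sup>+w. \<integral>\<^sup>+y. f (?R (x(j := w, i := y))) \<partial>?N \<partial>?N \<partial>gaussian K)"
      by (rule split, rule measurable_compose[OF m f])
    also have "\<dots> = (\<integral>\<^sup>+x. \<integral>\<^sup>+w. \<integral>\<^sup>+y. f (x(j := w, i := y)) \<partial>?N \<partial>?N \<partial>gaussian K)"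
    proof (rule nn_integral_cong)
      fix x assume x: "x \<in> space (gaussian K)"
      \<comment> \<open>The outer integral runs over coordinate \<open>j\<close> and the inner one
        over \<open>i\<close>; in this order the rotation has \<open>- s\<close> in place of
        \<open>s\<close>.\<close>
      have g: "?R (x(j := w, i := y)) = x(j := c * w + (- s) * y, i := - (- s) * w + c * y)" for w y
        using ij by (auto simp: givens_def fun_eq_iff)
      have "(\<lambda>(w, y). x(j := w, i := y)) \<in> borel \<Otimes>\<^sub>M borel \<rightarrow>\<^sub>M ?G"
        unfolding case_prod_beta
      proof (rule measurable_fun_upd[where J = "insert j K"])
        show "(\<lambda>w. x(j := fst w)) \<in> borel \<Otimes>\<^sub>M borel \<rightarrow>\<^sub>M gaussian (insert j K)"
          by (rule measurable_fun_upd[where J = K]) (use x in auto)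
      qed (use K in auto)
      from measurable_compose[OF this f]
      have "(\<lambda>(w, y). f (x(j := w, i := y))) \<in> borel_measurable (borel \<Otimes>\<^sub>M borel)" by (simp add: case_prod_beta)
      thus "(\<integral>\<^sup>+w. \<integral>\<^sup>+y. f (?R (x(j := w, i := y))) \<partial>?N \<partial>?N) =
        (\<integral>\<^sup>+w. \<integral>\<^sup>+y. f (x(j := w, i := y)) \<partial>?N \<partial>?N)"
        unfolding g using cs by (intro nn_integral_std_normal_rotate[where f = "\<lambda>w y. f (x(j := w, i := y))"]) auto
    qed
    also have "\<dots> = (\<integral>\<^sup>+z. f z \<partial>?G)" by (rule split[symmetric, OF f])
    finally show ?thesis .
  qed
  show "distr ?G ?G ?R = ?G"
  proof (rule measure_eqI)
    fix X assume "X \<in> sets (distr ?G ?G ?R)"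
    hence X [measurable]: "X \<in> sets ?G" by simp
    have "emeasure (distr ?G ?G ?R) X = (\<integral>\<^sup>+z. indicator X (?R z) \<partial>?G)"
      using m by (subst nn_integral_indicator[symmetric], simp, subst nn_integral_distr) auto
    also have "\<dots> = emeasure ?G X" by (subst nn) auto
    finally show "emeasure (distr ?G ?G ?R) X = emeasure ?G X" .
  qed simp
  show "dot n (?R x) (?R y) = dot n x y" for x y
  proof -
    have sp: "dot n u v = u i * v i + (u j * v j + (\<Sum>k\<in>K. u k * v k))" for u v
      unfolding dot_def K(1) using K by simp
    have k: "(\<Sum>k\<in>K. ?R x k * ?R y k) = (\<Sum>k\<in>K. x k * y k)"
      using K by (intro sum.cong) (auto simp: givens_def)
    have "(c * x i + s * x j) * (c * y i + s * y j) + (- s * x i + c * x j) * (- s * y i + c * y j)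
      = (c\<^sup>2 + s\<^sup>2) * (x i * y i + x j * y j)" by (simp add: power2_eq_square algebra_simps)
    thus ?thesis unfolding sp k using ij cs(1) by (simp add: givens_def)
  qed
  show "?R (\<lambda>k. a * x k + b * y k) = (\<lambda>k. a * ?R x k + b * ?R y k)" for a b x y
    by (auto simp: givens_def fun_eq_iff algebra_simps)
qed

text \<open>Rotations in the planes of coordinates \<open>j\<close> and \<open>m\<close> move entry
  \<open>m\<close> of \<open>w\<close> into entry \<open>j\<close>, one \<open>m\<close> after the
  other. The two clauses about arbitrary \<open>x\<close> protect vectors reduced earlier: entries
  below \<open>j\<close> stay fixed, and a vector vanishing from \<open>j\<close> on keeps vanishing
  there.\<close>

lemma gaussian_isometry_annihilate:
  assumes "j < m" "m \<le> n"
  shows "\<exists>T. gaussian_isometry n T \<and> (\<forall>x. \<forall>k<j. T x k = x k) \<and>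
    (\<forall>x. (\<forall>k. j \<le> k \<and> k < n \<longrightarrow> x k = 0) \<longrightarrow> (\<forall>k. j \<le> k \<and> k < n \<longrightarrow> T x k = 0)) \<and>
    (\<forall>k. j < k \<and> k < m \<longrightarrow> T w k = 0)"
  using assms
proof (induction m)
  case (Suc m)
  show ?case
  proof (cases "j = m")
    case True
    thus ?thesis by (intro exI[of _ "\<lambda>x. x"]) (auto simp: gaussian_isometry_id)
  next
    case False
    hence jm: "j < m" "m < n" using Suc.prems by auto
    obtain T where T0: "gaussian_isometry n T" "\<forall>x. \<forall>k<j. T x k = x k"
      "\<forall>x. (\<forall>k. j \<le> k \<and> k < n \<longrightarrow> x k = 0) \<longrightarrow> (\<forall>k. j \<le> k \<and> k < n \<longrightarrow> T x k = 0)"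
      "\<forall>k. j < k \<and> k < m \<longrightarrow> T w k = 0" using Suc.IH[OF jm(1) less_imp_le[OF jm(2)]] by (elim exE conjE) (rule that)
    note T = T0(2)[THEN spec, THEN spec, THEN mp] T0(3)[THEN spec, THEN mp, THEN spec, THEN mp]
      T0(4)[THEN spec, THEN mp]
    show ?thesis
    proof (cases "T w m = 0")
      case True
      show ?thesis
      proof (intro exI[of _ T] conjI T0(1-3) allI impI)
        fix k assume "j < k \<and> k < Suc m"
        thus "T w k = 0" using T0(4) True by (cases "k = m") auto
      qed
    next
      case False
      define r where "r = sqrt ((T w j)\<^sup>2 + (T w m)\<^sup>2)"
      have "(T w m)\<^sup>2 > 0" using False by simp
      hence r: "r > 0" "r\<^sup>2 = (T w j)\<^sup>2 + (T w m)\<^sup>2" by (auto simp: r_def add_nonneg_pos)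
      define c s where "c = T w j / r" and "s = T w m / r"
      have cs: "c\<^sup>2 + s\<^sup>2 = 1" "s \<noteq> 0"
        using r False by (simp_all add: c_def s_def power_divide add_divide_distrib[symmetric])
      let ?S = "\<lambda>x. givens j m c s (T x)"
      show ?thesis
      proof (intro exI[of _ ?S] conjI allI impI)
        show "gaussian_isometry n ?S"
          using jm cs by (intro gaussian_isometry_comp[OF gaussian_isometry_givens T0(1)]) auto
      next
        fix x :: "nat \<Rightarrow> real" and k assume "k < j"
        thus "?S x k = x k" using jm T(1) by (simp add: givens_def)
      next
        fix x :: "nat \<Rightarrow> real" and k assume x: "\<forall>k. j \<le> k \<and> k < n \<longrightarrow> x k = 0" and k: "j \<le> k \<and> k < n"
        have "T x l = 0" if "j \<le> l" "l < n" for l using T(2)[OF x] that by simp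
        thus "?S x k = 0" using k jm by (simp add: givens_def)
      next
        fix k assume k: "j < k \<and> k < Suc m"
        show "?S w k = 0"
        proof (cases "k = m")
          case True
          thus ?thesis using jm by (simp add: givens_def c_def s_def)
        next
          case False
          thus ?thesis using T(3)[of k] k jm by (simp add: givens_def)
        qed
      qed
    qed
  qed
qed simp

text \<open>QR factorisation by plane rotations. The vectors may be linearly dependent, and there
  may be more of them than coordinates, in which case the surplus ones impose no condition.\<close>

lemma gaussian_isometry_triangularise:
  "\<exists>T. gaussian_isometry n T \<and> (\<forall>j<v. \<forall>k. j < k \<and> k < n \<longrightarrow> T (e j) k = 0)"
proof (induction v)
  case 0
  show ?case by (intro exI[of _ "\<lambda>x. x"]) (auto simp: gaussian_isometry_id)
next
  case (Suc v)
  then obtain T where T: "gaussian_isometry n T" "\<And>j k. j < v \<Longrightarrow> j < k \<Longrightarrow> k < n \<Longrightarrow> T (e j) k = 0" by blast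
  show ?case
  proof (cases "v < n")
    case True
    obtain S where S0: "gaussian_isometry n S" "\<forall>x. \<forall>k<v. S x k = x k"
      "\<forall>x. (\<forall>k. v \<le> k \<and> k < n \<longrightarrow> x k = 0) \<longrightarrow> (\<forall>k. v \<le> k \<and> k < n \<longrightarrow> S x k = 0)"
      "\<forall>k. v < k \<and> k < n \<longrightarrow> S (T (e v)) k = 0"
      using gaussian_isometry_annihilate[OF True order_refl, of "T (e v)"] by (elim exE conjE) (rule that)
    note S = S0(2)[THEN spec, THEN spec, THEN mp] S0(3)[THEN spec, THEN mp, THEN spec, THEN mp]
      S0(4)[THEN spec, THEN mp]
    show ?thesis
    proof (intro exI[of _ "\<lambda>x. S (T x)"] conjI allI impI)
      show "gaussian_isometry n (\<lambda>x. S (T x))" by (rule gaussian_isometry_comp[OF S0(1) T(1)])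
    next
      fix j k assume j: "j < Suc v" and k: "j < k \<and> k < n"
      show "S (T (e j)) k = 0"
      proof (cases "j = v")
        case True thus ?thesis using S(3) k by simp
      next
        case False
        hence z: "\<forall>k. v \<le> k \<and> k < n \<longrightarrow> T (e j) k = 0" using j T(2)[of j] by auto
        show ?thesis
        proof (cases "k < v")
          case True
          thus ?thesis using S(1)[OF True] T(2)[of j k] j k by simp
        next
          case False
          thus ?thesis using S(2)[OF z] k by simp
        qed
      qed
    qed
  next
    case False
    thus ?thesis using T by (intro exI[of _ T]) (auto simp: less_Suc_eq)
  qed
qed

lemma gaussian_isometry_linear:
  assumes T: "gaussian_isometry n T"
  shows "T (\<lambda>k. a * x k + b * y k) = (\<lambda>k. a * T x k + b * T y k)"
  using T by (simp add: gaussian_isometry_def)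

text \<open>Made for the vector of conditional means, which is a combination of the constant column
  and the earlier columns of a block: the isometry sends it to zero in the same coordinates as those
  columns.\<close>

lemma gaussian_isometry_combination_zero:
  assumes T: "gaussian_isometry n T" and one: "T (\<lambda>_. 1) k = 0"
    and "finite B" and "\<And>b. b \<in> B \<Longrightarrow> T (c b) k = 0"
  shows "T (\<lambda>i. w + (\<Sum>b\<in>B. v b * c b i)) k = 0"
  using assms(3,4)
proof (induction B rule: finite_induct)
  case empty
  have "T (\<lambda>i. w * 1 + 0 * (1::real)) k = w * T (\<lambda>_. 1) k + 0 * T (\<lambda>_. 1) k"
    by (subst gaussian_isometry_linear[OF T]) simp
  thus ?case using one by simp
next
  case (insert b B)
  have "T (\<lambda>i. v b * c b i + 1 * (w + (\<Sum>b\<in>B. v b * c b i))) k = v b * T (c b) k + 1 * T (\<lambda>i. w + (\<Sum>b\<in>B. v b * c b i)) k"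
    by (subst gaussian_isometry_linear[OF T]) simp
  also have "\<dots> = 0" using insert by simp
  also have "(\<lambda>i. v b * c b i + 1 * (w + (\<Sum>b\<in>B. v b * c b i))) = (\<lambda>i. w + (\<Sum>b\<in>insert b B. v b * c b i))"
    using insert.hyps by (auto simp: fun_eq_iff)
  finally show ?case .
qed

section \<open>Gram determinants of centred columns\<close>

text \<open>Inner product of the projections orthogonal to the constant vector, that is,
  \<open>n\<close> times a sample covariance.\<close>

definition centered_dot :: "nat \<Rightarrow> (nat \<Rightarrow> real) \<Rightarrow> (nat \<Rightarrow> real) \<Rightarrow> real" where
  "centered_dot n x y = dot n x y - dot n x (\<lambda>_. 1) * dot n y (\<lambda>_. 1) / real n"

text \<open>The constant vector is put in front of the list, so the isometry sends it to a multiple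
  of the first axis. Centring then means dropping coordinate 0, and all column indices shift by
  one.\<close>

lemma gaussian_isometry_triangularise_centered:
  assumes n: "n > 0"
  shows "\<exists>T. gaussian_isometry n T \<and> (\<forall>x y. centered_dot n x y = (\<Sum>k\<in>{1..<n}. T x k * T y k)) \<and>
    (\<forall>k. 1 \<le> k \<and> k < n \<longrightarrow> T (\<lambda>_. 1) k = 0) \<and>
    (\<forall>j<v. \<forall>k. j + 1 < k \<and> k < n \<longrightarrow> T (e j) k = 0)"
proof -
  let ?e = "\<lambda>j. case j of 0 \<Rightarrow> (\<lambda>_. 1) | Suc i \<Rightarrow> e i"
  obtain T where T: "gaussian_isometry n T" "\<forall>j<Suc v. \<forall>k. j < k \<and> k < n \<longrightarrow> T (?e j) k = 0"
    using gaussian_isometry_triangularise[of n "Suc v" ?e] by blast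
  have dotT: "dot n (T x) (T y) = dot n x y" for x y using T(1) by (simp add: gaussian_isometry_def)
  have one: "T (\<lambda>_. 1) k = 0" if "1 \<le> k" "k < n" for k using T(2) that by force
  have N: "{..<n} = insert 0 {1..<n}" using n by auto
  have sp: "dot n u v = u 0 * v 0 + (\<Sum>k\<in>{1..<n}. u k * v k)" for u v
    unfolding dot_def N by simp
  have d1: "dot n x (\<lambda>_. 1) = T x 0 * T (\<lambda>_. 1) 0" for x
  proof -
    have "dot n x (\<lambda>_. 1) = dot n (T x) (T (\<lambda>_. 1))" by (simp add: dotT)
    also have "\<dots> = T x 0 * T (\<lambda>_. 1) 0" unfolding sp using one by simp
    finally show ?thesis .
  qed
  have "real n = dot n (\<lambda>_. 1) (\<lambda>_. 1)" by (simp add: dot_def)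
  hence nn: "T (\<lambda>_. 1) 0 * T (\<lambda>_. 1) 0 = real n" unfolding d1 by simp
  have "centered_dot n x y = (\<Sum>k\<in>{1..<n}. T x k * T y k)" for x y
  proof -
    have "dot n x (\<lambda>_. 1) * dot n y (\<lambda>_. 1) = (T x 0 * T y 0) * real n"
      unfolding d1 nn[symmetric] by (simp only: ac_simps)
    thus ?thesis unfolding centered_dot_def using n sp[of "T x" "T y"] by (simp add: dotT)
  qed
  moreover have "\<forall>j<v. \<forall>k. j + 1 < k \<and> k < n \<longrightarrow> T (e j) k = 0"
  proof (intro allI impI)
    fix j k assume "j < v" "j + 1 < k \<and> k < n"
    thus "T (e j) k = 0" using T(2)[rule_format, of "Suc j" k] by simp
  qed
  ultimately show ?thesis using T(1) one by (intro exI[of _ T]) auto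
qed

definition gram_det :: "(nat \<Rightarrow> nat \<Rightarrow> real) \<Rightarrow> nat \<Rightarrow> real" where
  "gram_det g m = det (mat m m (\<lambda>(i, j). g i j))"

lemma gram_det_cong:
  "(\<And>i j. i < m \<Longrightarrow> j < m \<Longrightarrow> g i j = h i j) \<Longrightarrow> gram_det g m = gram_det h m"
  unfolding gram_det_def by (intro arg_cong[of _ _ det] eq_matI) auto

text \<open>Rows and columns undergo the same permutation, so its sign appears squared.\<close>

lemma gram_det_permute:
  assumes p: "\<pi> permutes {0..<m}"
  shows "gram_det (\<lambda>i j. g (\<pi> i) (\<pi> j)) m = gram_det g m"
proof -
  have lt: "\<pi> i < m" if "i < m" for i using permutes_in_image[OF p, of i] that by auto
  define A where "A = mat m m (\<lambda>(i, j). g i j)"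
  define B where "B = mat m m (\<lambda>(i, j). A $$ (\<pi> i, j))"
  have A: "A \<in> carrier_mat m m" by (simp add: A_def)
  have B: "B \<in> carrier_mat m m" by (simp add: B_def)
  have 1: "det B = of_int (sign \<pi>) * det A" unfolding B_def by (rule det_permute_rows[OF A p])
  have "det (mat m m (\<lambda>(i, j). B\<^sup>T $$ (\<pi> i, j))) = of_int (sign \<pi>) * det (B\<^sup>T)"
    using B by (intro det_permute_rows p) auto
  also have "det (B\<^sup>T) = det B" using det_transpose[OF B] by simp
  also have "mat m m (\<lambda>(i, j). B\<^sup>T $$ (\<pi> i, j)) = (mat m m (\<lambda>(i, j). g (\<pi> i) (\<pi> j)))\<^sup>T"
    by (intro eq_matI) (auto simp: B_def A_def lt)
  also have "det \<dots> = gram_det (\<lambda>i j. g (\<pi> i) (\<pi> j)) m"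
    unfolding gram_det_def by (rule det_transpose[where n = m]) simp
  finally show ?thesis
    unfolding 1 gram_det_def A_def by (simp add: mult.assoc[symmetric] of_int_mult[symmetric] sign_def del: of_int_mult)
qed

text \<open>Only the last vector reaches beyond coordinate \<open>u\<close>. Its tail can be
  replaced by a single entry of the same length without changing any inner product, which makes the
  Gram matrix \<open>L\<close> times its transpose with \<open>L\<close> lower triangular.\<close>

lemma gram_det_triangular:
  assumes u: "u + 1 < n" and z: "\<And>j k. j < u \<Longrightarrow> j + 1 < k \<Longrightarrow> k < n \<Longrightarrow> f j k = 0"
  shows "gram_det (\<lambda>i j. \<Sum>k\<in>{1..<n}. f i k * f j k) (Suc u) =
    (\<Prod>j<u. (f j (Suc j))\<^sup>2) * (\<Sum>k\<in>{Suc u..<n}. (f u k)\<^sup>2)"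
proof -
  define tail where "tail = (\<Sum>k\<in>{Suc u..<n}. (f u k)\<^sup>2)"
  have tail: "tail \<ge> 0" unfolding tail_def by (intro sum_nonneg) auto
  \<comment> \<open>Columns are shifted by one because coordinate 0 carries the constant vector;
    column \<open>u\<close> takes the length of the tail in the last row.\<close>
  define F where "F j k = (if j < u then f j (Suc k) else if k < u then f j (Suc k) else sqrt tail)" for j k
  define L where "L = mat (Suc u) (Suc u) (\<lambda>(j, k). F j k)"
  have L: "L \<in> carrier_mat (Suc u) (Suc u)" by (simp add: L_def)
  have F0: "F j k = 0" if "j < k" "k < Suc u" for j k using that z[of j "Suc k"] u by (auto simp: F_def)
  have entry: "(\<Sum>k\<in>{1..<n}. f i k * f j k) = (\<Sum>k<Suc u. F i k * F j k)" if ij: "i < Suc u" "j < Suc u" for i j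
  proof -
    have "{1..<n} = Suc ` {..<u} \<union> {Suc u..<n}" using u unfolding image_Suc_lessThan by auto
    hence "(\<Sum>k\<in>{1..<n}. f i k * f j k) = (\<Sum>k\<in>Suc ` {..<u}. f i k * f j k) + (\<Sum>k\<in>{Suc u..<n}. f i k * f j k)"
      by (simp only:, subst sum.union_disjoint) auto
    also have "(\<Sum>k\<in>Suc ` {..<u}. f i k * f j k) = (\<Sum>k<u. F i k * F j k)"
      by (subst sum.reindex) (auto simp: F_def intro!: sum.cong)
    also have "(\<Sum>k\<in>{Suc u..<n}. f i k * f j k) = F i u * F j u"
    proof (cases "i = u \<and> j = u")
      case True
      thus ?thesis using tail by (simp add: F_def tail_def[symmetric] power2_eq_square[symmetric])
    next
      case False
      have "f i k * f j k = 0" if "k \<in> {Suc u..<n}" for k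
        using False ij that z[of i k] z[of j k] by auto
      hence "(\<Sum>k\<in>{Suc u..<n}. f i k * f j k) = 0" by (intro sum.neutral) auto
      moreover have "F i u * F j u = 0" using False ij F0[of i u] F0[of j u] by auto
      ultimately show ?thesis by simp
    qed
    finally show ?thesis by simp
  qed
  have "mat (Suc u) (Suc u) (\<lambda>(i, j). \<Sum>k\<in>{1..<n}. f i k * f j k) = L * L\<^sup>T"
    by (rule eq_matI) (auto simp: entry[simplified One_nat_def] L_def scalar_prod_def atLeast0LessThan simp del: sum.lessThan_Suc)
  hence "gram_det (\<lambda>i j. \<Sum>k\<in>{1..<n}. f i k * f j k) (Suc u) = det L * det (L\<^sup>T)"
    unfolding gram_det_def using L by (simp add: det_mult[of _ "Suc u"])
  also have "\<dots> = (det L)\<^sup>2" using det_transpose[OF L] by (simp add: power2_eq_square)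
  also have "det L = prod_list (diag_mat L)"
    by (rule det_lower_triangular[OF _ L]) (auto simp: L_def F0)
  also have "\<dots> = (\<Prod>j<Suc u. F j j)"
    by (simp add: prod_list_diag_prod L_def atLeast0LessThan)
  also have "\<dots>\<^sup>2 = (\<Prod>j<u. (f j (Suc j))\<^sup>2) * tail"
    using tail by (simp add: F_def power_mult_distrib prod_power_distrib)
  finally show ?thesis by (simp add: tail_def)
qed

definition cols_det :: "nat \<Rightarrow> (nat \<Rightarrow> nat \<Rightarrow> real) \<Rightarrow> nat \<Rightarrow> nat \<Rightarrow> real" where
  "cols_det n c s m = gram_det (\<lambda>i j. centered_dot n (c (s + i)) (c (s + j))) m"

text \<open>
  The columns before \<open>a\<close> are triangularised in reverse order, so that for every \<open>s\<close> the
  columns from \<open>s\<close> to \<open>a - 1\<close> form an initial segment and one isometry serves both determinants.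
\<close>

lemma cols_det_step:
  assumes a: "a + 1 < n"
  obtains T r where "gaussian_isometry n T" "\<And>k. 1 \<le> k \<Longrightarrow> k < n \<Longrightarrow> T (\<lambda>_. 1) k = 0"
    "\<And>s. s \<le> a \<Longrightarrow> cols_det n c s (a - s) = (\<Prod>j<a-s. (r j)\<^sup>2)"
    "\<And>s y. s \<le> a \<Longrightarrow> cols_det n (c(a := y)) s (Suc (a - s)) =
      (\<Prod>j<a-s. (r j)\<^sup>2) * (\<Sum>k\<in>{Suc (a - s)..<n}. (T y k)\<^sup>2)"
    "\<And>s b k. s \<le> b \<Longrightarrow> b < a \<Longrightarrow> a - s < k \<Longrightarrow> k < n \<Longrightarrow> T (c b) k = 0"
proof -
  have n0: "0 < n" using a by simp
  define e where "e j = c (a - 1 - j)" for j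
  obtain T where T: "gaussian_isometry n T" "\<forall>x y. centered_dot n x y = (\<Sum>k\<in>{1..<n}. T x k * T y k)"
    "\<forall>k. 1 \<le> k \<and> k < n \<longrightarrow> T (\<lambda>_. 1) k = 0"
    "\<forall>j<a. \<forall>k. j + 1 < k \<and> k < n \<longrightarrow> T (e j) k = 0"
    using gaussian_isometry_triangularise_centered[OF n0, of a e] by (elim exE conjE) (rule that)
  have z: "T (e j) k = 0" if "j < a" "j + 1 < k" "k < n" for j k using T(4) that by blast
  \<comment> \<open>These diagonal entries do not depend on \<open>s\<close>; the starting column
    only decides how many of them are multiplied.\<close>
  define r where "r j = T (e j) (Suc j)" for j
  have step: "cols_det n (c(a := y)) s (Suc (a - s)) = (\<Prod>j<a-s. (r j)\<^sup>2) * (\<Sum>k\<in>{Suc (a - s)..<n}. (T y k)\<^sup>2)"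
    if s: "s \<le> a" for s y
  proof -
    define u where "u = a - s"
    \<comment> \<open>Reverses the columns from \<open>s\<close> to \<open>a - 1\<close>, to match
      the order of \<open>e\<close>, and keeps the new column last.\<close>
    define p where "p i = (if i < u then u - 1 - i else i)" for i
    have bij: "bij_betw p {0..<Suc u} {0..<Suc u}"
      by (rule bij_betwI[where g = p]) (auto simp: p_def)
    have p: "p permutes {0..<Suc u}"
      by (rule bij_imp_permutes[OF bij]) (auto simp: p_def)
    define f where "f j = (if j < u then T (e j) else T y)" for j
    have fz: "f j k = 0" if "j < u" "j + 1 < k" "k < n" for j k using that z[of j k] by (auto simp: f_def u_def)
    have "cols_det n (c(a := y)) s (Suc u) = gram_det (\<lambda>i j. centered_dot n ((c(a := y)) (s + p i)) ((c(a := y)) (s + p j))) (Suc u)"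
      unfolding cols_det_def by (rule gram_det_permute[OF p, symmetric])
    also have "\<dots> = gram_det (\<lambda>i j. \<Sum>k\<in>{1..<n}. f i k * f j k) (Suc u)"
    proof (rule gram_det_cong)
      have "T ((c(a := y)) (s + p i)) = f i" if "i < Suc u" for i
      proof (cases "i < u")
        case True
        have "s + p i = a - 1 - i" "s + p i \<noteq> a" using True s by (auto simp: p_def u_def)
        thus ?thesis using True by (simp add: f_def e_def)
      next
        case False
        hence "s + p i = a" using that s by (auto simp: p_def u_def)
        thus ?thesis using False by (simp add: f_def)
      qed
      thus "centered_dot n ((c(a := y)) (s + p i)) ((c(a := y)) (s + p j)) = (\<Sum>k\<in>{1..<n}. f i k * f j k)"
        if "i < Suc u" "j < Suc u" for i j using that T(2) by simp
    qed
    also have "\<dots> = (\<Prod>j<u. (f j (Suc j))\<^sup>2) * (\<Sum>k\<in>{Suc u..<n}. (f u k)\<^sup>2)"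
      by (rule gram_det_triangular[OF _ fz]) (use a in \<open>auto simp: u_def\<close>)
    also have "\<dots> = (\<Prod>j<u. (r j)\<^sup>2) * (\<Sum>k\<in>{Suc u..<n}. (T y k)\<^sup>2)"
      by (simp add: f_def r_def)
    finally show ?thesis unfolding u_def .
  qed
  have base: "cols_det n c s (a - s) = (\<Prod>j<a-s. (r j)\<^sup>2)" if s: "s \<le> a" for s
  proof (cases "a - s")
    case 0
    thus ?thesis by (simp add: cols_det_def gram_det_def)
  next
    case (Suc w)
    define p where "p i = (if i < Suc w then w - i else i)" for i
    have bij: "bij_betw p {0..<Suc w} {0..<Suc w}"
      by (rule bij_betwI[where g = p]) (auto simp: p_def)
    have p: "p permutes {0..<Suc w}"
      by (rule bij_imp_permutes[OF bij]) (auto simp: p_def)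
    have "cols_det n c s (Suc w) = gram_det (\<lambda>i j. centered_dot n (c (s + p i)) (c (s + p j))) (Suc w)"
      unfolding cols_det_def by (rule gram_det_permute[OF p, symmetric])
    also have "\<dots> = gram_det (\<lambda>i j. \<Sum>k\<in>{1..<n}. T (e i) k * T (e j) k) (Suc w)"
    proof (rule gram_det_cong)
      have "c (s + p i) = e i" if "i < Suc w" for i
      proof -
        have "s + p i = a - 1 - i" using that Suc by (auto simp: p_def)
        thus ?thesis by (simp add: e_def)
      qed
      thus "centered_dot n (c (s + p i)) (c (s + p j)) = (\<Sum>k\<in>{1..<n}. T (e i) k * T (e j) k)"
        if "i < Suc w" "j < Suc w" for i j using that T(2) by simp
    qed
    also have "\<dots> = (\<Prod>j<w. (T (e j) (Suc j))\<^sup>2) * (\<Sum>k\<in>{Suc w..<n}. (T (e w) k)\<^sup>2)"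
      by (rule gram_det_triangular) (use a Suc z in auto)
    also have "(\<Sum>k\<in>{Suc w..<n}. (T (e w) k)\<^sup>2) = (\<Sum>k\<in>{Suc w}. (T (e w) k)\<^sup>2)"
      by (rule sum.mono_neutral_right) (use a Suc z[of w] in auto)
    finally show ?thesis unfolding Suc by (simp add: r_def)
  qed
  have zero: "T (c b) k = 0" if "s \<le> b" "b < a" "a - s < k" "k < n" for s b k
  proof -
    have "c b = e (a - 1 - b)" using that by (simp add: e_def)
    thus ?thesis using z[of "a - 1 - b" k] that by simp
  qed
  show thesis
  proof (rule that[where T = T and r = r])
    show "T (\<lambda>_. 1) k = 0" if "1 \<le> k" "k < n" for k using T(3) that by blast
  qed (fact T(1) base step zero)+
qed

text \<open>A nonzero determinant of all columns makes every diagonal entry \<open>r j\<close>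
  nonzero, and the suffix determinant is a product of squares of some of them.\<close>

lemma cols_det_suffix_pos:
  assumes "a + 1 < n" "cols_det n c 0 a \<noteq> 0" "s \<le> a"
  shows "cols_det n c s (a - s) > 0"
proof (rule cols_det_step[OF assms(1), of c])
  fix r assume r: "\<And>s. s \<le> a \<Longrightarrow> cols_det n c s (a - s) = (\<Prod>j<a-s. (r j)\<^sup>2)"
  have "r j \<noteq> 0" if "j < a" for j
  proof
    assume "r j = 0"
    hence "(\<Prod>j<a. (r j)\<^sup>2) = 0" using that by (intro prod_zero) auto
    thus False using r[of 0] assms(2) by simp
  qed
  thus ?thesis unfolding r[OF assms(3)] by (intro prod_pos) auto
qed

lemma cols_det_Suc_nonzero:
  assumes "a + 1 < n" "cols_det n c 0 (Suc a) \<noteq> 0"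
  shows "cols_det n c 0 a \<noteq> 0"
proof (rule cols_det_step[OF assms(1), of c])
  fix T r
  assume "\<And>s. s \<le> a \<Longrightarrow> cols_det n c s (a - s) = (\<Prod>j<a-s. (r j)\<^sup>2)"
    and "\<And>s y. s \<le> a \<Longrightarrow> cols_det n (c(a := y)) s (Suc (a - s)) =
      (\<Prod>j<a-s. (r j)\<^sup>2) * (\<Sum>k\<in>{Suc (a - s)..<n}. (T y k)\<^sup>2)"
  from this(1)[of 0] this(2)[of 0 "c a"] show ?thesis using assms(2) by auto
qed

section \<open>Normal rows built coordinate by coordinate\<close>

text \<open>Turns rows into columns: adding one coordinate to each of \<open>n\<close> independent
  rows amounts to adding one independent Gaussian vector indexed by the rows, to which rotation
  invariance can be applied.\<close>

lemma PiM_distr_pair: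
  assumes fin: "finite I" and M: "prob_space M" and N: "prob_space N"
    and g [measurable]: "g \<in> M \<Otimes>\<^sub>M N \<rightarrow>\<^sub>M L"
  shows "Pi\<^sub>M I (\<lambda>_. distr (M \<Otimes>\<^sub>M N) L g) =
    distr (Pi\<^sub>M I (\<lambda>_. M) \<Otimes>\<^sub>M Pi\<^sub>M I (\<lambda>_. N)) (Pi\<^sub>M I (\<lambda>_. L)) (\<lambda>(x, z). \<lambda>k\<in>I. g (x k, z k))"
proof -
  let ?M = "Pi\<^sub>M I (\<lambda>_. M)" and ?N = "Pi\<^sub>M I (\<lambda>_. N)" and ?L = "Pi\<^sub>M I (\<lambda>_. L)" and ?D = "distr (M \<Otimes>\<^sub>M N) L g"
  interpret M: prob_space M by fact
  interpret N: prob_space N by fact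
  interpret MN: pair_prob_space M N ..
  interpret D: prob_space "?D" by (rule MN.prob_space_distr) simp
  interpret PM: product_sigma_finite "\<lambda>_. M" by (simp add: product_sigma_finite_def M.sigma_finite_measure_axioms)
  interpret PN: product_sigma_finite "\<lambda>_. N" by (simp add: product_sigma_finite_def N.sigma_finite_measure_axioms)
  interpret PD: product_sigma_finite "\<lambda>_. ?D" by (simp add: product_sigma_finite_def D.sigma_finite_measure_axioms)
  interpret PPN: prob_space "?N" by (intro prob_space_PiM N)
  let ?h = "\<lambda>(x, z). \<lambda>k\<in>I. g (x k, z k)"
  have h [measurable]: "?h \<in> ?M \<Otimes>\<^sub>M ?N \<rightarrow>\<^sub>M ?L"
    unfolding case_prod_beta by (rule measurable_restrict) measurable
  show ?thesis
  proof (rule PD.PiM_eqI[symmetric, OF fin])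
    show "sets (distr (?M \<Otimes>\<^sub>M ?N) ?L ?h) = sets (Pi\<^sub>M I (\<lambda>_. ?D))"
      by (simp cong: sets_PiM_cong)
    fix A assume "\<And>i. i \<in> I \<Longrightarrow> A i \<in> sets ?D"
    hence A [measurable]: "\<And>i. i \<in> I \<Longrightarrow> A i \<in> sets L" by simp
    have PA [measurable]: "Pi\<^sub>E I A \<in> sets ?L" by (intro sets_PiM_I_finite fin A)
    have m1: "(\<lambda>(x, z). indicator (A k) (g (x, z)) :: ennreal) \<in> borel_measurable (M \<Otimes>\<^sub>M N)" if "k \<in> I" for k
      using A[OF that] by (simp add: split_def)
    have "emeasure (distr (?M \<Otimes>\<^sub>M ?N) ?L ?h) (Pi\<^sub>E I A) =
      (\<integral>\<^sup>+w. indicator (Pi\<^sub>E I A) (?h w) \<partial>(?M \<Otimes>\<^sub>M ?N))"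
      by (subst nn_integral_indicator[symmetric], simp, subst nn_integral_distr) auto
    also have "\<dots> = (\<integral>\<^sup>+x. \<integral>\<^sup>+z. indicator (Pi\<^sub>E I A) (?h (x, z)) \<partial>?N \<partial>?M)"
      by (rule PPN.nn_integral_fst[symmetric]) measurable
    also have "\<dots> = (\<integral>\<^sup>+x. \<integral>\<^sup>+z. (\<Prod>k\<in>I. indicator (A k) (g (x k, z k))) \<partial>?N \<partial>?M)"
    proof (intro nn_integral_cong)
      fix x z
      show "indicator (Pi\<^sub>E I A) (?h (x, z)) = (\<Prod>k\<in>I. indicator (A k) (g (x k, z k)) :: ennreal)"
      proof (cases "\<forall>k\<in>I. g (x k, z k) \<in> A k")
        case True
        thus ?thesis by (simp add: PiE_iff)
      next
        case False
        hence "(\<Prod>k\<in>I. indicator (A k) (g (x k, z k)) :: ennreal) = 0"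
          using fin by (intro prod_zero) (auto simp: indicator_def)
        thus ?thesis using False by (simp add: PiE_iff)
      qed
    qed
    also have "\<dots> = (\<integral>\<^sup>+x. (\<Prod>k\<in>I. \<integral>\<^sup>+z. indicator (A k) (g (x k, z)) \<partial>N) \<partial>?M)"
    proof (rule nn_integral_cong)
      fix x assume x: "x \<in> space ?M"
      show "(\<integral>\<^sup>+z. (\<Prod>k\<in>I. indicator (A k) (g (x k, z k))) \<partial>?N) = (\<Prod>k\<in>I. \<integral>\<^sup>+z. indicator (A k) (g (x k, z)) \<partial>N)"
      proof (rule PN.product_nn_integral_prod[OF fin])
        fix k assume k: "k \<in> I"
        hence "x k \<in> space M" using x by (auto simp: space_PiM)
        thus "(\<lambda>z. indicator (A k) (g (x k, z)) :: ennreal) \<in> borel_measurable N"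
          using measurable_Pair2[OF m1[OF k]] by simp
      qed
    qed
    also have "\<dots> = (\<Prod>k\<in>I. \<integral>\<^sup>+x. \<integral>\<^sup>+z. indicator (A k) (g (x, z)) \<partial>N \<partial>M)"
      using m1 by (intro PM.product_nn_integral_prod fin N.borel_measurable_nn_integral) auto
    also have "\<dots> = (\<Prod>k\<in>I. emeasure ?D (A k))"
    proof (rule prod.cong[OF refl])
      fix k assume k: "k \<in> I"
      have "emeasure ?D (A k) = (\<integral>\<^sup>+w. indicator (A k) (g w) \<partial>(M \<Otimes>\<^sub>M N))"
        using A[OF k] by (subst nn_integral_indicator[symmetric], simp, subst nn_integral_distr) auto
      also have "\<dots> = (\<integral>\<^sup>+x. \<integral>\<^sup>+z. indicator (A k) (g (x, z)) \<partial>N \<partial>M)"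
        using m1[OF k] by (intro N.nn_integral_fst[symmetric]) (simp add: split_def)
      finally show "(\<integral>\<^sup>+x. \<integral>\<^sup>+z. indicator (A k) (g (x, z)) \<partial>N \<partial>M) = emeasure ?D (A k)" by simp
    qed
    finally show "emeasure (distr (?M \<Otimes>\<^sub>M ?N) ?L ?h) (Pi\<^sub>E I A) =
      (\<Prod>k\<in>I. emeasure ?D (A k))" .
  qed
qed

lemma centered_dot_cong:
  "(\<And>k. k < n \<Longrightarrow> x k = x' k) \<Longrightarrow> (\<And>k. k < n \<Longrightarrow> y k = y' k) \<Longrightarrow> centered_dot n x y = centered_dot n x' y'"
  unfolding centered_dot_def dot_def by simp

lemma cols_det_cong:
  "(\<And>b k. s \<le> b \<Longrightarrow> b < s + m \<Longrightarrow> k < n \<Longrightarrow> c b k = c' b k) \<Longrightarrow> cols_det n c s m = cols_det n c' s m"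
  unfolding cols_det_def by (intro gram_det_cong centered_dot_cong) auto

definition cols :: "(nat \<Rightarrow> nat \<Rightarrow> real) \<Rightarrow> nat \<Rightarrow> nat \<Rightarrow> real" where
  "cols x b k = x k b"

abbreviation rows_space :: "nat \<Rightarrow> nat \<Rightarrow> (nat \<Rightarrow> nat \<Rightarrow> real) measure" where
  "rows_space n a \<equiv> Pi\<^sub>M {..<n} (\<lambda>_. Pi\<^sub>M {..<a} (\<lambda>_. borel))"

lemma cols_det_measurable:
  assumes "s + m \<le> a"
  shows "(\<lambda>x. cols_det n (cols x) s m) \<in> borel_measurable (rows_space n a)"
proof -
  have comp: "(\<lambda>x. x k b) \<in> borel_measurable (rows_space n a)" if "k < n" "b < a" for k b
  proof -
    have "(\<lambda>x. x k) \<in> rows_space n a \<rightarrow>\<^sub>M Pi\<^sub>M {..<a} (\<lambda>_. borel)"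
      using that by (intro measurable_component_singleton) auto
    from measurable_compose[OF this, of "\<lambda>y. y b" borel] show ?thesis
      using that by (auto intro: measurable_component_singleton)
  qed
  have cd: "(\<lambda>x. centered_dot n (cols x b) (cols x b')) \<in> borel_measurable (rows_space n a)"
    if "b < a" "b' < a" for b b'
    unfolding centered_dot_def dot_def cols_def using that
    by (intro borel_measurable_diff borel_measurable_divide borel_measurable_times borel_measurable_sum
        borel_measurable_const comp) auto
  have "cols_det n (cols x) s m = (\<Sum>p\<in>{p. p permutes {0..<m}}. of_int (sign p) * (\<Prod>i=0..<m. centered_dot n (cols x (s + i)) (cols x (s + p i))))" for x
  proof -
    have "(\<Prod>i=0..<m. mat m m (\<lambda>(i, j). centered_dot n (cols x (s + i)) (cols x (s + j))) $$ (i, p i)) =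
       (\<Prod>i=0..<m. centered_dot n (cols x (s + i)) (cols x (s + p i)))" if "p permutes {0..<m}" for p
      using permutes_in_image[OF that] by (intro prod.cong) auto
    thus ?thesis unfolding cols_det_def gram_det_def
      by (subst det_def'[of _ m]) auto
  qed
  moreover have "(\<lambda>x. \<Sum>p\<in>{p. p permutes {0..<m}}. of_int (sign p) * (\<Prod>i=0..<m. centered_dot n (cols x (s + i)) (cols x (s + p i)))) \<in> borel_measurable (rows_space n a)"
  proof (intro borel_measurable_sum borel_measurable_times borel_measurable_const borel_measurable_prod cd)
    fix p i assume "p \<in> {p. p permutes {0..<m}}" "i \<in> {0..<m}"
    hence "i < m" "p i \<in> {0..<m}" using permutes_in_image[of p "{0..<m}" i] by auto
    thus "s + i < a" "s + p i < a" using assms by auto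
  qed
  ultimately show ?thesis by simp
qed

text \<open>Regression form of a Gaussian vector: \<open>beta a b\<close> are the coefficients of
  coordinate \<open>a\<close> on earlier ones and \<open>tau a\<close> is its conditional standard
  deviation. Block independence is encoded in \<open>st a\<close>, later the first coordinate of the
  block of \<open>a\<close>, where the regression starts.\<close>

locale triangular_rows =
  fixes mu :: "nat \<Rightarrow> real" and beta :: "nat \<Rightarrow> nat \<Rightarrow> real" and tau :: "nat \<Rightarrow> real" and st :: "nat \<Rightarrow> nat"
  assumes tau_pos: "\<And>a. tau a > 0" and st_le: "\<And>a. st a \<le> a"
begin

definition row_mean :: "nat \<Rightarrow> (nat \<Rightarrow> real) \<Rightarrow> real" where
  "row_mean a x = mu a + (\<Sum>b\<in>{st a..<a}. beta a b * (x b - mu b))"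

primrec row_law :: "nat \<Rightarrow> (nat \<Rightarrow> real) measure" where
  "row_law 0 = Pi\<^sub>M {} (\<lambda>_. borel)"
| "row_law (Suc a) = distr (row_law a \<Otimes>\<^sub>M std_normal_distribution) (Pi\<^sub>M {..<Suc a} (\<lambda>_. borel))
     (\<lambda>(x, z). x(a := row_mean a x + tau a * z))"

lemma sets_row_law [measurable_cong]: "sets (row_law a) = sets (Pi\<^sub>M {..<a} (\<lambda>_. borel))"
  by (cases a) simp_all

lemma row_mean_measurable: "row_mean a \<in> borel_measurable (Pi\<^sub>M {..<a} (\<lambda>_. borel))"
proof -
  have "(\<lambda>x. x b) \<in> borel_measurable (Pi\<^sub>M {..<a} (\<lambda>_. borel))" if "b \<in> {st a..<a}" for b
    using that by (intro measurable_component_singleton) auto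
  thus ?thesis unfolding row_mean_def[abs_def]
    by (intro borel_measurable_add borel_measurable_sum borel_measurable_times borel_measurable_diff borel_measurable_const)
qed

lemma row_step_measurable:
  "(\<lambda>(x, z). x(a := row_mean a x + tau a * z)) \<in> row_law a \<Otimes>\<^sub>M std_normal_distribution \<rightarrow>\<^sub>M Pi\<^sub>M {..<Suc a} (\<lambda>_. borel)"
proof -
  have [measurable]: "row_mean a \<in> borel_measurable (row_law a)"
    using row_mean_measurable[of a] by (simp cong: measurable_cong_sets add: sets_row_law)
  have [measurable]: "fst \<in> row_law a \<Otimes>\<^sub>M std_normal_distribution \<rightarrow>\<^sub>M Pi\<^sub>M {..<a} (\<lambda>_. borel)"
    using measurable_fst[of "row_law a" std_normal_distribution] measurable_cong_sets[OF refl sets_row_law] by blast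
  show ?thesis unfolding case_prod_beta
    by (rule measurable_fun_upd[where J = "{..<a}"]) auto
qed

lemma prob_space_row_law: "prob_space (row_law a)"
proof (induction a)
  case 0
  show ?case unfolding row_law.simps PiM_empty by (rule prob_spaceI) simp
next
  case (Suc a)
  interpret M: prob_space "row_law a" by fact
  interpret N: prob_space std_normal_distribution by (rule prob_space_normal_density) simp
  interpret P: pair_prob_space "row_law a" std_normal_distribution ..
  show ?case unfolding row_law.simps by (rule P.prob_space_distr[OF row_step_measurable])
qed

definition rows_law :: "nat \<Rightarrow> nat \<Rightarrow> (nat \<Rightarrow> nat \<Rightarrow> real) measure" where
  "rows_law n a = Pi\<^sub>M {..<n} (\<lambda>_. row_law a)"

definition extend :: "nat \<Rightarrow> nat \<Rightarrow> (nat \<Rightarrow> nat \<Rightarrow> real) \<times> (nat \<Rightarrow> real) \<Rightarrow> nat \<Rightarrow> nat \<Rightarrow> real" where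
  "extend n a = (\<lambda>(x, z). \<lambda>k\<in>{..<n}. (x k)(a := row_mean a (x k) + tau a * z k))"

lemma sets_rows_law [measurable_cong]: "sets (rows_law n a) = sets (rows_space n a)"
  unfolding rows_law_def by (intro sets_PiM_cong refl sets_row_law)

lemma prob_space_rows_law: "prob_space (rows_law n a)"
  unfolding rows_law_def by (intro prob_space_PiM prob_space_row_law)

lemma rows_law_Suc:
  "rows_law n (Suc a) = distr (rows_law n a \<Otimes>\<^sub>M gaussian {..<n}) (rows_space n (Suc a)) (extend n a)"
  unfolding rows_law_def row_law.simps extend_def
  by (subst PiM_distr_pair[OF _ prob_space_row_law _ row_step_measurable])
    (auto simp: prob_space_normal_density)

lemma extend_measurable: "extend n a \<in> rows_law n a \<Otimes>\<^sub>M gaussian {..<n} \<rightarrow>\<^sub>M rows_space n (Suc a)"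
  unfolding extend_def case_prod_beta
proof (rule measurable_restrict)
  let ?P = "rows_law n a \<Otimes>\<^sub>M gaussian {..<n}"
  fix k assume k: "k \<in> {..<n}"
  have 1: "(\<lambda>w. fst w k) \<in> ?P \<rightarrow>\<^sub>M row_law a"
    unfolding rows_law_def by (rule measurable_compose[OF measurable_fst measurable_component_singleton[OF k]])
  have 2: "(\<lambda>w. snd w k) \<in> ?P \<rightarrow>\<^sub>M std_normal_distribution"
    by (rule measurable_compose[OF measurable_snd measurable_component_singleton[OF k]])
  show "(\<lambda>w. (fst w k)(a := row_mean a (fst w k) + tau a * snd w k)) \<in> ?P \<rightarrow>\<^sub>M Pi\<^sub>M {..<Suc a} (\<lambda>_. borel)"
    using measurable_compose[OF measurable_Pair[OF 1 2] row_step_measurable] by (simp add: case_prod_beta)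
qed

definition increment :: "nat \<Rightarrow> nat \<Rightarrow> (nat \<Rightarrow> nat \<Rightarrow> real) \<Rightarrow> real" where
  "increment n b x = (ln (cols_det n (cols x) 0 (Suc b)) - ln (cols_det n (cols x) 0 b)) -
     (ln (cols_det n (cols x) (st b) (Suc (b - st b))) - ln (cols_det n (cols x) (st b) (b - st b)))"

lemma increment_measurable: "b < a \<Longrightarrow> increment n b \<in> borel_measurable (rows_law n a)"
  unfolding increment_def[abs_def] measurable_cong_sets[OF sets_rows_law refl] using st_le[of b]
  by (intro borel_measurable_diff borel_measurable_ln cols_det_measurable) auto

lemma cols_det_extend:
  assumes "s + m \<le> a"
  shows "cols_det n (cols (extend n a (x, z))) s m = cols_det n (cols x) s m"
  using assms by (intro cols_det_cong) (auto simp: cols_def extend_def)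

lemma increment_extend: "b < a \<Longrightarrow> increment n b (extend n a (x, z)) = increment n b x"
  unfolding increment_def using st_le[of b] by (simp add: cols_det_extend)

text \<open>With the earlier columns frozen, the isometry \<open>T\<close> depends on
  \<open>x\<close> but not on \<open>z\<close>. It sends the conditional means to zero beyond
  coordinate \<open>a - st a\<close>, so there the new column is \<open>tau a\<close> times
  \<open>T z\<close>, and \<open>T z\<close> has the law of \<open>z\<close>. The products of
  \<open>(r j)^2\<close> and the factor \<open>tau a\<close> drop out of the increment, whose law is
  therefore free of \<open>x\<close>.\<close>

lemma conditional_increment:
  assumes a: "a + 1 < n" and x: "cols_det n (cols x) 0 a \<noteq> 0" and xs: "x \<in> space (rows_law n a)"
  shows "AE z in gaussian {..<n}. cols_det n (cols (extend n a (x, z))) 0 (Suc a) \<noteq> 0"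
    and "(LINT z|gaussian {..<n}. iexp (t * increment n a (extend n a (x, z)))) =
      chi_ratio t (n - 1 - a) / chi_ratio t (n - 1 - (a - st a))"
proof -
  let ?G = "gaussian {..<n}" and ?x = "\<lambda>z. extend n a (x, z)" and ?S = "\<lambda>v z. \<Sum>k\<in>{v..<n}. (z k)\<^sup>2 :: real"
  define s where "s = st a"
  have s: "s \<le> a" unfolding s_def by (rule st_le)
  obtain T r where T: "gaussian_isometry n T" "\<And>k. 1 \<le> k \<Longrightarrow> k < n \<Longrightarrow> T (\<lambda>_. 1) k = 0"
    and D0: "\<And>s. s \<le> a \<Longrightarrow> cols_det n (cols x) s (a - s) = (\<Prod>j<a-s. (r j)\<^sup>2)"
    and D1: "\<And>s y. s \<le> a \<Longrightarrow> cols_det n ((cols x)(a := y)) s (Suc (a - s)) =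
      (\<Prod>j<a-s. (r j)\<^sup>2) * ?S (Suc (a - s)) (T y)"
    and Dz: "\<And>s b k. s \<le> b \<Longrightarrow> b < a \<Longrightarrow> a - s < k \<Longrightarrow> k < n \<Longrightarrow> T (cols x b) k = 0"
    by (rule cols_det_step[OF a, of "cols x"]) (rule that)
  have pos: "(\<Prod>j<a-s. (r j)\<^sup>2) > 0" if "s \<le> a" for s
    using cols_det_suffix_pos[OF a x that] D0[OF that] by simp
  define y where "y z k = row_mean a (x k) + tau a * z k" for z k
  have Ty: "T (y z) k = tau a * T z k" if "a - s < k" "k < n" for z k
  proof -
    \<comment> \<open>The conditional mean rewritten as a constant plus a combination of earlier
      columns of the block.\<close>
    let ?m = "\<lambda>k. (mu a - (\<Sum>b\<in>{s..<a}. beta a b * mu b)) + (\<Sum>b\<in>{s..<a}. beta a b * cols x b k)"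
    have "row_mean a (x k) = ?m k" for k
      unfolding row_mean_def s_def cols_def by (simp add: right_diff_distrib sum_subtractf)
    hence "y z = (\<lambda>k. 1 * ?m k + tau a * z k)" by (simp add: y_def fun_eq_iff)
    hence "T (y z) k = 1 * T ?m k + tau a * T z k" by (simp only: gaussian_isometry_linear[OF T(1)])
    also have "T ?m k = 0"
    proof (rule gaussian_isometry_combination_zero[OF T(1)])
      show "T (\<lambda>_. 1) k = 0" using T(2) that by auto
      fix b assume "b \<in> {s..<a}"
      thus "T (cols x b) k = 0" using Dz[of s b k] that by auto
    qed simp
    finally show ?thesis by simp
  qed
  have new: "cols_det n (cols (?x z)) s' (Suc (a - s')) =
     (\<Prod>j<a-s'. (r j)\<^sup>2) * ((tau a)\<^sup>2 * ?S (Suc (a - s')) (T z))" if s': "s' \<le> s" for s' z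
  proof -
    have "cols_det n (cols (?x z)) s' (Suc (a - s')) = cols_det n ((cols x)(a := y z)) s' (Suc (a - s'))"
      using s s' by (intro cols_det_cong) (auto simp: cols_def extend_def y_def)
    also have "\<dots> = (\<Prod>j<a-s'. (r j)\<^sup>2) * ?S (Suc (a - s')) (T (y z))"
      using D1[of s'] s s' by auto
    also have "?S (Suc (a - s')) (T (y z)) = (tau a)\<^sup>2 * ?S (Suc (a - s')) (T z)"
      unfolding sum_distrib_left using s' by (intro sum.cong refl) (auto simp: Ty power_mult_distrib)
    finally show ?thesis .
  qed
  have Tm [measurable]: "T \<in> ?G \<rightarrow>\<^sub>M ?G"
    and Td: "distr ?G ?G T = ?G"
    using T(1) by (simp_all add: gaussian_isometry_def)
  have m: "(\<lambda>z. \<Sum>k\<in>{v..<n}. (z k)\<^sup>2) \<in> borel_measurable ?G" for v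
  proof (intro borel_measurable_sum borel_measurable_power)
    fix i assume "i \<in> {v..<n}"
    thus "(\<lambda>z. z i) \<in> borel_measurable ?G"
      using measurable_component_singleton[of i "{..<n}" "\<lambda>_. std_normal_distribution"] by auto
  qed
  note [measurable] = m
  have "AE z in ?G. ?S (Suc a) z > 0"
    using a by (intro chi_square_pos_AE) auto
  hence "AE z in distr ?G ?G T. ?S (Suc a) z > 0"
    unfolding Td .
  hence AE: "AE z in ?G. ?S (Suc a) (T z) > 0"
    by (subst (asm) AE_distr_iff) auto
  show "AE z in ?G. cols_det n (cols (?x z)) 0 (Suc a) \<noteq> 0"
    using AE
  proof eventually_elim
    case (elim z)
    have "(\<Prod>j<a. (r j)\<^sup>2) * ((tau a)\<^sup>2 * ?S (Suc a) (T z)) > 0"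
      using elim pos[of 0, simplified] tau_pos[of a] by (intro mult_pos_pos) auto
    moreover have "cols_det n (cols (?x z)) 0 (Suc a) =
      (\<Prod>j<a. (r j)\<^sup>2) * ((tau a)\<^sup>2 * ?S (Suc a) (T z))"
      using new[of 0 z] by simp
    ultimately show ?case by linarith
  qed
  have "AE z in ?G. increment n a (?x z) =
    ln (?S (Suc a) (T z)) - ln (?S (Suc (a - s)) (T z))"
    using AE
  proof eventually_elim
    case (elim z)
    define A where "A = ?S (Suc a) (T z)"
    define B where "B = ?S (Suc (a - s)) (T z)"
    have "A \<le> B" unfolding A_def B_def using s by (intro sum_mono2) auto
    hence AB: "A > 0" "B > 0" using elim by (auto simp: A_def)
    have t: "(tau a)\<^sup>2 > 0" using tau_pos[of a] by simp
    have l: "ln (K * ((tau a)\<^sup>2 * C)) - ln K = ln ((tau a)\<^sup>2) + ln C" if "K > 0" "C > 0" for K C :: real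
    proof -
      have "ln (K * ((tau a)\<^sup>2 * C)) = ln K + ln ((tau a)\<^sup>2 * C)" using that t by (intro ln_mult_pos) auto
      also have "ln ((tau a)\<^sup>2 * C) = ln ((tau a)\<^sup>2) + ln C" using that t by (intro ln_mult_pos) auto
      finally show ?thesis by simp
    qed
    have "cols_det n (cols x) 0 a = (\<Prod>j<a. (r j)\<^sup>2)" "cols_det n (cols x) s (a - s) = (\<Prod>j<a-s. (r j)\<^sup>2)"
      using D0[of 0] D0[OF s] by auto
    hence "increment n a (?x z) = (ln ((tau a)\<^sup>2) + ln A) - (ln ((tau a)\<^sup>2) + ln B)"
      unfolding increment_def s_def[symmetric]
      using new[of 0 z] new[of s z] l[OF pos[of 0, simplified] AB(1)] l[OF pos[OF s] AB(2)] s
      by (simp add: cols_det_extend A_def[symmetric] B_def[symmetric])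
    thus ?case by (simp add: A_def B_def)
  qed
  hence AE2: "AE z in ?G. iexp (t * increment n a (?x z)) =
    iexp (t * (ln (?S (Suc a) (T z)) - ln (?S (Suc (a - s)) (T z))))"
    by eventually_elim simp
  have "extend n a \<in> rows_law n a \<Otimes>\<^sub>M ?G \<rightarrow>\<^sub>M rows_law n (Suc a)"
    using extend_measurable measurable_cong_sets[OF refl sets_rows_law] by blast
  hence "(\<lambda>w. increment n a (extend n a w)) \<in> borel_measurable (rows_law n a \<Otimes>\<^sub>M ?G)"
    by (rule measurable_compose[OF _ increment_measurable]) simp
  from measurable_Pair2[OF this xs]
  have [measurable]: "(\<lambda>z. increment n a (?x z)) \<in> borel_measurable ?G" .
  have "(LINT z|?G. iexp (t * increment n a (?x z))) =
    (LINT z|?G. iexp (t * (ln (?S (Suc a) (T z)) - ln (?S (Suc (a - s)) (T z)))))"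
    by (rule integral_cong_AE[OF _ _ AE2]) measurable
  also have "\<dots> = (LINT z|distr ?G ?G T. iexp (t * (ln (?S (Suc a) z) - ln (?S (Suc (a - s)) z))))"
    by (rule integral_distr[symmetric]) measurable
  \<comment> \<open>Degrees of freedom: one coordinate is lost to the constant column and one to
    each earlier column, of the whole matrix above and of the block below.\<close>
  also have "\<dots> = chi_ratio t (n - Suc a) / chi_ratio t (n - Suc (a - s))"
    unfolding Td using a s by (intro char_ln_chi_square_ratio) auto
  finally show "(LINT z|?G. iexp (t * increment n a (?x z))) =
      chi_ratio t (n - 1 - a) / chi_ratio t (n - 1 - (a - st a))"
    by (simp add: s_def)
qed

text \<open>The two claims share one induction because the conditional characteristic function is
  available only where the determinant of the earlier columns is nonzero.\<close>

lemma cols_det_nonzero_AE_char_increments: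
  assumes "a < n"
  shows "(AE x in rows_law n a. cols_det n (cols x) 0 a \<noteq> 0) \<and>
    (LINT x|rows_law n a. iexp (t * (\<Sum>b<a. increment n b x))) =
      (\<Prod>b<a. chi_ratio t (n - 1 - b) / chi_ratio t (n - 1 - (b - st b)))"
  using assms
proof (induction a)
  case 0
  interpret M: prob_space "rows_law n 0" by (rule prob_space_rows_law)
  show ?case using M.prob_space by (simp add: cols_det_def gram_det_def)
next
  case (Suc a)
  interpret M: prob_space "rows_law n a" by (rule prob_space_rows_law)
  let ?G = "gaussian {..<n}"
  interpret N: prob_space "?G" by (rule prob_space_gaussian)
  interpret P: pair_prob_space "rows_law n a" "?G" ..
  let ?P = "rows_law n a \<Otimes>\<^sub>M ?G"
  let ?C = "\<Prod>b<a. chi_ratio t (n - 1 - b) / chi_ratio t (n - 1 - (b - st b))"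
  let ?c = "chi_ratio t (n - 1 - a) / chi_ratio t (n - 1 - (a - st a))"
  have a: "a + 1 < n" using Suc.prems by simp
  have nz: "AE x in rows_law n a. cols_det n (cols x) 0 a \<noteq> 0"
    and IH: "(LINT x|rows_law n a. iexp (t * (\<Sum>b<a. increment n b x))) = ?C" using Suc by auto
  have nz': "AE x in rows_law n a. x \<in> space (rows_law n a) \<and> cols_det n (cols x) 0 a \<noteq> 0"
    using nz AE_space[of "rows_law n a"] by eventually_elim simp
  note em [measurable] = extend_measurable[of n a]
  have [measurable]: "(\<lambda>x. cols_det n (cols x) 0 (Suc a)) \<in> borel_measurable (rows_space n (Suc a))"
    by (rule cols_det_measurable) simp
  have "AE x in distr ?P (rows_space n (Suc a)) (extend n a). cols_det n (cols x) 0 (Suc a) \<noteq> 0"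
  proof (subst AE_distr_iff)
    show "AE w in ?P. cols_det n (cols (extend n a w)) 0 (Suc a) \<noteq> 0"
    proof (rule P.AE_pair_measure)
      show "AE x in rows_law n a. AE z in ?G. cols_det n (cols (extend n a (x, z))) 0 (Suc a) \<noteq> 0"
        using nz' by eventually_elim (rule conditional_increment(1)[OF a], auto)
    qed measurable
  qed measurable
  hence 1: "AE x in rows_law n (Suc a). cols_det n (cols x) 0 (Suc a) \<noteq> 0" unfolding rows_law_Suc .
  have [measurable]: "increment n b \<in> borel_measurable (rows_law n a)" if "b < a" for b
    using increment_measurable[OF that] .
  have i2 [measurable]: "increment n b \<in> borel_measurable (rows_space n (Suc a))" if "b < Suc a" for b
    using increment_measurable[OF that, of n] by (simp cong: measurable_cong_sets add: sets_rows_law)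
  have S1 [measurable]: "(\<lambda>x. \<Sum>b<Suc a. increment n b x) \<in> borel_measurable (rows_space n (Suc a))"
    by (intro borel_measurable_sum i2) auto
  have S2 [measurable]: "(\<lambda>x. \<Sum>b<a. increment n b x) \<in> borel_measurable (rows_law n a)"
    by (intro borel_measurable_sum) auto
  have "(LINT x|rows_law n (Suc a). iexp (t * (\<Sum>b<Suc a. increment n b x))) =
    (LINT w|?P. iexp (t * (\<Sum>b<Suc a. increment n b (extend n a w))))"
    unfolding rows_law_Suc by (rule integral_distr[OF em]) measurable
  also have "\<dots> = (LINT x|rows_law n a. LINT z|?G. iexp (t * (\<Sum>b<Suc a. increment n b (extend n a (x, z)))))"
    by (intro P.integral_fst'[symmetric] P.integrable_const_bound[where B = 1]) (auto simp del: sum.lessThan_Suc)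
  \<comment> \<open>The inner integral over the new column is the same constant \<open>?c\<close>
    for almost every \<open>x\<close> and factors out. This is the independence of the increments,
    expressed through characteristic functions.\<close>
  also have "\<dots> = (LINT x|rows_law n a. iexp (t * (\<Sum>b<a. increment n b x)) * ?c)"
  proof (rule integral_cong_AE)
    show "(\<lambda>x. LINT z|?G. iexp (t * (\<Sum>b<Suc a. increment n b (extend n a (x, z))))) \<in> borel_measurable (rows_law n a)"
      by (rule N.borel_measurable_lebesgue_integral) (measurable)
    show "AE x in rows_law n a. (LINT z|?G. iexp (t * (\<Sum>b<Suc a. increment n b (extend n a (x, z))))) =
       iexp (t * (\<Sum>b<a. increment n b x)) * ?c"
      using nz'
    proof eventually_elim
      case (elim x)
      have "iexp (t * (\<Sum>b<Suc a. increment n b (extend n a (x, z)))) =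
        iexp (t * (\<Sum>b<a. increment n b x)) * iexp (t * increment n a (extend n a (x, z)))" for z
        by (simp add: increment_extend distrib_left exp_add)
      hence "(LINT z|?G. iexp (t * (\<Sum>b<Suc a. increment n b (extend n a (x, z))))) =
        iexp (t * (\<Sum>b<a. increment n b x)) * (LINT z|?G. iexp (t * increment n a (extend n a (x, z))))"
        by (simp only: integral_mult_right_zero)
      thus ?case using conditional_increment(2)[OF a, of x t] elim by simp
    qed
  qed measurable
  also have "\<dots> = ?C * ?c" unfolding integral_mult_left_zero IH ..
  finally show ?case using 1 by simp
qed

end

section \<open>Reduction of the normal model\<close>

text \<open>The last variable is eliminated by completing its square, and \<open>Q'\<close> is the
  Schur complement. The zero pattern survives: for \<open>j < st i\<close> and \<open>i < p\<close>,
  monotonicity gives \<open>j < st p\<close>, so \<open>Q p j\<close> vanishes and the correction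
  term with it.\<close>

lemma complete_squares:
  fixes Q :: "nat \<Rightarrow> nat \<Rightarrow> real" and st :: "nat \<Rightarrow> nat"
  assumes sym: "\<And>i j. i < p \<Longrightarrow> j < p \<Longrightarrow> Q i j = Q j i"
    and pd: "\<And>v. \<exists>i<p. v i \<noteq> 0 \<Longrightarrow> 0 < (\<Sum>i<p. \<Sum>j<p. Q i j * v i * v j)"
    and block: "\<And>i j. i < p \<Longrightarrow> j < st i \<Longrightarrow> Q i j = 0"
    and st: "\<And>i. st i \<le> i" "\<And>i j. i \<le> j \<Longrightarrow> st i \<le> st j"
  shows "\<exists>beta tau. (\<forall>a. tau a > 0) \<and> (\<forall>v. (\<Sum>i<p. \<Sum>j<p. Q i j * v i * v j) =
    (\<Sum>a<p. ((v a - (\<Sum>b\<in>{st a..<a}. beta a b * v b)) / tau a)\<^sup>2))"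
  using sym pd block
proof (induction p arbitrary: Q)
  case 0
  show ?case by (intro exI[of _ "\<lambda>_ _. 0"] exI[of _ "\<lambda>_. 1"]) simp
next
  case (Suc p)
  note sym = Suc.prems(1) and pd = Suc.prems(2) and block = Suc.prems(3)
  define q where "q = Q p p"
  have "(\<Sum>i<Suc p. \<Sum>j<Suc p. Q i j * (if i = p then 1 else 0) * (if j = p then 1 else 0)) > 0"
    by (rule pd) auto
  moreover have "(\<Sum>i<p. \<Sum>j<Suc p. Q i j * (if i = p then 1 else 0) * (if j = p then 1 else 0)) = 0"
    by (intro sum.neutral ballI) auto
  moreover have "(\<Sum>j<p. Q p j * (if j = p then 1 else 0)) = 0" by (intro sum.neutral ballI) auto
  ultimately have q: "q > 0" by (simp add: q_def)
  define Q' where "Q' i j = Q i j - Q p i * Q p j / q" for i j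
  have expand: "(\<Sum>i<Suc p. \<Sum>j<Suc p. Q i j * v i * v j) =
    q * (v p + (\<Sum>j<p. Q p j * v j) / q)\<^sup>2 + (\<Sum>i<p. \<Sum>j<p. Q' i j * v i * v j)" for v
  proof -
    define S where "S = (\<Sum>j<p. Q p j * v j)"
    have SS: "S * S = (\<Sum>i<p. \<Sum>j<p. Q p i * Q p j * v i * v j)"
      unfolding S_def sum_product by (intro sum.cong refl) (simp only: ac_simps)
    have 1: "(\<Sum>i<p. \<Sum>j<p. Q' i j * v i * v j) = (\<Sum>i<p. \<Sum>j<p. Q i j * v i * v j) - S * S / q"
      unfolding SS Q'_def by (simp add: sum_subtractf left_diff_distrib sum_divide_distrib)
    have 2: "(\<Sum>i<p. Q i p * v i * v p) = v p * S" "(\<Sum>j<p. Q p j * v p * v j) = v p * S"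
      unfolding S_def sum_distrib_left using sym by (auto intro!: sum.cong)
    have "(\<Sum>i<Suc p. \<Sum>j<Suc p. Q i j * v i * v j) = (\<Sum>i<p. \<Sum>j<p. Q i j * v i * v j) + 2 * v p * S + q * (v p)\<^sup>2"
      using 2 by (simp add: sum.distrib q_def power2_eq_square)
    also have "\<dots> = q * (v p + S / q)\<^sup>2 + ((\<Sum>i<p. \<Sum>j<p. Q i j * v i * v j) - S * S / q)"
    proof -
      define u where "u = S / q"
      have "S = q * u" using q by (simp add: u_def)
      hence "S * S / q = q * (u * u)" "v p * S = v p * (q * u)" using q by simp_all
      thus ?thesis unfolding u_def[symmetric] mult.assoc[of 2] by (simp add: power2_eq_square ring_distribs)
    qed
    finally show ?thesis unfolding 1 S_def .
  qed
  obtain beta tau where IH: "\<forall>a. tau a > 0" "\<forall>v. (\<Sum>i<p. \<Sum>j<p. Q' i j * v i * v j) =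
    (\<Sum>a<p. ((v a - (\<Sum>b\<in>{st a..<a}. beta a b * v b)) / tau a)\<^sup>2)"
  proof -
    have "\<exists>beta tau. (\<forall>a. tau a > 0) \<and> (\<forall>v. (\<Sum>i<p. \<Sum>j<p. Q' i j * v i * v j) =
    (\<Sum>a<p. ((v a - (\<Sum>b\<in>{st a..<a}. beta a b * v b)) / tau a)\<^sup>2))"
    proof (rule Suc.IH)
      show "Q' i j = Q' j i" if "i < p" "j < p" for i j using sym[of i j] that by (simp add: Q'_def mult.commute)
      show "0 < (\<Sum>i<p. \<Sum>j<p. Q' i j * v i * v j)" if v: "\<exists>i<p. v i \<noteq> 0" for v
      proof -
        \<comment> \<open>The last coordinate is chosen to annihilate the completed square, so
          positivity of the full form gives positivity of the Schur complement.\<close>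
        define w where "w = v(p := - (\<Sum>j<p. Q p j * v j) / q)"
        have wv: "w i = v i" if "i < p" for i using that by (simp add: w_def)
        have "0 < (\<Sum>i<Suc p. \<Sum>j<Suc p. Q i j * w i * w j)"
        proof (rule pd)
          obtain i where "i < p" "v i \<noteq> 0" using v by blast
          thus "\<exists>i<Suc p. w i \<noteq> 0" using wv[of i] by (intro exI[of _ i]) auto
        qed
        also have "\<dots> = (\<Sum>i<p. \<Sum>j<p. Q' i j * w i * w j)"
          unfolding expand by (simp add: wv) (simp add: w_def)
        also have "\<dots> = (\<Sum>i<p. \<Sum>j<p. Q' i j * v i * v j)" by (simp add: wv)
        finally show ?thesis .
      qed
      show "Q' i j = 0" if "i < p" "j < st i" for i j
      proof -
        have "Q p i * Q p j = 0"
          using that block[of p i] block[of p j] st(2)[of i p] by (cases "i < st p") auto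
        thus ?thesis using block[of i j] that by (simp add: Q'_def)
      qed
    qed
    thus thesis by (elim exE conjE) (rule that)
  qed
  define beta' where "beta' a b = (if a = p then - Q p b / q else beta a b)" for a b
  define tau' where "tau' = tau(p := 1 / sqrt q)"
  have "(\<Sum>i<Suc p. \<Sum>j<Suc p. Q i j * v i * v j) =
    (\<Sum>a<Suc p. ((v a - (\<Sum>b\<in>{st a..<a}. beta' a b * v b)) / tau' a)\<^sup>2)" for v
  proof -
    have "(\<Sum>j<p. Q p j * v j) = (\<Sum>j\<in>{st p..<p}. Q p j * v j)"
      by (rule sum.mono_neutral_right) (use block[of p] in auto)
    hence e: "v p - (\<Sum>b\<in>{st p..<p}. beta' p b * v b) = v p + (\<Sum>j<p. Q p j * v j) / q"
      by (simp add: beta'_def sum_negf sum_divide_distrib)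
    have "((v p - (\<Sum>b\<in>{st p..<p}. beta' p b * v b)) / tau' p)\<^sup>2 = q * (v p + (\<Sum>j<p. Q p j * v j) / q)\<^sup>2"
    proof -
      have "(X / (1 / sqrt q))\<^sup>2 = q * X\<^sup>2" for X using q by (simp add: power_mult_distrib mult.commute)
      thus ?thesis unfolding e by (simp only: tau'_def fun_upd_same)
    qed
    moreover have "(\<Sum>a<p. ((v a - (\<Sum>b\<in>{st a..<a}. beta' a b * v b)) / tau' a)\<^sup>2) =
      (\<Sum>a<p. ((v a - (\<Sum>b\<in>{st a..<a}. beta a b * v b)) / tau a)\<^sup>2)"
      by (intro sum.cong) (auto simp: beta'_def tau'_def)
    ultimately show ?thesis unfolding expand using IH(2) by simp
  qed
  moreover have "\<forall>a. tau' a > 0" using IH(1) q by (simp add: tau'_def)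
  ultimately show ?case by (intro exI[of _ beta'] exI[of _ tau'] conjI allI) auto
qed

context triangular_rows
begin

lemma row_mean_upd: "b \<le> a \<Longrightarrow> row_mean b (x(a := y)) = row_mean b x"
  unfolding row_mean_def by (intro arg_cong2[of _ _ _ _ "(+)"] sum.cong) auto

definition row_density :: "nat \<Rightarrow> (nat \<Rightarrow> real) \<Rightarrow> real" where
  "row_density a x = (\<Prod>b<a. normal_density (row_mean b x) (tau b) (x b))"

lemma row_density_nonneg: "row_density a x \<ge> 0"
  unfolding row_density_def by (intro prod_nonneg) auto

lemma row_density_measurable: "row_density a \<in> borel_measurable (Pi\<^sub>M {..<a} (\<lambda>_. lborel))"
proof -
  let ?B = "borel_measurable (Pi\<^sub>M {..<a} (\<lambda>_. lborel :: real measure))"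
  have c: "(\<lambda>x. x b) \<in> ?B" if "b < a" for b
    using measurable_component_singleton[of b "{..<a}" "\<lambda>_. lborel :: real measure"] that by simp
  have m: "(\<lambda>x. row_mean b x) \<in> ?B" if "b < a" for b
    unfolding row_mean_def using that
    by (intro borel_measurable_add borel_measurable_sum borel_measurable_times borel_measurable_diff borel_measurable_const c) auto
  show ?thesis unfolding row_density_def[abs_def] normal_density_def
  proof (intro borel_measurable_prod)
    fix b assume b: "b \<in> {..<a}"
    have [measurable]: "(\<lambda>x. x b) \<in> ?B"
      "(\<lambda>x. row_mean b x) \<in> ?B" using c m b by auto
    show "(\<lambda>x. 1 / sqrt (2 * pi * (tau b)\<^sup>2) * exp (- (x b - row_mean b x)\<^sup>2 / (2 * (tau b)\<^sup>2))) \<in> ?B"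
      by measurable
  qed
qed

text \<open>Chain rule for densities: each new coordinate is an affine image of a standard normal
  variable and contributes its conditional density.\<close>

lemma row_law_density: "row_law a = density (Pi\<^sub>M {..<a} (\<lambda>_. lborel)) (\<lambda>x. ennreal (row_density a x))"
proof (induction a)
  case 0
  show ?case unfolding row_law.simps row_density_def lessThan_0 prod.empty ennreal_1 density_1 PiM_empty ..
next
  case (Suc a)
  let ?L = "Pi\<^sub>M {..<a} (\<lambda>_. lborel :: real measure)" and ?N = std_normal_distribution
  let ?u = "\<lambda>x z. x(a := row_mean a x + tau a * z)" and ?D = "\<lambda>x. ennreal (row_density (Suc a) x)"
  interpret M: prob_space "row_law a" by (rule prob_space_row_law)
  have N: "sigma_finite_measure ?N"
    by (intro prob_space_imp_sigma_finite prob_space_normal_density) simp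
  interpret L: product_sigma_finite "\<lambda>_::nat. lborel :: real measure"
    by (simp add: product_sigma_finite_def lborel.sigma_finite_measure_axioms)
  have sets_lb: "sets (Pi\<^sub>M I (\<lambda>_. lborel :: real measure)) = sets (Pi\<^sub>M I (\<lambda>_. borel))" for I :: "nat set"
    by (rule sets_PiM_cong) auto
  have e: "{..<Suc a} = insert a {..<a}" by (rule lessThan_Suc)
  show ?case
  proof (rule measure_eqI)
    show "sets (row_law (Suc a)) = sets (density (Pi\<^sub>M {..<Suc a} (\<lambda>_. lborel)) (\<lambda>x. ?D x))"
      unfolding sets_row_law sets_density sets_lb ..
    fix X assume "X \<in> sets (row_law (Suc a))"
    hence X [measurable]: "X \<in> sets (Pi\<^sub>M {..<Suc a} (\<lambda>_. borel))" by (simp only: sets_row_law)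
    have X' [measurable]: "X \<in> sets (Pi\<^sub>M {..<Suc a} (\<lambda>_. lborel))" using X unfolding sets_lb .
    note row_step_measurable[of a, measurable]
    note row_density_measurable[measurable]
    have im: "(\<lambda>(x, z). indicator X (?u x z) :: ennreal) \<in> borel_measurable (row_law a \<Otimes>\<^sub>M ?N)"
      using measurable_compose[OF row_step_measurable[of a] borel_measurable_indicator[OF X]] by (simp add: split_def)
    have ic: "(\<lambda>y. indicator X (x(a := y)) :: ennreal) \<in> borel_measurable borel" if x: "x \<in> space ?L" for x
    proof -
      have "(\<lambda>y. x(a := y)) \<in> borel \<rightarrow>\<^sub>M Pi\<^sub>M {..<Suc a} (\<lambda>_. borel)"
      proof (rule measurable_fun_upd[where J = "{..<a}"])
        show "(\<lambda>y::real. x) \<in> borel \<rightarrow>\<^sub>M Pi\<^sub>M {..<a} (\<lambda>_. borel)"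
          using x by (intro measurable_const) (simp add: space_PiM)
      qed auto
      thus ?thesis by (rule measurable_compose[OF _ borel_measurable_indicator[OF X]])
    qed
    have "emeasure (row_law (Suc a)) X = (\<integral>\<^sup>+w. indicator X ((\<lambda>(x, z). ?u x z) w) \<partial>(row_law a \<Otimes>\<^sub>M ?N))"
      unfolding row_law.simps
      by (subst nn_integral_indicator[symmetric], simp, subst nn_integral_distr[OF row_step_measurable]) auto
    also have "\<dots> = (\<integral>\<^sup>+x. \<integral>\<^sup>+z. indicator X (?u x z) \<partial>?N \<partial>row_law a)"
      by (subst sigma_finite_measure.nn_integral_fst[OF N, symmetric]) (use im in \<open>auto simp: split_def\<close>)
    also have "\<dots> = (\<integral>\<^sup>+x. ennreal (row_density a x) * (\<integral>\<^sup>+z. indicator X (?u x z) \<partial>?N) \<partial>?L)"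
    proof -
      have "(\<lambda>x. \<integral>\<^sup>+z. indicator X (?u x z) \<partial>?N) \<in> borel_measurable (row_law a)"
        by (rule sigma_finite_measure.borel_measurable_nn_integral[OF N im])
      hence "(\<lambda>x. \<integral>\<^sup>+z. indicator X (?u x z) \<partial>?N) \<in> borel_measurable ?L"
        unfolding Suc.IH by simp
      thus ?thesis unfolding Suc.IH by (subst nn_integral_density) auto
    qed
    also have "\<dots> = (\<integral>\<^sup>+x. \<integral>\<^sup>+y. ?D (x(a := y)) * indicator X (x(a := y)) \<partial>lborel \<partial>?L)"
    proof (rule nn_integral_cong)
      fix x assume x: "x \<in> space ?L"
      note [measurable] = ic[OF x]
      have rd: "row_density (Suc a) (x(a := y)) = row_density a x * normal_density (row_mean a x) (tau a) y" for y
        unfolding row_density_def by (simp add: row_mean_upd)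
      have nd: "\<bar>tau a\<bar> * normal_density (row_mean a x) (tau a) (row_mean a x + tau a * z) = std_normal_density z" for z
      proof -
        have "sqrt (2 * pi * (tau a)\<^sup>2) = sqrt (2 * pi) * tau a"
          using tau_pos[of a] by (simp add: real_sqrt_mult)
        moreover have "(row_mean a x + tau a * z - row_mean a x)\<^sup>2 / (2 * (tau a)\<^sup>2) = z\<^sup>2 / 2"
          using tau_pos[of a] by (simp add: power_mult_distrib)
        ultimately show ?thesis
          using tau_pos[of a] by (simp add: normal_density_def std_normal_density_def)
      qed
      have "(\<integral>\<^sup>+y. ?D (x(a := y)) * indicator X (x(a := y)) \<partial>lborel) =
        ennreal (row_density a x) * (\<integral>\<^sup>+y. ennreal (normal_density (row_mean a x) (tau a) y) * indicator X (x(a := y)) \<partial>lborel)"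
        unfolding rd by (subst nn_integral_cmult[symmetric]) (auto simp: ennreal_mult row_density_nonneg mult.assoc)
      also have "(\<integral>\<^sup>+y. ennreal (normal_density (row_mean a x) (tau a) y) * indicator X (x(a := y)) \<partial>lborel) =
        ennreal \<bar>tau a\<bar> * (\<integral>\<^sup>+z. ennreal (normal_density (row_mean a x) (tau a) (row_mean a x + tau a * z)) * indicator X (?u x z) \<partial>lborel)"
        using tau_pos[of a] by (intro nn_integral_real_affine) auto
      also have "\<dots> = (\<integral>\<^sup>+z. ennreal (std_normal_density z) * indicator X (?u x z) \<partial>lborel)"
        unfolding nd[symmetric] by (subst nn_integral_cmult[symmetric]) (auto simp: ennreal_mult mult.assoc)
      also have "\<dots> = (\<integral>\<^sup>+z. indicator X (?u x z) \<partial>?N)"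
        by (subst nn_integral_density) auto
      finally show "ennreal (row_density a x) * (\<integral>\<^sup>+z. indicator X (?u x z) \<partial>?N) =
        (\<integral>\<^sup>+y. ?D (x(a := y)) * indicator X (x(a := y)) \<partial>lborel)" by (rule sym)
    qed
    also have "\<dots> = (\<integral>\<^sup>+x. ?D x * indicator X x \<partial>Pi\<^sub>M {..<Suc a} (\<lambda>_. lborel))"
    proof -
      have "(\<lambda>x. ?D x * indicator X x) \<in> borel_measurable (Pi\<^sub>M (insert a {..<a}) (\<lambda>_. lborel))"
        unfolding e[symmetric] by measurable
      thus ?thesis unfolding e by (intro L.product_nn_integral_insert[symmetric]) simp_all
    qed
    also have "\<dots> = emeasure (density (Pi\<^sub>M {..<Suc a} (\<lambda>_. lborel)) (\<lambda>x. ?D x)) X"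
      by (rule emeasure_density[symmetric]) auto
    finally show "emeasure (row_law (Suc a)) X = emeasure (density (Pi\<^sub>M {..<Suc a} (\<lambda>_. lborel)) (\<lambda>x. ?D x)) X" .
  qed
qed

end

section \<open>Index arithmetic of consecutive blocks\<close>

definition block_of :: "(nat \<Rightarrow> nat) \<Rightarrow> nat \<Rightarrow> nat \<Rightarrow> nat" where
  "block_of d q i = (GREATEST k. k < q \<and> (\<Sum>l<k. d l) \<le> i)"

definition block_start :: "(nat \<Rightarrow> nat) \<Rightarrow> nat \<Rightarrow> nat \<Rightarrow> nat" where
  "block_start d q i = (\<Sum>l<block_of d q i. d l)"

text \<open>\<open>k = 0\<close> is always admissible in the \<open>GREATEST\<close>, and indices
  past the last block are assigned to block \<open>q - 1\<close>. The bounds therefore hold for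
  every index, as \<open>triangular_rows\<close> demands of \<open>st\<close>.\<close>

lemma block_of_less_start_le:
  assumes "q > 0"
  shows "block_of d q i < q" "block_start d q i \<le> i"
proof -
  have "block_of d q i < q \<and> (\<Sum>l<block_of d q i. d l) \<le> i"
    unfolding block_of_def
    by (rule GreatestI_nat[where k = 0 and b = q]) (use assms in auto)
  thus "block_of d q i < q" "block_start d q i \<le> i" by (auto simp: block_start_def)
qed

lemma block_of_greatest: "k < q \<Longrightarrow> (\<Sum>l<k. d l) \<le> i \<Longrightarrow> k \<le> block_of d q i"
  unfolding block_of_def by (rule Greatest_le_nat[where b = q]) auto

lemma block_of_mono:
  assumes "q > 0" "i \<le> j"
  shows "block_of d q i \<le> block_of d q j"
  using block_of_less_start_le[OF assms(1), of d i] assms(2)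
  by (intro block_of_greatest) (auto simp: block_start_def)

lemma partial_sum_mono: "j \<le> k \<Longrightarrow> (\<Sum>l<j. d l) \<le> (\<Sum>l<k. d l)" for j k :: nat and d :: "nat \<Rightarrow> nat"
  by (intro sum_mono2) auto

lemma block_start_mono: "q > 0 \<Longrightarrow> i \<le> j \<Longrightarrow> block_start d q i \<le> block_start d q j"
  unfolding block_start_def by (intro partial_sum_mono block_of_mono)

lemma less_next_block_start:
  assumes "q > 0" "i < (\<Sum>l<q. d l)"
  shows "i < block_start d q i + d (block_of d q i)"
proof (rule ccontr)
  assume "\<not> i < block_start d q i + d (block_of d q i)"
  hence le: "(\<Sum>l<Suc (block_of d q i). d l) \<le> i" by (simp add: block_start_def)
  have "Suc (block_of d q i) < q"
    using block_of_less_start_le(1)[OF assms(1), of d i] le assms(2) by (metis Suc_lessI not_less)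
  from block_of_greatest[OF this le] show False by simp
qed

lemma block_start_add:
  assumes "k < q" "j < d k"
  shows "block_start d q ((\<Sum>l<k. d l) + j) = (\<Sum>l<k. d l)"
proof -
  let ?i = "(\<Sum>l<k. d l) + j"
  have q: "q > 0" using assms by simp
  have "k \<le> block_of d q ?i" using assms by (intro block_of_greatest) auto
  moreover have "block_of d q ?i \<le> k"
  proof (rule ccontr)
    assume "\<not> block_of d q ?i \<le> k"
    hence "(\<Sum>l<Suc k. d l) \<le> (\<Sum>l<block_of d q ?i. d l)" by (intro partial_sum_mono) auto
    also have "\<dots> \<le> ?i" using block_of_less_start_le(2)[OF q, of d ?i] by (simp add: block_start_def)
    finally show False using assms by simp
  qed
  ultimately have "block_of d q ?i = k" by (rule antisym[rotated])
  thus ?thesis by (simp add: block_start_def)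
qed

lemma sum_blocks:
  fixes f :: "nat \<Rightarrow> 'b :: comm_monoid_add" and d :: "nat \<Rightarrow> nat" and q :: nat
  shows "(\<Sum>b<(\<Sum>i<q. d i). f b) = (\<Sum>i<q. \<Sum>j<d i. f ((\<Sum>l<i. d l) + j))"
proof (induction q)
  case (Suc q)
  have "(\<Sum>b<m + k. f b) = (\<Sum>b<m. f b) + (\<Sum>j<k. f (m + j))" for m k :: nat
    by (induction k) (auto simp: add.assoc)
  thus ?case using Suc by simp
qed simp

lemma prod_blocks:
  fixes f :: "nat \<Rightarrow> 'b :: comm_monoid_mult" and d :: "nat \<Rightarrow> nat" and q :: nat
  shows "(\<Prod>b<(\<Sum>i<q. d i). f b) = (\<Prod>i<q. \<Prod>j<d i. f ((\<Sum>l<i. d l) + j))"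
proof (induction q)
  case (Suc q)
  have "(\<Prod>b<m + k. f b) = (\<Prod>b<m. f b) * (\<Prod>j<k. f (m + j))" for m k :: nat
    by (induction k) (auto simp: mult.assoc)
  thus ?case using Suc by simp
qed simp

lemma block_diagonal_entries:
  assumes q: "q > 0" and d: "(\<Sum>i<q. d i) = p"
    and H0: "\<And>i j. i < q \<Longrightarrow> j < q \<Longrightarrow> i \<noteq> j \<Longrightarrow> mat_block d S i j = 0\<^sub>m (d i) (d j)"
    and ij: "i < p" "j < p" "block_of d q i \<noteq> block_of d q j"
  shows "S $$ (i, j) = 0"
proof -
  let ?k = "block_of d q i" and ?l = "block_of d q j"
  define a where "a = i - block_start d q i"
  define b where "b = j - block_start d q j"
  have a: "a < d ?k" "(\<Sum>l<?k. d l) + a = i"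
    using less_next_block_start[OF q, of i d] block_of_less_start_le(2)[OF q, of d i] ij d
    by (auto simp: a_def block_start_def)
  have b: "b < d ?l" "(\<Sum>l<?l. d l) + b = j"
    using less_next_block_start[OF q, of j d] block_of_less_start_le(2)[OF q, of d j] ij d
    by (auto simp: b_def block_start_def)
  have "mat_block d S ?k ?l $$ (a, b) = 0\<^sub>m (d ?k) (d ?l) $$ (a, b)"
    using H0[OF block_of_less_start_le(1)[OF q] block_of_less_start_le(1)[OF q] ij(3)] by simp
  thus ?thesis using a b by (simp add: mat_block_def)
qed

section \<open>The normal law under the null hypothesis in regression form\<close>

lemma positive_definite_inverse:
  assumes S: "S \<in> carrier_mat p p" and pd: "positive_definite S"
  obtains A where "mat_inverse S = Some A" "A \<in> carrier_mat p p" "S * A = 1\<^sub>m p" "A * S = 1\<^sub>m p"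
    "A\<^sup>T = A" "\<And>v. v \<in> carrier_vec p \<Longrightarrow> v \<noteq> 0\<^sub>v p \<Longrightarrow> scalar_prod v (A *\<^sub>v v) > 0"
proof -
  have sym: "S\<^sup>T = S" and pos: "\<And>v. v \<in> carrier_vec p \<Longrightarrow> v \<noteq> 0\<^sub>v p \<Longrightarrow> scalar_prod v (S *\<^sub>v v) > 0"
    using pd S by (auto simp: positive_definite_def)
  have "det S \<noteq> 0"
  proof
    assume "det S = 0"
    then obtain v where v: "v \<in> carrier_vec p" "v \<noteq> 0\<^sub>v p" "S *\<^sub>v v = 0\<^sub>v p"
      using det_0_iff_vec_prod_zero[OF S] by blast
    thus False using pos[of v] by simp
  qed
  hence "S \<in> Units (ring_mat TYPE(real) p ())" by (rule det_non_zero_imp_unit[OF S])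
  then obtain A where A: "mat_inverse S = Some A" using mat_inverse(1)[OF S, of "()"] by (cases "mat_inverse S") auto
  have inv: "S * A = 1\<^sub>m p" "A * S = 1\<^sub>m p" and Ac: "A \<in> carrier_mat p p" using mat_inverse(2)[OF S A] by auto
  have AT: "A\<^sup>T \<in> carrier_mat p p" using Ac by simp
  have "A\<^sup>T = A\<^sup>T * (S * A)" using AT inv by simp
  also have "\<dots> = (A\<^sup>T * S) * A" using AT S Ac by (simp add: assoc_mult_mat)
  also have "A\<^sup>T * S = (S * A)\<^sup>T" using transpose_mult[OF S Ac] sym by simp
  also have "(S * A)\<^sup>T * A = A" using inv Ac by simp
  finally have Asym: "A\<^sup>T = A" .
  have "scalar_prod v (A *\<^sub>v v) > 0" if v: "v \<in> carrier_vec p" "v \<noteq> 0\<^sub>v p" for v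
  proof -
    define w where "w = A *\<^sub>v v"
    have w: "w \<in> carrier_vec p" using Ac v by (simp add: w_def)
    have Sw: "S *\<^sub>v w = v"
      unfolding w_def using assoc_mult_mat_vec[OF S Ac v(1)] inv v by simp
    have "w \<noteq> 0\<^sub>v p"
    proof
      assume "w = 0\<^sub>v p"
      hence "S *\<^sub>v w = 0\<^sub>v p" using S by (auto simp: scalar_prod_def)
      thus False using Sw v by simp
    qed
    from pos[OF w this] have "scalar_prod w v > 0" by (simp add: Sw)
    thus ?thesis using comm_scalar_prod[OF w v(1)] by (simp add: w_def)
  qed
  with that A Ac inv Asym show thesis by blast
qed

text \<open>Setting the off-diagonal blocks of \<open>A\<close> to zero still gives a right inverse
  of \<open>S\<close>, and inverses are unique.\<close>

lemma block_diagonal_inverse_entries: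
  fixes S A :: "real mat"
  assumes S: "S \<in> carrier_mat p p" and A: "A \<in> carrier_mat p p" and inv: "S * A = 1\<^sub>m p" "A * S = 1\<^sub>m p"
    and blk: "\<And>i j. i < p \<Longrightarrow> j < p \<Longrightarrow> bl i \<noteq> bl j \<Longrightarrow> S $$ (i, j) = 0"
    and ij: "i < p" "j < p" "bl i \<noteq> bl j"
  shows "A $$ (i, j) = 0"
proof -
  define B where "B = mat p p (\<lambda>(i, j). if bl i = bl j then A $$ (i, j) else 0)"
  have B: "B \<in> carrier_mat p p" by (simp add: B_def)
  have "S * B = 1\<^sub>m p"
  proof (rule eq_matI)
    fix i j assume "i < dim_row (1\<^sub>m p)" "j < dim_col (1\<^sub>m p)"
    hence ij: "i < p" "j < p" by auto
    have e: "(S * C) $$ (i, j) = (\<Sum>k<p. S $$ (i, k) * C $$ (k, j))" if "C \<in> carrier_mat p p" for C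
      using S that ij by (simp add: scalar_prod_def atLeast0LessThan)
    show "(S * B) $$ (i, j) = 1\<^sub>m p $$ (i, j)"
    proof (cases "bl i = bl j")
      case True
      have "(S * B) $$ (i, j) = (S * A) $$ (i, j)"
        unfolding e[OF B] e[OF A] using ij True blk[of i] by (intro sum.cong) (auto simp: B_def)
      thus ?thesis unfolding inv .
    next
      case False
      have "(S * B) $$ (i, j) = 0"
        unfolding e[OF B] using ij False blk[of i] by (intro sum.neutral) (auto simp: B_def)
      thus ?thesis using False ij by auto
    qed
  qed (use S B in auto)
  hence "A = A * (S * B)" using right_mult_one_mat[OF A] by simp
  also have "\<dots> = B" unfolding assoc_mult_mat[OF A S B, symmetric] inv by (rule left_mult_one_mat[OF B])
  finally have "A $$ (i, j) = B $$ (i, j)" by simp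
  thus ?thesis using ij by (simp add: B_def)
qed

text \<open>Completing squares in the inverse covariance matrix shows that the two densities differ
  by a constant factor \<open>C\<close>. Both measures have mass one, the left one by
  \<open>prob\<close>, so \<open>C = 1\<close>; this also accounts for \<open>det S\<close>.\<close>

lemma multivariate_normal_row_law:
  assumes q: "q > 0" and d: "(\<Sum>i<q. d i) = p" and \<mu>: "\<mu> \<in> carrier_vec p"
    and S: "S \<in> carrier_mat p p" and pd: "positive_definite S"
    and H0: "\<And>i j. i < q \<Longrightarrow> j < q \<Longrightarrow> i \<noteq> j \<Longrightarrow> mat_block d S i j = 0\<^sub>m (d i) (d j)"
    and prob: "prob_space (multivariate_normal \<mu> S)"
  obtains beta tau where "triangular_rows tau (block_start d q)"
    "multivariate_normal \<mu> S = triangular_rows.row_law (\<lambda>i. \<mu> $ i) beta tau (block_start d q) p"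
proof -
  let ?L = "Pi\<^sub>M {..<p} (\<lambda>_. lborel :: real measure)"
  define st where "st = block_start d q"
  obtain A where A: "mat_inverse S = Some A" "A \<in> carrier_mat p p" "S * A = 1\<^sub>m p" "A * S = 1\<^sub>m p"
    "A\<^sup>T = A" "\<And>v. v \<in> carrier_vec p \<Longrightarrow> v \<noteq> 0\<^sub>v p \<Longrightarrow> scalar_prod v (A *\<^sub>v v) > 0"
    by (rule positive_definite_inverse[OF S pd]) (rule that)
  define Q where "Q i j = A $$ (i, j)" for i j
  have form: "scalar_prod (vec p v) (A *\<^sub>v vec p v) = (\<Sum>i<p. \<Sum>j<p. Q i j * v i * v j)" for v
    using A(2) by (simp add: scalar_prod_def atLeast0LessThan Q_def sum_distrib_left ac_simps)
  let ?P = "\<lambda>beta tau. (\<forall>a. tau a > 0) \<and> (\<forall>v. (\<Sum>i<p. \<Sum>j<p. Q i j * v i * v j) =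
    (\<Sum>a<p. ((v a - (\<Sum>b\<in>{st a..<a}. beta a b * v b)) / tau a)\<^sup>2))"
  have "\<exists>beta tau. ?P beta tau"
  proof (rule complete_squares)
    show "Q i j = Q j i" if "i < p" "j < p" for i j
      using A(5) A(2) that unfolding Q_def by (metis index_transpose_mat(1) carrier_matD)
    show "0 < (\<Sum>i<p. \<Sum>j<p. Q i j * v i * v j)" if v: "\<exists>i<p. v i \<noteq> 0" for v
    proof -
      obtain i where i: "i < p" "v i \<noteq> 0" using v by blast
      have "vec p v \<noteq> 0\<^sub>v p"
      proof
        assume "vec p v = 0\<^sub>v p"
        hence "vec p v $ i = 0\<^sub>v p $ i" by simp
        thus False using i by simp
      qed
      thus ?thesis unfolding form[symmetric] by (intro A(6)) auto
    qed
    show "Q i j = 0" if "i < p" "j < st i" for i j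
    proof -
      have j: "j < i" using that block_of_less_start_le(2)[OF q, of d i] by (simp add: st_def)
      have "block_of d q i \<noteq> block_of d q j"
      proof
        assume "block_of d q i = block_of d q j"
        hence "st i = st j" by (simp add: st_def block_start_def)
        thus False using that block_of_less_start_le(2)[OF q, of d j] by (simp add: st_def)
      qed
      thus ?thesis unfolding Q_def using that j
        by (intro block_diagonal_inverse_entries[OF S A(2-4), where bl = "block_of d q"] block_diagonal_entries[OF q d H0]) auto
    qed
    show "st i \<le> i" for i unfolding st_def by (rule block_of_less_start_le[OF q])
    show "st i \<le> st j" if "i \<le> j" for i j unfolding st_def by (rule block_start_mono[OF q that])
  qed
  then obtain beta tau where bt: "?P beta tau"
    by (elim exE) (rule that)
  have tau: "\<And>a. tau a > 0" and sq: "\<And>v. (\<Sum>i<p. \<Sum>j<p. Q i j * v i * v j) =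
    (\<Sum>a<p. ((v a - (\<Sum>b\<in>{st a..<a}. beta a b * v b)) / tau a)\<^sup>2)"
    using bt[THEN conjunct1, THEN spec] bt[THEN conjunct2, THEN spec] .
  interpret R: triangular_rows "\<lambda>i. \<mu> $ i" beta tau st
    by (simp add: triangular_rows_def tau st_def block_of_less_start_le(2)[OF q])
  define C0 where "C0 = (\<Prod>a<p. 1 / sqrt (2 * pi * (tau a)\<^sup>2))"
  have C0: "C0 > 0" unfolding C0_def
  proof (intro prod_pos)
    show "0 < 1 / sqrt (2 * pi * (tau a)\<^sup>2)" for a using tau[of a] by simp
  qed
  define C where "C = 1 / sqrt ((2 * pi) ^ p * det S) / C0"
  have dens: "multivariate_normal_density \<mu> S x = C * R.row_density p x" for x
  proof -
    define v where "v i = x i - \<mu> $ i" for i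
    have vv: "vec p x - \<mu> = vec p v" using \<mu> by (intro eq_vecI) (auto simp: v_def)
    have rm: "v a - (\<Sum>b\<in>{st a..<a}. beta a b * v b) = x a - R.row_mean a x" for a
      by (simp add: v_def R.row_mean_def)
    have "R.row_density p x = C0 * exp (\<Sum>a<p. - (x a - R.row_mean a x)\<^sup>2 / (2 * (tau a)\<^sup>2))"
      unfolding R.row_density_def normal_density_def C0_def exp_sum[OF finite_lessThan] by (rule prod.distrib)
    also have "(\<Sum>a<p. - (x a - R.row_mean a x)\<^sup>2 / (2 * (tau a)\<^sup>2)) = - (\<Sum>a<p. ((x a - R.row_mean a x) / tau a)\<^sup>2) / 2"
      by (simp add: sum_negf sum_divide_distrib power_divide mult.commute)
    also have "(\<Sum>a<p. ((x a - R.row_mean a x) / tau a)\<^sup>2) = scalar_prod (vec p v) (A *\<^sub>v vec p v)"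
      unfolding form sq rm ..
    finally have "R.row_density p x = C0 * exp (- scalar_prod (vec p v) (A *\<^sub>v vec p v) / 2)" .
    thus ?thesis using C0 \<mu>
      by (simp add: multivariate_normal_density_def Let_def vv A(1) C_def)
  qed
  interpret P: prob_space "R.row_law p" by (rule R.prob_space_row_law)
  have "(\<integral>\<^sup>+x. ennreal (R.row_density p x) \<partial>?L) = emeasure (R.row_law p) (space (R.row_law p))"
    unfolding R.row_law_density using R.row_density_measurable by (subst emeasure_density) (auto intro!: nn_integral_cong)
  hence rd1: "(\<integral>\<^sup>+x. ennreal (R.row_density p x) \<partial>?L) = 1"
    using P.emeasure_space_1 by simp
  have mvn: "multivariate_normal \<mu> S = density ?L (\<lambda>x. ennreal (C * R.row_density p x))"
    unfolding multivariate_normal_def dens using \<mu> by simp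
  have [measurable]: "R.row_density p \<in> borel_measurable ?L" by (rule R.row_density_measurable)
  have "1 = emeasure (multivariate_normal \<mu> S) (space (multivariate_normal \<mu> S))"
    using prob_space.emeasure_space_1[OF prob] by simp
  also have "\<dots> = (\<integral>\<^sup>+x. ennreal (C * R.row_density p x) \<partial>?L)"
    unfolding mvn by (subst emeasure_density) (auto intro!: nn_integral_cong)
  also have "\<dots> = ennreal C * (\<integral>\<^sup>+x. ennreal (R.row_density p x) \<partial>?L)"
  proof (subst nn_integral_cmult[symmetric])
    have "ennreal (C * R.row_density p x) = ennreal C * ennreal (R.row_density p x)" for x
      using R.row_density_nonneg[of p x] by (rule ennreal_mult'')
    thus "(\<integral>\<^sup>+x. ennreal (C * R.row_density p x) \<partial>?L) =
      (\<integral>\<^sup>+x. ennreal C * ennreal (R.row_density p x) \<partial>?L)" by simp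
  qed simp
  finally have "ennreal C = 1" unfolding rd1 by simp
  hence "C = 1" by (simp add: ennreal_eq_1)
  hence "multivariate_normal \<mu> S = R.row_law p" unfolding mvn R.row_law_density by simp
  with R.triangular_rows_axioms show thesis
    unfolding st_def by (rule that[where beta = beta and tau = tau])
qed

section \<open>The statistic in terms of Gram determinants\<close>

lemma sample_cov_entry:
  assumes "n > 0" "a < p" "b < p"
  shows "sample_cov n p x $$ (a, b) = centered_dot n (cols x a) (cols x b) / real n"
proof -
  define S where "S a = (\<Sum>k<n. x k a)" for a
  have "(\<Sum>k<n. (x k a - S a / real n) * (x k b - S b / real n)) =
    (\<Sum>k<n. x k a * x k b - S b / real n * x k a - S a / real n * x k b + S a / real n * (S b / real n))"
    by (intro sum.cong refl) (simp add: algebra_simps)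
  also have "\<dots> = (\<Sum>k<n. x k a * x k b) - (\<Sum>k<n. S b / real n * x k a) - (\<Sum>k<n. S a / real n * x k b) + real n * (S a / real n * (S b / real n))"
    by (simp add: sum.distrib sum_subtractf)
  also have "\<dots> = (\<Sum>k<n. x k a * x k b) - S b / real n * S a - S a / real n * S b + real n * (S a / real n * (S b / real n))"
    unfolding sum_distrib_left[symmetric] S_def[symmetric] ..
  also have "\<dots> = (\<Sum>k<n. x k a * x k b) - S a * S b / real n"
    using assms(1) by (simp add: field_simps)
  finally show ?thesis
    using assms by (simp add: sample_cov_def sample_mean_def centered_dot_def dot_def cols_def S_def)
qed

lemma dim_sample_cov [simp]: "dim_row (sample_cov n p x) = p" "dim_col (sample_cov n p x) = p"
  by (simp_all add: sample_cov_def)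

lemma det_sample_cov:
  assumes "n > 0"
  shows "det (sample_cov n p x) = cols_det n (cols x) 0 p / real n ^ p"
proof -
  have "sample_cov n p x = (1 / real n) \<cdot>\<^sub>m mat p p (\<lambda>(i, j). centered_dot n (cols x i) (cols x j))"
    by (intro eq_matI) (auto simp: sample_cov_entry[OF assms])
  thus ?thesis
    by (simp add: cols_det_def gram_det_def det_smult power_one_over field_simps)
qed

lemma det_mat_block_sample_cov:
  assumes "n > 0" "i < q" "(\<Sum>l<q. d l) = p"
  shows "det (mat_block d (sample_cov n p x) i i) = cols_det n (cols x) (\<Sum>l<i. d l) (d i) / real n ^ d i"
proof -
  have "(\<Sum>l<Suc i. d l) \<le> p" unfolding assms(3)[symmetric] using assms(2) by (intro partial_sum_mono) auto
  hence lt: "(\<Sum>l<i. d l) + a < p" if "a < d i" for a using that by simp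
  have "mat_block d (sample_cov n p x) i i =
    (1 / real n) \<cdot>\<^sub>m mat (d i) (d i) (\<lambda>(a, b). centered_dot n (cols x ((\<Sum>l<i. d l) + a)) (cols x ((\<Sum>l<i. d l) + b)))"
    by (intro eq_matI) (auto simp: mat_block_def sample_cov_entry[OF assms(1) lt lt])
  thus ?thesis
    by (simp add: cols_det_def gram_det_def det_smult power_one_over field_simps)
qed

text \<open>Dropping the last column keeps the determinant nonzero, so it can be repeated until the
  window from \<open>s\<close> to \<open>b - 1\<close> is a suffix.\<close>

lemma cols_det_pos:
  assumes "a + 1 < n" "cols_det n c 0 a \<noteq> 0" "s \<le> b" "b \<le> a"
  shows "cols_det n c s (b - s) > 0"
  using assms
proof (induction a)
  case 0
  thus ?case by (simp add: cols_det_def gram_det_def)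
next
  case (Suc a)
  show ?case
  proof (cases "b = Suc a")
    case True
    thus ?thesis using cols_det_suffix_pos[of "Suc a" n c s] Suc.prems by simp
  next
    case False
    have a: "a + 1 < n" using Suc.prems by simp
    hence "cols_det n c 0 a \<noteq> 0" using cols_det_Suc_nonzero[of a n c] Suc.prems by simp
    thus ?thesis using Suc.IH[OF a] Suc.prems False by auto
  qed
qed

context triangular_rows
begin

text \<open>The powers of \<open>n\<close> from the sample covariance cancel because the block sizes
  add up to \<open>p\<close>. The logarithms of the full and of the block determinants then
  telescope over columns, starting from empty determinants equal to 1.\<close>

lemma ln_likelihood_ratio:
  assumes st: "st = block_start d q" and d: "(\<Sum>i<q. d i) = p" and n: "p + 1 < n"
    and x: "cols_det n (cols x) 0 p \<noteq> 0"
  shows "2 / real n * ln (likelihood_ratio n p q d x) = (\<Sum>b<p. increment n b x)"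
proof -
  define D where "D s m = cols_det n (cols x) s m" for s m
  define S where "S i = (\<Sum>l<i. d l)" for i
  have n0: "n > 0" "real n > 0" using n by auto
  have Sp: "S i + d i \<le> p" if "i < q" for i
  proof -
    have "(\<Sum>l<Suc i. d l) \<le> p" unfolding d[symmetric] using that by (intro partial_sum_mono) auto
    thus ?thesis by (simp add: S_def)
  qed
  have pos: "D s m > 0" if "s + m \<le> p" for s m
    using cols_det_pos[OF n x, of s "s + m"] that by (simp add: D_def)
  have D0: "D s 0 = 1" for s by (simp add: D_def cols_det_def gram_det_def)
  define E where "E i = D (S i) (d i) / real n ^ d i" for i
  define E0 where "E0 = D 0 p / real n ^ p"
  have E: "E i > 0" if "i < q" for i using pos[OF Sp[OF that]] n0 by (simp add: E_def)
  have E0: "E0 > 0" using pos[of 0 p] n0 by (simp add: E0_def)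
  have lnE: "ln (E i) = ln (D (S i) (d i)) - real (d i) * ln (real n)" if "i < q" for i
    using pos[OF Sp[OF that]] n0 by (simp add: E_def ln_divide_pos ln_realpow)
  have lnE0: "ln E0 = ln (D 0 p) - real p * ln (real n)"
    using pos[of 0 p] n0 by (simp add: E0_def ln_divide_pos ln_realpow)
  have "likelihood_ratio n p q d x = E0 powr (real n / 2) / (\<Prod>i<q. E i powr (real n / 2))"
    unfolding likelihood_ratio_def det_sample_cov[OF n0(1)] E0_def D_def
    by (intro arg_cong2[of _ _ _ _ "(/)"] refl prod.cong)
      (simp add: det_mat_block_sample_cov[OF n0(1) _ d] E_def D_def S_def)
  hence "ln (likelihood_ratio n p q d x) = ln (E0 powr (real n / 2)) - ln (\<Prod>i<q. E i powr (real n / 2))"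
  proof -
    have "(\<Prod>i<q. E i powr (real n / 2)) > 0"
    proof (intro prod_pos)
      show "0 < E i powr (real n / 2)" if "i \<in> {..<q}" for i using E[of i] that by simp
    qed
    moreover have "E0 powr (real n / 2) > 0" using E0 by simp
    ultimately have "ln (E0 powr (real n / 2) / (\<Prod>i<q. E i powr (real n / 2))) =
      ln (E0 powr (real n / 2)) - ln (\<Prod>i<q. E i powr (real n / 2))" by (intro ln_divide_pos)
    moreover assume "likelihood_ratio n p q d x = E0 powr (real n / 2) / (\<Prod>i<q. E i powr (real n / 2))"
    ultimately show ?thesis by (simp only:)
  qed
  also have "ln (E0 powr (real n / 2)) = real n / 2 * ln E0" by (rule ln_powr)
  finally have 1: "ln (likelihood_ratio n p q d x) = real n / 2 * ln E0 - ln (\<Prod>i<q. E i powr (real n / 2))" .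
  have Epow: "E i powr (real n / 2) \<noteq> 0" if "i < q" for i using E[OF that] by simp
  have "ln (\<Prod>i<q. E i powr (real n / 2)) = (\<Sum>i<q. ln (E i powr (real n / 2)))"
    using E by (intro ln_prod) (auto dest: Epow)
  also have "\<dots> = (\<Sum>i<q. real n / 2 * ln (E i))"
    by (intro sum.cong refl ln_powr)
  also have "\<dots> = real n / 2 * (\<Sum>i<q. ln (E i))" by (rule sum_distrib_left[symmetric])
  finally have "ln (likelihood_ratio n p q d x) = real n / 2 * (ln E0 - (\<Sum>i<q. ln (E i)))"
    unfolding 1 by (simp add: right_diff_distrib)
  moreover have "2 / real n * (real n / 2 * z) = z" for z using n0 by simp
  ultimately have "2 / real n * ln (likelihood_ratio n p q d x) = ln E0 - (\<Sum>i<q. ln (E i))" by (simp only:)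
  also have "(\<Sum>i<q. ln (E i)) = (\<Sum>i<q. ln (D (S i) (d i)) - real (d i) * ln (real n))"
    by (intro sum.cong refl lnE) auto
  also have "\<dots> = (\<Sum>i<q. ln (D (S i) (d i))) - real p * ln (real n)"
    unfolding d[symmetric] by (simp add: sum_subtractf sum_distrib_right)
  finally have "2 / real n * ln (likelihood_ratio n p q d x) = ln (D 0 p) - (\<Sum>i<q. ln (D (S i) (d i)))"
    unfolding lnE0 by simp
  also have "ln (D 0 p) = (\<Sum>b<p. ln (D 0 (Suc b)) - ln (D 0 b))"
    by (subst sum_lessThan_telescope) (simp add: D0)
  \<comment> \<open>At column \<open>S i + j\<close> the block starts at \<open>S i\<close>, so the
    \<open>j\<close>-sum telescopes to the determinant of block \<open>i\<close>.\<close>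
  also have "(\<Sum>i<q. ln (D (S i) (d i))) = (\<Sum>b<p. ln (D (st b) (Suc (b - st b))) - ln (D (st b) (b - st b)))"
  proof -
    have "(\<Sum>b<p. ln (D (st b) (Suc (b - st b))) - ln (D (st b) (b - st b))) =
      (\<Sum>i<q. \<Sum>j<d i. ln (D (st (S i + j)) (Suc (S i + j - st (S i + j)))) - ln (D (st (S i + j)) (S i + j - st (S i + j))))"
      unfolding d[symmetric] S_def by (rule sum_blocks)
    also have "\<dots> = (\<Sum>i<q. \<Sum>j<d i. ln (D (S i) (Suc j)) - ln (D (S i) j))"
      by (intro sum.cong refl) (simp add: st block_start_add S_def)
    also have "\<dots> = (\<Sum>i<q. ln (D (S i) (d i)))"
      by (intro sum.cong refl, subst sum_lessThan_telescope) (simp add: D0)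
    finally show ?thesis by simp
  qed
  finally show ?thesis by (simp add: increment_def D_def sum_subtractf)
qed

lemma chi_ratio_prod_blocks:
  assumes st: "st = block_start d q" and d: "(\<Sum>i<q. d i) = p"
  shows "(\<Prod>b<p. chi_ratio t (n - 1 - b) / chi_ratio t (n - 1 - (b - st b))) =
    block_chi_ratio t n p q d"
proof -
  have "(\<Prod>b<p. chi_ratio t (n - 1 - (b - st b))) = (\<Prod>i<q. \<Prod>j<d i. chi_ratio t (n - 1 - ((\<Sum>l<i. d l) + j - st ((\<Sum>l<i. d l) + j))))"
    unfolding d[symmetric] by (rule prod_blocks)
  also have "\<dots> = (\<Prod>i<q. \<Prod>j<d i. chi_ratio t (n - 1 - j))"
    by (intro prod.cong refl) (simp add: st block_start_add)
  finally show ?thesis by (simp add: prod_dividef block_chi_ratio_def)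
qed

end

section \<open>The limit theorem\<close>

lemma char_normal_density:
  assumes "\<sigma> > 0"
  shows "char (density lborel (normal_density 0 \<sigma>)) t = of_real (exp (- \<sigma>\<^sup>2 * t\<^sup>2 / 2))"
proof -
  interpret N: prob_space std_normal_distribution by (rule prob_space_normal_density) simp
  have "distributed std_normal_distribution lborel (\<lambda>x. x) (normal_density 0 1)"
    by (simp add: distributed_def distr_id2)
  from N.normal_density_affine[OF this, of \<sigma> 0]
  have "distributed std_normal_distribution lborel (\<lambda>x. \<sigma> * x) (normal_density 0 \<sigma>)" using assms by simp
  hence "density lborel (normal_density 0 \<sigma>) = distr std_normal_distribution lborel (\<lambda>x. \<sigma> * x)"
    by (simp add: distributed_def)
  hence "char (density lborel (normal_density 0 \<sigma>)) t = (LINT x|distr std_normal_distribution lborel (\<lambda>x. \<sigma> * x). iexp (t * x))"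
    by (simp only: char_def)
  also have "\<dots> = (LINT x|std_normal_distribution. iexp ((t * \<sigma>) * x))"
    by (subst integral_distr) (auto simp: mult.assoc)
  also have "\<dots> = char std_normal_distribution (t * \<sigma>)" by (simp only: char_def)
  finally show ?thesis unfolding char_std_normal_distribution by (simp add: power_mult_distrib mult.commute)
qed

text \<open>Levy's theorem asks for a distribution at every index. The finitely many indices without
  this guarantee are filled with the limit law, which changes neither the characteristic functions
  nor the cdfs in the limit.\<close>

lemma weak_conv_m_char_eventually:
  assumes M: "\<forall>\<^sub>F n in sequentially. real_distribution (M n)" and M': "real_distribution M'"
    and lim: "\<And>t. (\<lambda>n. char (M n) t) \<longlonglongrightarrow> char M' t"
  shows "weak_conv_m M M'"
proof -
  define L where "L n = (if real_distribution (M n) then M n else M')" for n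
  have ev: "\<forall>\<^sub>F n in sequentially. M n = L n" using M by eventually_elim (simp add: L_def)
  have "weak_conv_m L M'"
  proof (rule levy_continuity[OF _ M'])
    show "real_distribution (L n)" for n using M' by (simp add: L_def)
    show "(\<lambda>n. char (L n) t) \<longlonglongrightarrow> char M' t" for t
      by (rule Lim_transform_eventually[OF lim]) (use ev in \<open>auto elim: eventually_mono\<close>)
  qed
  hence lim': "(\<lambda>n. cdf (L n) x) \<longlonglongrightarrow> cdf M' x" if "isCont (cdf M') x" for x
    using that by (simp add: weak_conv_m_def weak_conv_def)
  have "(\<lambda>n. cdf (M n) x) \<longlonglongrightarrow> cdf M' x" if "isCont (cdf M') x" for x
    by (rule Lim_transform_eventually[OF lim'[OF that]]) (use ev in \<open>auto elim: eventually_mono\<close>)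
  thus ?thesis by (simp add: weak_conv_m_def weak_conv_def)
qed

lemma likelihood_ratio_cols_det:
  assumes "n > 0" "(\<Sum>l<q. d l) = p"
  shows "likelihood_ratio n p q d x = (cols_det n (cols x) 0 p / real n ^ p) powr (real n / 2) /
    (\<Prod>i<q. (cols_det n (cols x) (\<Sum>l<i. d l) (d i) / real n ^ d i) powr (real n / 2))"
  unfolding likelihood_ratio_def det_sample_cov[OF assms(1)]
  by (intro arg_cong2[of _ _ _ _ "(/)"] refl prod.cong) (simp add: det_mat_block_sample_cov[OF assms(1) _ assms(2)])

lemma block_end_le: "i < q \<Longrightarrow> (\<Sum>l<q. d l) = p \<Longrightarrow> (\<Sum>l<i. d l) + d i \<le> (p :: nat)" for i q :: nat
  using partial_sum_mono[of "Suc i" q d] by simp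

lemma likelihood_ratio_measurable:
  assumes "n > 0" "(\<Sum>l<q. d l) = p"
  shows "likelihood_ratio n p q d \<in> borel_measurable (rows_space n p)"
  unfolding likelihood_ratio_cols_det[OF assms, abs_def]
  by (intro borel_measurable_divide powr_real_measurable borel_measurable_prod borel_measurable_const cols_det_measurable)
    (use block_end_le[OF _ assms(2)] in auto)

lemma likelihood_ratio_cong:
  assumes n: "n > 0" and d: "(\<Sum>l<q. d l) = p" and x: "\<And>k. k < n \<Longrightarrow> x k = y k"
  shows "likelihood_ratio n p q d x = likelihood_ratio n p q d y"
proof -
  have "cols_det n (cols x) s m = cols_det n (cols y) s m" for s m
    by (intro cols_det_cong) (simp add: cols_def x)
  thus ?thesis unfolding likelihood_ratio_cols_det[OF n d] by simp
qed

text \<open>With \<open>p + 1 < n\<close> the Gram determinant is almost surely nonzero, so outside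
  a null set the statistic is a sum of increments. Positive definiteness and \<open>H0\<close> act
  through the representation of the normal law as a \<open>row_law\<close>.\<close>

lemma char_log_likelihood_ratio:
  fixes X :: "nat \<Rightarrow> 'a \<Rightarrow> nat \<Rightarrow> real" and s :: real
  assumes n: "p + 1 < n" and q: "q > 0" and d: "(\<Sum>i<q. d i) = p" and \<mu>: "\<mu> \<in> carrier_vec p"
    and S: "S \<in> carrier_mat p p" and pd: "positive_definite S" and M: "prob_space M"
    and indep: "prob_space.indep_vars M (\<lambda>_. Pi\<^sub>M {..<p} (\<lambda>_. borel)) X {..<n}"
    and normal: "\<And>k. k < n \<Longrightarrow> distr M (Pi\<^sub>M {..<p} (\<lambda>_. borel)) (X k) = multivariate_normal \<mu> S"
    and H0: "\<And>i j. i < q \<Longrightarrow> j < q \<Longrightarrow> i \<noteq> j \<Longrightarrow> mat_block d S i j = 0\<^sub>m (d i) (d j)"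
  defines "Y \<equiv> \<lambda>\<omega>. 2 / real n * ln (likelihood_ratio n p q d (\<lambda>k. X k \<omega>)) - s"
  shows "Y \<in> borel_measurable M"
    and "char (distr M borel Y) t =
      block_chi_ratio t n p q d * exp (- \<i> * of_real (t * s))"
proof -
  interpret M: prob_space M by fact
  have n0: "n > 0" using n by simp
  have rv: "X k \<in> M \<rightarrow>\<^sub>M Pi\<^sub>M {..<p} (\<lambda>_. borel)" if "k < n" for k
    using indep that unfolding M.indep_vars_def by auto
  have prob: "prob_space (multivariate_normal \<mu> S)"
    unfolding normal[OF n0, symmetric] by (rule M.prob_space_distr[OF rv[OF n0]])
  obtain beta tau where R: "triangular_rows tau (block_start d q)"
    "multivariate_normal \<mu> S = triangular_rows.row_law (\<lambda>i. \<mu> $ i) beta tau (block_start d q) p"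
  proof (rule multivariate_normal_row_law[OF q d \<mu> S pd _ prob])
    show "mat_block d S i j = 0\<^sub>m (d i) (d j)" if "i < q" "j < q" "i \<noteq> j" for i j by (rule H0[OF that])
    fix beta tau
    assume "triangular_rows tau (block_start d q)"
      "multivariate_normal \<mu> S = triangular_rows.row_law (\<lambda>i. \<mu> $ i) beta tau (block_start d q) p"
    thus thesis by (rule that)
  qed
  interpret R: triangular_rows "\<lambda>i. \<mu> $ i" beta tau "block_start d q" by (rule R(1))
  \<comment> \<open>Points of the product space are \<open>undefined\<close> outside
    \<open>{..<n}\<close>, whereas \<open>X k\<close> is given for all \<open>k\<close>; the
    statistic only sees the first \<open>n\<close> observations.\<close>
  define Z where "Z \<omega> = (\<lambda>k\<in>{..<n}. X k \<omega>)" for \<omega>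
  have Z: "Z \<in> M \<rightarrow>\<^sub>M rows_space n p" unfolding Z_def by (rule measurable_restrict) (use rv in auto)
  have "distr M (rows_space n p) Z = Pi\<^sub>M {..<n} (\<lambda>k. distr M (Pi\<^sub>M {..<p} (\<lambda>_. borel)) (X k))"
    using M.indep_vars_iff_distr_eq_PiM'[of "{..<n}" X "\<lambda>_. Pi\<^sub>M {..<p} (\<lambda>_. borel)"] indep rv n0
    unfolding Z_def by auto
  also have "\<dots> = R.rows_law n p" unfolding R.rows_law_def R(2)[symmetric] by (intro PiM_cong refl normal) auto
  finally have ZD: "distr M (rows_space n p) Z = R.rows_law n p" .
  define F where "F x = 2 / real n * ln (likelihood_ratio n p q d x)" for x
  have F [measurable]: "F \<in> borel_measurable (rows_space n p)"
    unfolding F_def[abs_def] using likelihood_ratio_measurable[OF n0 d] by (intro borel_measurable_times borel_measurable_ln) auto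
  have YF: "Y \<omega> = F (Z \<omega>) - s" for \<omega>
    unfolding Y_def F_def Z_def using likelihood_ratio_cong[OF n0 d, of "\<lambda>k. X k \<omega>" "\<lambda>k\<in>{..<n}. X k \<omega>"] by simp
  show Ym: "Y \<in> borel_measurable M" unfolding YF[abs_def] using measurable_compose[OF Z F] by simp
  have "AE x in R.rows_law n p. cols_det n (cols x) 0 p \<noteq> 0"
    using R.cols_det_nonzero_AE_char_increments[of p n t] n by auto
  hence AE: "AE x in R.rows_law n p. iexp (t * (F x - s)) = iexp (t * (\<Sum>b<p. R.increment n b x)) * exp (- \<i> * of_real (t * s))"
  proof eventually_elim
    case (elim x)
    have "F x = (\<Sum>b<p. R.increment n b x)" unfolding F_def by (rule R.ln_likelihood_ratio[OF refl d n elim])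
    thus ?case by (simp add: right_diff_distrib exp_diff exp_minus divide_inverse)
  qed
  have im: "(\<lambda>x. \<Sum>b<p. R.increment n b x) \<in> borel_measurable (R.rows_law n p)"
    by (intro borel_measurable_sum R.increment_measurable) auto
  have Fm: "F \<in> borel_measurable (R.rows_law n p)" unfolding ZD[symmetric] by simp
  note [measurable] = im Fm
  have "char (distr M borel Y) t = (LINT y|distr M borel Y. iexp (t * y))" by (simp only: char_def)
  also have "\<dots> = (LINT \<omega>|M. iexp (t * (F (Z \<omega>) - s)))"
    by (subst integral_distr[OF Ym]) (simp_all add: YF)
  also have "\<dots> = (LINT x|R.rows_law n p. iexp (t * (F x - s)))"
    unfolding ZD[symmetric] by (rule integral_distr[OF Z, symmetric]) measurable
  also have "\<dots> = (LINT x|R.rows_law n p. iexp (t * (\<Sum>b<p. R.increment n b x)) * exp (- \<i> * of_real (t * s)))"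
    by (rule integral_cong_AE[OF _ _ AE]) measurable
  also have "\<dots> = (LINT x|R.rows_law n p. iexp (t * (\<Sum>b<p. R.increment n b x))) * exp (- \<i> * of_real (t * s))"
    by (rule integral_mult_left_zero)
  also have "(LINT x|R.rows_law n p. iexp (t * (\<Sum>b<p. R.increment n b x))) =
     block_chi_ratio t n p q d"
    using R.cols_det_nonzero_AE_char_increments[of p n t] n R.chi_ratio_prod_blocks[OF refl d, of t n] by simp
  finally show "char (distr M borel Y) t =
      block_chi_ratio t n p q d * exp (- \<i> * of_real (t * s))" .
qed

theorem theorem2p1:
  fixes M :: "nat \<Rightarrow> 'a measure"
    and X :: "nat \<Rightarrow> nat \<Rightarrow> 'a \<Rightarrow> nat \<Rightarrow> real"
    and p q :: "nat \<Rightarrow> nat"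
    and d :: "nat \<Rightarrow> nat \<Rightarrow> nat"
    and \<mu> :: "nat \<Rightarrow> real vec"
    and \<Sigma> :: "nat \<Rightarrow> real mat"
    and lam :: "nat \<Rightarrow> real"
    and c \<sigma>2 :: real
    and s :: "nat \<Rightarrow> real"
  assumes p_pos: "\<And>n. n > 0 \<Longrightarrow> p n > 0"
    and q_pos: "\<And>n. n > 0 \<Longrightarrow> q n > 0"
    and d_pos: "\<And>n i. n > 0 \<Longrightarrow> i < q n \<Longrightarrow> d n i > 0"
    and d_sum: "\<And>n. n > 0 \<Longrightarrow> (\<Sum>i<q n. d n i) = p n"
    and mu_dim: "\<And>n. n > 0 \<Longrightarrow> \<mu> n \<in> carrier_vec (p n)"
    and Sigma_dim: "\<And>n. n > 0 \<Longrightarrow> \<Sigma> n \<in> carrier_mat (p n) (p n)"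
    and Sigma_pd: "\<And>n. n > 0 \<Longrightarrow> positive_definite (\<Sigma> n)"
    and prob: "\<And>n. n > 0 \<Longrightarrow> prob_space (M n)"
    and indep: "\<And>n. n > 0 \<Longrightarrow>
      prob_space.indep_vars (M n) (\<lambda>_. Pi\<^sub>M {..<p n} (\<lambda>_. borel)) (X n) {..<n}"
    and normal: "\<And>n k. n > 0 \<Longrightarrow> k < n \<Longrightarrow>
      distr (M n) (Pi\<^sub>M {..<p n} (\<lambda>_. borel)) (X n k) = multivariate_normal (\<mu> n) (\<Sigma> n)"
    and H0: "\<And>n i j. n > 0 \<Longrightarrow> i < q n \<Longrightarrow> j < q n \<Longrightarrow> i \<noteq> j \<Longrightarrow>
      mat_block (d n) (\<Sigma> n) i j = 0\<^sub>m (d n i) (d n j)"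
    and q_lim: "filterlim q at_top sequentially"
    and lam_range: "\<And>i. 0 < lam i \<and> lam i < 1"
    and d_lim: "\<And>i. (\<lambda>n. real (d n i) / real n) \<longlonglongrightarrow> lam i"
    and p_lim: "(\<lambda>n. real (p n) / real n) \<longlonglongrightarrow> c"
    and c_less: "c < 1"
    and lam_sum: "lam sums c"
    and sigma2: "\<sigma>2 = 2 * ln (inverse (1 - c) * (\<Prod>i. 1 - lam i))"
    and s: "\<And>n. n > 0 \<Longrightarrow> s n =
      (\<Sum>i<q n. (real n - real (d n i) - 1) * ln (1 - real (d n i) / (real n - 1)))
      - (real n - real (p n) - 1) * ln (1 - real (p n) / (real n - 1)) - \<sigma>2 / 4"
  shows "weak_conv_m
    (\<lambda>n. distr (M n) borel
      (\<lambda>\<omega>. 2 / real n * ln (likelihood_ratio n (p n) (q n) (d n) (\<lambda>k. X n k \<omega>)) - s n))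
    (density lborel (normal_density 0 (sqrt \<sigma>2)))"
proof -
  \<comment> \<open>Strictness yields \<open>\<sigma>2 > 0\<close>, so the limit law is
    nondegenerate and has the stated density.\<close>
  have "(\<Prod>i. 1 - lam i) > 1 - c" by (rule prodinf_one_minus_gt[OF lam_sum lam_range])
  hence "inverse (1 - c) * (\<Prod>i. 1 - lam i) > 1" using c_less by (simp add: field_simps)
  hence s2: "\<sigma>2 > 0" by (simp add: sigma2)
  define Y where "Y n \<omega> = 2 / real n * ln (likelihood_ratio n (p n) (q n) (d n) (\<lambda>k. X n k \<omega>)) - s n" for n \<omega>
  \<comment> \<open>Half of the gap \<open>1 - c\<close>: from \<open>p n / n < 1 - r\<close> and
    \<open>r * n > 1\<close> one gets \<open>p n + 1 < n\<close>.\<close>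
  define r where "r = (1 - c) / 2"
  have r: "r > 0" using c_less by (simp add: r_def)
  have "\<forall>\<^sub>F n in sequentially. real (p n) / real n < 1 - r"
    using p_lim by (rule order_tendstoD) (use c_less in \<open>simp add: r_def field_simps\<close>)
  moreover have "\<forall>\<^sub>F n in sequentially. r * real n > 1" using r by real_asymp
  ultimately have large: "\<forall>\<^sub>F n in sequentially. n > 0 \<and> p n + 1 < n"
    using eventually_gt_at_top[of 0]
  proof eventually_elim
    case (elim n)
    hence "real (p n) < real n - r * real n" by (simp add: field_simps)
    hence "real (p n + 1) < real n" using elim by simp
    thus ?case using elim by linarith
  qed
  have key: "Y n \<in> borel_measurable (M n)"
    "char (distr (M n) borel (Y n)) t =
      block_chi_ratio t n (p n) (q n) (d n) * exp (- \<i> * of_real (t * s n))"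
    if "n > 0" "p n + 1 < n" for n t
    unfolding Y_def
    by (rule char_log_likelihood_ratio[OF that(2) q_pos[OF that(1)] d_sum[OF that(1)] mu_dim[OF that(1)] Sigma_dim[OF that(1)]
      Sigma_pd[OF that(1)] prob[OF that(1)] indep[OF that(1)] normal[OF that(1)] H0[OF that(1)]]; assumption)+
  have "weak_conv_m (\<lambda>n. distr (M n) borel (Y n)) (density lborel (normal_density 0 (sqrt \<sigma>2)))"
  proof (rule weak_conv_m_char_eventually)
    show "\<forall>\<^sub>F n in sequentially. real_distribution (distr (M n) borel (Y n))"
      using large
    proof eventually_elim
      case (elim n)
      interpret M: prob_space "M n" using elim by (intro prob) auto
      show ?case using key(1)[of n] elim by (intro M.real_distribution_distr) auto
    qed
    have "prob_space (density lborel (normal_density 0 (sqrt \<sigma>2)))"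
      using s2 by (intro prob_space_normal_density) simp
    thus "real_distribution (density lborel (normal_density 0 (sqrt \<sigma>2)))"
      by (simp add: real_distribution_def real_distribution_axioms_def)
    fix t
    have "char (density lborel (normal_density 0 (sqrt \<sigma>2))) t = of_real (exp (- \<sigma>2 * t\<^sup>2 / 2))"
      using char_normal_density[of "sqrt \<sigma>2" t] s2 by simp
    moreover have "(\<lambda>n. char (distr (M n) borel (Y n)) t) \<longlonglongrightarrow> of_real (exp (- \<sigma>2 * t\<^sup>2 / 2))"
    proof (rule Lim_transform_eventually)
      show "(\<lambda>n. block_chi_ratio t n (p n) (q n) (d n)
        * exp (- \<i> * of_real (t * s n))) \<longlonglongrightarrow> of_real (exp (- \<sigma>2 * t\<^sup>2 / 2))"
        by (rule block_chi_ratio_limit[OF d_sum q_lim lam_range d_lim p_lim c_less lam_sum sigma2 s])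
      show "\<forall>\<^sub>F n in sequentially. block_chi_ratio t n (p n) (q n) (d n)
        * exp (- \<i> * of_real (t * s n)) = char (distr (M n) borel (Y n)) t"
        using large
      proof eventually_elim
        case (elim n)
        thus ?case using key(2)[of n t] by simp
      qed
    qed
    ultimately show "(\<lambda>n. char (distr (M n) borel (Y n)) t) \<longlonglongrightarrow> char (density lborel (normal_density 0 (sqrt \<sigma>2))) t"
      by simp
  qed
  thus ?thesis unfolding Y_def .
qed

end
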